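(* Let $(\underline{\mathcal C},\underline x)$ be a $G$-$A$-coring with a fixed grouplike family and left dual graded ring $R$. Then $\mathbb{GM}=(G*S,R,A\{G\},QG,\omega,\nu)$ is a graded Morita context, with connecting maps $$\omega:A\{G\}\otimes_RQG\to G*S,\quad \omega(\mu_\alpha(a)\otimes_R\omega_\sigma(\underline q))=u_{\alpha\sigma}\bigl(q_{\sigma\beta}(x_{(\sigma\beta)^{-1}}a)\bigr)_{\beta\in G},$$ $$\nu:QG\otimes_{G*S}A\{G\}\to R,\quad \nu(\omega_\sigma(\underline q)\otimes\mu_\alpha(a))=q_{\sigma\alpha}\cdot a.$$ If $\underline{\mathcal C}$ is left homogeneously finite, then the graded Morita contexts $\mathbb{GM}'=(G*S',R,A\{G\},Q'G,\omega',\nu')$ and $\mathbb{GM}$ are isomorphic.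
   Context: $G$ is a group with unit $e$, $A$ is a ring with unit. A $G$-$A$-coring $\underline{\mathcal C}$ is a family $(\mathcal C_\alpha)_{\alpha\in G}$ of $A$-bimodules with $A$-bimodule maps $\Delta_{\alpha,\beta}:\mathcal C_{\alpha\beta}\to\mathcal C_\alpha\otimes_A\mathcal C_\beta$, $\Delta_{\alpha,\beta}(c)=c_{(1,\alpha)}\otimes_Ac_{(2,\beta)}$, and $\varepsilon:\mathcal C_e\to A$ such that $(\Delta_{\alpha,\beta}\otimes_A\mathcal C_\gamma)\circ\Delta_{\alpha\beta,\gamma}=(\mathcal C_\alpha\otimes_A\Delta_{\beta,\gamma})\circ\Delta_{\alpha,\beta\gamma}$ and $(\mathcal C_\alpha\otimes_A\varepsilon)\circ\Delta_{\alpha,e}=\mathcal C_\alpha=(\varepsilon\otimes_A\mathcal C_\alpha)\circ\Delta_{e,\alpha}$. It is left homogeneously finite if every $\mathcal C_\alpha$ is finitely generated projective as a left $A$-module. A grouplike family is $\underline x=(x_\alpha)_\alpha\in\prod_\alpha\mathcal C_\alpha$ with $\Delta_{\alpha,\beta}(x_{\alpha\beta})=x_\alpha\otimes_Ax_\beta$, $\varepsilon(x_e)=1$. Left dual graded ring: $R=\bigoplus_\alpha R_\alpha$, $R_\alpha={}_A\mathrm{Hom}(\mathcal C_{\alpha^{-1}},A)$ (left $A$-linear maps), $(a\cdot f\cdot b)(c)=f(ca)b$, $(f\#g)(c)=g(c_{(1,\beta^{-1})}f(c_{(2,\alpha^{-1})}))$ for $f\in R_\alpha$, $g\in R_\beta$,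 $c\in\mathcal C_{(\alpha\beta)^{-1}}$, unit $\varepsilon$. $A\{G\}=\bigoplus_{\alpha\in G}\mu_\alpha(A)$ (copies of $A$), a $G$-graded right $R$-module via $\mu_\alpha(a)\cdot f=\mu_{\alpha\beta}(f(x_{\beta^{-1}}a))$ for $f\in R_\beta$. A graded Morita context $(S,R,P,Q,\varphi,\psi)$ consists of $G$-graded rings $S,R$, graded bimodules $P\in{}_S\mathcal M_R^G$, $Q\in{}_R\mathcal M_S^G$ and bimodule maps $\varphi:P\otimes_RQ\to S$, $\psi:Q\otimes_SP\to R$, homogeneous of degree $e$, with $\varphi(p\otimes q)p'=p\psi(q\otimes p')$ and $\psi(q\otimes p)q'=q\varphi(p\otimes q')$. An isomorphism of such contexts consists of graded ring isomorphisms and compatible graded bimodule isomorphisms commuting with the connecting maps. $S'=\{\underline b=(b_\alpha)_\alpha\in\prod_{\alpha\in G}A\mid f(b_{\alpha\beta}x_{\beta^{-1}})=f(x_{\beta^{-1}}b_\alpha)\ \forall\alpha,\beta\in G,f\in R_\beta\}$ and $S=\{\underline b\in\prod_{\alpha\in G}A\mid b_{\alpha\beta}x_{\beta^{-1}}=x_{\beta^{-1}}b_\alpha\ \forall\alpha,\beta\in G\}$ are rings under componentwise operations, with right $G$-action $\underline b^\sigma=(b_{\sigma\alpha})_\alpha$. $G*S=\bigoplus_\alpha u_\alpha S$ with $u_\alpha\underline b\,u_\beta\underline c=u_{\alpha\beta}\underline b^\beta\underline c$, graded by $\deg u_\alpha=\alpha$; it acts on the left on $A\{G\}$ by $u_\sigma\underline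 b\cdot\mu_\alpha(a)=\mu_{\sigma\alpha}(b_\alpha a)$. $G*S'$ and its action are defined in the same way. $Q=\{\underline q=(q_\alpha)_\alpha\in\prod_\alpha R_\alpha\mid c_{(1,\beta^{-1})}q_\alpha(c_{(2,\alpha^{-1})})=q_{\alpha\beta}(c)x_{\beta^{-1}}\ \forall\alpha,\beta\in G,c\in\mathcal C_{(\alpha\beta)^{-1}}\}$; $Q'=\{\underline q\in\prod_\alpha R_\alpha\mid f(c_{(1,\beta^{-1})}q_\alpha(c_{(2,\alpha^{-1})}))=f(q_{\alpha\beta}(c)x_{\beta^{-1}})\ \forall\alpha,\beta\in G,c\in\mathcal C_{(\alpha\beta)^{-1}},f\in R_\beta\}$. $QG=\bigoplus_\alpha\omega_\alpha(Q)$ (copies of $Q$, degree $\alpha$) is a graded $(R,G*S)$-bimodule: for $f\in R_\beta$, $f\cdot\omega_\alpha(\underline q)=\omega_{\beta\alpha}((f\#q_{\beta^{-1}\gamma})_{\gamma\in G})$; and $\omega_\alpha(\underline q)\cdot u_\tau\underline b=\omega_{\alpha\tau}(\underline q\cdot\underline b^{(\alpha\tau)^{-1}})$ with $\underline q\cdot\underline b=(q_\gamma\cdot b_\gamma)_{\gamma\in G}$. $Q'G$ is the graded $(R,G*S')$-bimodule defined by the same formulas from $Q'$, and $\omega',\nu'$ are given by the same formulas as $\omega,\nu$ (with $Q',S'$ in place of $Q,S$). *)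

theory Defs
  imports "HOL-Algebra.Free_Abelian_Groups" "HOL-Algebra.QuotRing"
begin

section \<open>Bimodules over rings that need not be commutative\<close>

text \<open>As for the library's record of modules, the multiplicative fields inherited from rings
  carry no information.\<close>

record ('a, 'b, 'm) bimod = "'m ring" +
  lsmult :: "'a \<Rightarrow> 'm \<Rightarrow> 'm" (infixr \<open>\<triangleright>\<index>\<close> 71)
  rsmult :: "'m \<Rightarrow> 'b \<Rightarrow> 'm" (infixl \<open>\<triangleleft>\<index>\<close> 72)

locale bimodule = A: ring A + B: ring B + M: abelian_group M
  for A :: "('a, 'w) ring_scheme" (structure) and B :: "('b, 'y) ring_scheme" (structure)
    and M :: "('a, 'b, 'm, 'z) bimod_scheme" (structure) +
  assumes lsmult_closed: "\<lbrakk>a \<in> carrier A; m \<in> carrier M\<rbrakk> \<Longrightarrow> a \<triangleright>\<^bsub>M\<^esub> m \<in> carrier M"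
    and lsmult_l_distr: "\<lbrakk>a \<in> carrier A; a' \<in> carrier A; m \<in> carrier M\<rbrakk> \<Longrightarrow>
      (a \<oplus>\<^bsub>A\<^esub> a') \<triangleright>\<^bsub>M\<^esub> m = (a \<triangleright>\<^bsub>M\<^esub> m) \<oplus>\<^bsub>M\<^esub> (a' \<triangleright>\<^bsub>M\<^esub> m)"
    and lsmult_r_distr: "\<lbrakk>a \<in> carrier A; m \<in> carrier M; m' \<in> carrier M\<rbrakk> \<Longrightarrow>
      a \<triangleright>\<^bsub>M\<^esub> (m \<oplus>\<^bsub>M\<^esub> m') = (a \<triangleright>\<^bsub>M\<^esub> m) \<oplus>\<^bsub>M\<^esub> (a \<triangleright>\<^bsub>M\<^esub> m')"
    and lsmult_assoc: "\<lbrakk>a \<in> carrier A; a' \<in> carrier A; m \<in> carrier M\<rbrakk> \<Longrightarrow>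
      (a \<otimes>\<^bsub>A\<^esub> a') \<triangleright>\<^bsub>M\<^esub> m = a \<triangleright>\<^bsub>M\<^esub> (a' \<triangleright>\<^bsub>M\<^esub> m)"
    and lsmult_one: "m \<in> carrier M \<Longrightarrow> \<one>\<^bsub>A\<^esub> \<triangleright>\<^bsub>M\<^esub> m = m"
    and rsmult_closed: "\<lbrakk>b \<in> carrier B; m \<in> carrier M\<rbrakk> \<Longrightarrow> m \<triangleleft>\<^bsub>M\<^esub> b \<in> carrier M"
    and rsmult_r_distr: "\<lbrakk>b \<in> carrier B; b' \<in> carrier B; m \<in> carrier M\<rbrakk> \<Longrightarrow>
      m \<triangleleft>\<^bsub>M\<^esub> (b \<oplus>\<^bsub>B\<^esub> b') = (m \<triangleleft>\<^bsub>M\<^esub> b) \<oplus>\<^bsub>M\<^esub> (m \<triangleleft>\<^bsub>M\<^esub> b')"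
    and rsmult_l_distr: "\<lbrakk>b \<in> carrier B; m \<in> carrier M; m' \<in> carrier M\<rbrakk> \<Longrightarrow>
      (m \<oplus>\<^bsub>M\<^esub> m') \<triangleleft>\<^bsub>M\<^esub> b = (m \<triangleleft>\<^bsub>M\<^esub> b) \<oplus>\<^bsub>M\<^esub> (m' \<triangleleft>\<^bsub>M\<^esub> b)"
    and rsmult_assoc: "\<lbrakk>b \<in> carrier B; b' \<in> carrier B; m \<in> carrier M\<rbrakk> \<Longrightarrow>
      m \<triangleleft>\<^bsub>M\<^esub> (b \<otimes>\<^bsub>B\<^esub> b') = (m \<triangleleft>\<^bsub>M\<^esub> b) \<triangleleft>\<^bsub>M\<^esub> b'"
    and rsmult_one: "m \<in> carrier M \<Longrightarrow> m \<triangleleft>\<^bsub>M\<^esub> \<one>\<^bsub>B\<^esub> = m"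
    and smult_commute: "\<lbrakk>a \<in> carrier A; b \<in> carrier B; m \<in> carrier M\<rbrakk> \<Longrightarrow>
      (a \<triangleright>\<^bsub>M\<^esub> m) \<triangleleft>\<^bsub>M\<^esub> b = a \<triangleright>\<^bsub>M\<^esub> (m \<triangleleft>\<^bsub>M\<^esub> b)"

definition regular_bimod :: "('a, 'z) ring_scheme \<Rightarrow> ('a, 'a, 'a) bimod" where
  "regular_bimod A = \<lparr>carrier = carrier A, mult = mult A, one = one A, zero = zero A, add = add A,
     lsmult = mult A, rsmult = mult A\<rparr>"

definition bimod_hom ::
  "('a, 'w) ring_scheme \<Rightarrow> ('b, 'x) ring_scheme \<Rightarrow> ('a, 'b, 'm, 'y) bimod_scheme \<Rightarrow>
    ('a, 'b, 'n, 'z) bimod_scheme \<Rightarrow> ('m \<Rightarrow> 'n) set" where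
  "bimod_hom A B M N = {f \<in> hom (add_monoid M) (add_monoid N).
     (\<forall>a\<in>carrier A. \<forall>m\<in>carrier M. f (a \<triangleright>\<^bsub>M\<^esub> m) = a \<triangleright>\<^bsub>N\<^esub> f m) \<and>
     (\<forall>b\<in>carrier B. \<forall>m\<in>carrier M. f (m \<triangleleft>\<^bsub>M\<^esub> b) = f m \<triangleleft>\<^bsub>N\<^esub> b)}"

text \<open>Left linear maps are extensional, so that equality in the module of all
  left linear maps is equality of functions on the carrier.\<close>

definition left_hom ::
  "('a, 'w) ring_scheme \<Rightarrow> ('a, 'b, 'm, 'y) bimod_scheme \<Rightarrow> ('a, 'c, 'n, 'z) bimod_scheme \<Rightarrow>
    ('m \<Rightarrow> 'n) set" where
  "left_hom A M N = {f \<in> hom (add_monoid M) (add_monoid N) \<inter> extensional (carrier M).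
     \<forall>a\<in>carrier A. \<forall>m\<in>carrier M. f (a \<triangleright>\<^bsub>M\<^esub> m) = a \<triangleright>\<^bsub>N\<^esub> f m}"

definition left_dual ::
  "('a, 'w) ring_scheme \<Rightarrow> ('a, 'a, 'm, 'y) bimod_scheme \<Rightarrow> ('a, 'a, 'm \<Rightarrow> 'a) bimod" where
  "left_dual A M = \<lparr>carrier = left_hom A M (regular_bimod A), mult = undefined, one = undefined,
     zero = (\<lambda>m\<in>carrier M. \<zero>\<^bsub>A\<^esub>), add = (\<lambda>f g. \<lambda>m\<in>carrier M. f m \<oplus>\<^bsub>A\<^esub> g m),
     lsmult = (\<lambda>a f. \<lambda>m\<in>carrier M. f (m \<triangleleft>\<^bsub>M\<^esub> a)),
     rsmult = (\<lambda>f b. \<lambda>m\<in>carrier M. f m \<otimes>\<^bsub>A\<^esub> b)\<rparr>"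

definition free_bimod :: "('a, 'w) ring_scheme \<Rightarrow> 'i set \<Rightarrow> ('a, 'a, 'i \<Rightarrow> 'a) bimod" where
  "free_bimod A I = (let F = sum_group I (\<lambda>_. add_monoid A) in
     \<lparr>carrier = carrier F, mult = undefined, one = undefined, zero = one F, add = mult F,
      lsmult = (\<lambda>a v. \<lambda>i\<in>I. a \<otimes>\<^bsub>A\<^esub> v i), rsmult = (\<lambda>v a. \<lambda>i\<in>I. v i \<otimes>\<^bsub>A\<^esub> a)\<rparr>)"

definition left_finitely_generated ::
  "('a, 'w) ring_scheme \<Rightarrow> ('a, 'b, 'm, 'y) bimod_scheme \<Rightarrow> bool" where
  "left_finitely_generated A M \<longleftrightarrow> (\<exists>X. finite X \<and> X \<subseteq> carrier M \<and>
     (\<forall>m\<in>carrier M. \<exists>k\<in>X \<rightarrow> carrier A. m = (\<Oplus>\<^bsub>M\<^esub>y\<in>X. k y \<triangleright>\<^bsub>M\<^esub> y)))"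

text \<open>Projective means: a direct summand of a free left module. Index sets \<open>I\<close> taken from the type of
  the elements of \<open>M\<close> suffice, since a projective module is a direct summand of the free module
  on any of its generating sets, for instance on its whole carrier.\<close>

definition left_projective ::
  "('a, 'w) ring_scheme \<Rightarrow> ('a, 'b, 'm, 'y) bimod_scheme \<Rightarrow> bool" where
  "left_projective A M \<longleftrightarrow> (\<exists>(I :: 'm set) i p. i \<in> left_hom A M (free_bimod A I) \<and>
     p \<in> left_hom A (free_bimod A I) M \<and> (\<forall>m\<in>carrier M. p (i m) = m))"


section \<open>Tensor products\<close>

text \<open>The tensor product of a right and a left \<open>A\<close>-module is the quotient of the free abelian group on
  \<open>carrier M \<times> carrier N\<close> by the subgroup generated by the usual relations.\<close>

definition tensor_rels ::
  "('a, 'w) ring_scheme \<Rightarrow> ('b, 'a, 'm, 'y) bimod_scheme \<Rightarrow> ('a, 'c, 'n, 'z) bimod_scheme \<Rightarrow>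
    ('m \<times> 'n \<Rightarrow>\<^sub>0 int) set" where
  "tensor_rels A M N = generate (free_Abelian_group (carrier M \<times> carrier N))
     ({frag_of (m \<oplus>\<^bsub>M\<^esub> m', n) - frag_of (m, n) - frag_of (m', n) | m m' n.
         m \<in> carrier M \<and> m' \<in> carrier M \<and> n \<in> carrier N} \<union>
      {frag_of (m, n \<oplus>\<^bsub>N\<^esub> n') - frag_of (m, n) - frag_of (m, n') | m n n'.
         m \<in> carrier M \<and> n \<in> carrier N \<and> n' \<in> carrier N} \<union>
      {frag_of (m \<triangleleft>\<^bsub>M\<^esub> a, n) - frag_of (m, a \<triangleright>\<^bsub>N\<^esub> n) | m a n.
         m \<in> carrier M \<and> a \<in> carrier A \<and> n \<in> carrier N})"

definition tensor_group ::
  "('a, 'w) ring_scheme \<Rightarrow> ('b, 'a, 'm, 'y) bimod_scheme \<Rightarrow> ('a, 'c, 'n, 'z) bimod_scheme \<Rightarrow>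
    ('m \<times> 'n \<Rightarrow>\<^sub>0 int) set monoid" where
  "tensor_group A M N = free_Abelian_group (carrier M \<times> carrier N) Mod tensor_rels A M N"

definition pure_tensor ::
  "('a, 'w) ring_scheme \<Rightarrow> ('b, 'a, 'm, 'y) bimod_scheme \<Rightarrow> ('a, 'c, 'n, 'z) bimod_scheme \<Rightarrow>
    'm \<Rightarrow> 'n \<Rightarrow> ('m \<times> 'n \<Rightarrow>\<^sub>0 int) set" where
  "pure_tensor A M N m n =
     tensor_rels A M N #>\<^bsub>free_Abelian_group (carrier M \<times> carrier N)\<^esub> frag_of (m, n)"

text \<open>The additive map \<open>M \<otimes> N \<rightarrow> V\<close> with \<open>m \<otimes> n \<mapsto> f m n\<close>; it exists and is unique
  if \<open>V\<close> is an abelian group and \<open>f\<close> is biadditive and \<open>A\<close>-balanced.\<close>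

definition tensor_lift ::
  "('a, 'w) ring_scheme \<Rightarrow> ('b, 'a, 'm, 'y) bimod_scheme \<Rightarrow> ('a, 'c, 'n, 'z) bimod_scheme \<Rightarrow>
    ('v, 'u) monoid_scheme \<Rightarrow> ('m \<Rightarrow> 'n \<Rightarrow> 'v) \<Rightarrow> ('m \<times> 'n \<Rightarrow>\<^sub>0 int) set \<Rightarrow> 'v" where
  "tensor_lift A M N V f = (THE h. h \<in> hom (tensor_group A M N) V \<and>
     h \<in> extensional (carrier (tensor_group A M N)) \<and>
     (\<forall>m\<in>carrier M. \<forall>n\<in>carrier N. h (pure_tensor A M N m n) = f m n))"

definition tensor ::
  "('a, 'w) ring_scheme \<Rightarrow> ('b, 'a, 'm, 'y) bimod_scheme \<Rightarrow> ('a, 'c, 'n, 'z) bimod_scheme \<Rightarrow>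
    ('b, 'c, ('m \<times> 'n \<Rightarrow>\<^sub>0 int) set) bimod" where
  "tensor A M N = (let T = tensor_group A M N in
     \<lparr>carrier = carrier T, mult = undefined, one = undefined, zero = one T, add = mult T,
      lsmult = (\<lambda>b. tensor_lift A M N T (\<lambda>m n. pure_tensor A M N (b \<triangleright>\<^bsub>M\<^esub> m) n)),
      rsmult = (\<lambda>t c. tensor_lift A M N T (\<lambda>m n. pure_tensor A M N m (n \<triangleleft>\<^bsub>N\<^esub> c)) t)\<rparr>)"

definition tensor_map ::
  "('a, 'w) ring_scheme \<Rightarrow> ('b, 'a, 'm, 'x) bimod_scheme \<Rightarrow> ('a, 'c, 'n, 'y) bimod_scheme \<Rightarrow>
    ('b, 'a, 'm', 'z) bimod_scheme \<Rightarrow> ('a, 'c, 'n', 'u) bimod_scheme \<Rightarrow>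
    ('m \<Rightarrow> 'm') \<Rightarrow> ('n \<Rightarrow> 'n') \<Rightarrow> ('m \<times> 'n \<Rightarrow>\<^sub>0 int) set \<Rightarrow> ('m' \<times> 'n' \<Rightarrow>\<^sub>0 int) set" where
  "tensor_map A M N M' N' f g =
     tensor_lift A M N (tensor_group A M' N') (\<lambda>m n. pure_tensor A M' N' (f m) (g n))"

text \<open>The canonical map \<open>(M \<otimes> N) \<otimes> P \<rightarrow> M \<otimes> (N \<otimes> P)\<close>.\<close>

definition tensor_assoc ::
  "('a, 'w) ring_scheme \<Rightarrow> ('b, 'a, 'm, 'x) bimod_scheme \<Rightarrow> ('a, 'a, 'n, 'y) bimod_scheme \<Rightarrow>
    ('a, 'c, 'p, 'z) bimod_scheme \<Rightarrow> (('m \<times> 'n \<Rightarrow>\<^sub>0 int) set \<times> 'p \<Rightarrow>\<^sub>0 int) set \<Rightarrow>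
    ('m \<times> ('n \<times> 'p \<Rightarrow>\<^sub>0 int) set \<Rightarrow>\<^sub>0 int) set" where
  "tensor_assoc A M N P = (let T = tensor_group A M (tensor A N P) in
     tensor_lift A (tensor A M N) P T (\<lambda>t p.
       tensor_lift A M N T (\<lambda>m n. pure_tensor A M (tensor A N P) m (pure_tensor A N P n p)) t))"

text \<open>The canonical maps \<open>M \<otimes> A \<rightarrow> M\<close> and \<open>A \<otimes> M \<rightarrow> M\<close>.\<close>

definition tensor_runit ::
  "('a, 'w) ring_scheme \<Rightarrow> ('b, 'a, 'm, 'y) bimod_scheme \<Rightarrow> ('m \<times> 'a \<Rightarrow>\<^sub>0 int) set \<Rightarrow> 'm" where
  "tensor_runit A M = tensor_lift A M (regular_bimod A) (add_monoid M) (\<lambda>m a. m \<triangleleft>\<^bsub>M\<^esub> a)"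

definition tensor_lunit ::
  "('a, 'w) ring_scheme \<Rightarrow> ('a, 'c, 'm, 'y) bimod_scheme \<Rightarrow> ('a \<times> 'm \<Rightarrow>\<^sub>0 int) set \<Rightarrow> 'm" where
  "tensor_lunit A M = tensor_lift A (regular_bimod A) M (add_monoid M) (\<lambda>a m. a \<triangleright>\<^bsub>M\<^esub> m)"


section \<open>Graded rings, graded bimodules and graded Morita contexts\<close>

record ('g, 'r) gr_ring = "'r ring" +
  rcomp :: "'g \<Rightarrow> 'r set"

record ('g, 'a, 'b, 'm) gr_bimod = "('a, 'b, 'm) bimod" +
  bcomp :: "'g \<Rightarrow> 'm set"

definition internal_direct_sum ::
  "('g, 'w) monoid_scheme \<Rightarrow> ('m, 'y) ring_scheme \<Rightarrow> ('g \<Rightarrow> 'm set) \<Rightarrow> bool" where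
  "internal_direct_sum G M D \<longleftrightarrow>
     (\<forall>\<alpha>\<in>carrier G. subgroup (D \<alpha>) (add_monoid M)) \<and>
     (\<forall>m\<in>carrier M. \<exists>!d. d \<in> (\<Pi>\<^sub>E \<alpha>\<in>carrier G. D \<alpha>) \<and> finite {\<alpha>\<in>carrier G. d \<alpha> \<noteq> \<zero>\<^bsub>M\<^esub>} \<and>
        m = (\<Oplus>\<^bsub>M\<^esub>\<alpha>\<in>{\<alpha>\<in>carrier G. d \<alpha> \<noteq> \<zero>\<^bsub>M\<^esub>}. d \<alpha>))"

locale graded_ring = G: group G + R: ring R
  for G :: "('g, 'w) monoid_scheme" (structure) and R :: "('g, 'r, 'z) gr_ring_scheme" (structure) +
  assumes rcomp_direct_sum: "internal_direct_sum G R (rcomp R)"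
    and rcomp_mult: "\<lbrakk>\<alpha> \<in> carrier G; \<beta> \<in> carrier G; r \<in> rcomp R \<alpha>; s \<in> rcomp R \<beta>\<rbrakk> \<Longrightarrow>
      r \<otimes>\<^bsub>R\<^esub> s \<in> rcomp R (\<alpha> \<otimes>\<^bsub>G\<^esub> \<beta>)"

locale graded_bimodule = S: graded_ring G S + R: graded_ring G R + P: bimodule S R P
  for G :: "('g, 'w) monoid_scheme" (structure)
    and S :: "('g, 's, 'x) gr_ring_scheme" (structure)
    and R :: "('g, 'r, 'y) gr_ring_scheme" (structure)
    and P :: "('g, 's, 'r, 'p, 'z) gr_bimod_scheme" (structure) +
  assumes bcomp_direct_sum: "internal_direct_sum G P (bcomp P)"
    and bcomp_lsmult: "\<lbrakk>\<alpha> \<in> carrier G; \<beta> \<in> carrier G; s \<in> rcomp S \<alpha>; p \<in> bcomp P \<beta>\<rbrakk> \<Longrightarrow>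
      s \<triangleright>\<^bsub>P\<^esub> p \<in> bcomp P (\<alpha> \<otimes>\<^bsub>G\<^esub> \<beta>)"
    and bcomp_rsmult: "\<lbrakk>\<alpha> \<in> carrier G; \<beta> \<in> carrier G; p \<in> bcomp P \<alpha>; r \<in> rcomp R \<beta>\<rbrakk> \<Longrightarrow>
      p \<triangleleft>\<^bsub>P\<^esub> r \<in> bcomp P (\<alpha> \<otimes>\<^bsub>G\<^esub> \<beta>)"

definition gr_regular :: "('g, 'r, 'z) gr_ring_scheme \<Rightarrow> ('g, 'r, 'r, 'r) gr_bimod" where
  "gr_regular R = \<lparr>carrier = carrier R, mult = mult R, one = one R, zero = zero R, add = add R,
     lsmult = mult R, rsmult = mult R, bcomp = rcomp R\<rparr>"

definition gr_tensor ::
  "('g, 'w) monoid_scheme \<Rightarrow> ('a, 'x) ring_scheme \<Rightarrow> ('g, 'b, 'a, 'm, 'y) gr_bimod_scheme \<Rightarrow>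
    ('g, 'a, 'c, 'n, 'z) gr_bimod_scheme \<Rightarrow> ('g, 'b, 'c, ('m \<times> 'n \<Rightarrow>\<^sub>0 int) set) gr_bimod" where
  "gr_tensor G A M N = (let T = tensor A M N in
     \<lparr>carrier = carrier T, mult = mult T, one = one T, zero = zero T, add = add T,
      lsmult = lsmult T, rsmult = rsmult T,
      bcomp = (\<lambda>\<gamma>. generate (tensor_group A M N) {pure_tensor A M N m n | \<alpha> \<beta> m n.
        \<alpha> \<in> carrier G \<and> \<beta> \<in> carrier G \<and> \<alpha> \<otimes>\<^bsub>G\<^esub> \<beta> = \<gamma> \<and> m \<in> bcomp M \<alpha> \<and> n \<in> bcomp N \<beta>})\<rparr>)"

text \<open>Bimodule maps that are homogeneous of degree the unit of \<open>G\<close>.\<close>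

definition gr_bimod_hom ::
  "('g, 'u) monoid_scheme \<Rightarrow> ('a, 'w) ring_scheme \<Rightarrow> ('b, 'x) ring_scheme \<Rightarrow>
    ('g, 'a, 'b, 'm, 'y) gr_bimod_scheme \<Rightarrow> ('g, 'a, 'b, 'n, 'z) gr_bimod_scheme \<Rightarrow>
    ('m \<Rightarrow> 'n) set" where
  "gr_bimod_hom G A B M N =
     {f \<in> bimod_hom A B M N. \<forall>\<gamma>\<in>carrier G. f ` bcomp M \<gamma> \<subseteq> bcomp N \<gamma>}"

record ('g, 's, 'r, 'p, 'q) gr_context =
  ctx_S :: "('g, 's) gr_ring"
  ctx_R :: "('g, 'r) gr_ring"
  ctx_P :: "('g, 's, 'r, 'p) gr_bimod"
  ctx_Q :: "('g, 'r, 's, 'q) gr_bimod"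
  ctx_phi :: "('p \<times> 'q \<Rightarrow>\<^sub>0 int) set \<Rightarrow> 's"
  ctx_psi :: "('q \<times> 'p \<Rightarrow>\<^sub>0 int) set \<Rightarrow> 'r"

definition graded_morita_context ::
  "('g, 'w) monoid_scheme \<Rightarrow> ('g, 's, 'r, 'p, 'q) gr_context \<Rightarrow> bool" where
  "graded_morita_context G K \<longleftrightarrow>
    (let S = ctx_S K; R = ctx_R K; P = ctx_P K; Q = ctx_Q K; \<phi> = ctx_phi K; \<psi> = ctx_psi K in
      graded_ring G S \<and> graded_ring G R \<and> graded_bimodule G S R P \<and> graded_bimodule G R S Q \<and>
      \<phi> \<in> gr_bimod_hom G S S (gr_tensor G R P Q) (gr_regular S) \<and>
      \<psi> \<in> gr_bimod_hom G R R (gr_tensor G S Q P) (gr_regular R) \<and>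
      (\<forall>p\<in>carrier P. \<forall>q\<in>carrier Q. \<forall>p'\<in>carrier P.
        \<phi> (pure_tensor R P Q p q) \<triangleright>\<^bsub>P\<^esub> p' = p \<triangleleft>\<^bsub>P\<^esub> \<psi> (pure_tensor S Q P q p')) \<and>
      (\<forall>q\<in>carrier Q. \<forall>p\<in>carrier P. \<forall>q'\<in>carrier Q.
        \<psi> (pure_tensor S Q P q p) \<triangleright>\<^bsub>Q\<^esub> q' = q \<triangleleft>\<^bsub>Q\<^esub> \<phi> (pure_tensor R P Q p q')))"

definition gr_ring_iso ::
  "('g, 'w) monoid_scheme \<Rightarrow> ('g, 'r, 'y) gr_ring_scheme \<Rightarrow> ('g, 's, 'z) gr_ring_scheme \<Rightarrow>
    ('r \<Rightarrow> 's) set" where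
  "gr_ring_iso G R S = {h \<in> ring_iso R S. \<forall>\<gamma>\<in>carrier G. h ` rcomp R \<gamma> = rcomp S \<gamma>}"

text \<open>Isomorphisms of graded bimodules along isomorphisms \<open>f\<close> and \<open>g\<close> of the rings acting
  on the left and on the right.\<close>

definition gr_bimod_iso ::
  "('g, 'u) monoid_scheme \<Rightarrow> ('a, 'w) ring_scheme \<Rightarrow> ('b, 'x) ring_scheme \<Rightarrow> ('a \<Rightarrow> 'a') \<Rightarrow>
    ('b \<Rightarrow> 'b') \<Rightarrow> ('g, 'a, 'b, 'm, 'y) gr_bimod_scheme \<Rightarrow>
    ('g, 'a', 'b', 'n, 'z) gr_bimod_scheme \<Rightarrow> ('m \<Rightarrow> 'n) set" where
  "gr_bimod_iso G A B f g M N = {h \<in> iso (add_monoid M) (add_monoid N).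
     (\<forall>a\<in>carrier A. \<forall>m\<in>carrier M. h (a \<triangleright>\<^bsub>M\<^esub> m) = f a \<triangleright>\<^bsub>N\<^esub> h m) \<and>
     (\<forall>b\<in>carrier B. \<forall>m\<in>carrier M. h (m \<triangleleft>\<^bsub>M\<^esub> b) = h m \<triangleleft>\<^bsub>N\<^esub> g b) \<and>
     (\<forall>\<gamma>\<in>carrier G. h ` bcomp M \<gamma> = bcomp N \<gamma>)}"

definition gr_context_isomorphic ::
  "('g, 'w) monoid_scheme \<Rightarrow> ('g, 's, 'r, 'p, 'q) gr_context \<Rightarrow>
    ('g, 's', 'r', 'p', 'q') gr_context \<Rightarrow> bool" where
  "gr_context_isomorphic G K L \<longleftrightarrow>
    (\<exists>fS fR fP fQ.
      fS \<in> gr_ring_iso G (ctx_S K) (ctx_S L) \<and>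
      fR \<in> gr_ring_iso G (ctx_R K) (ctx_R L) \<and>
      fP \<in> gr_bimod_iso G (ctx_S K) (ctx_R K) fS fR (ctx_P K) (ctx_P L) \<and>
      fQ \<in> gr_bimod_iso G (ctx_R K) (ctx_S K) fR fS (ctx_Q K) (ctx_Q L) \<and>
      (\<forall>p\<in>carrier (ctx_P K). \<forall>q\<in>carrier (ctx_Q K).
        fS (ctx_phi K (pure_tensor (ctx_R K) (ctx_P K) (ctx_Q K) p q)) =
        ctx_phi L (pure_tensor (ctx_R L) (ctx_P L) (ctx_Q L) (fP p) (fQ q))) \<and>
      (\<forall>q\<in>carrier (ctx_Q K). \<forall>p\<in>carrier (ctx_P K).
        fR (ctx_psi K (pure_tensor (ctx_S K) (ctx_Q K) (ctx_P K) q p)) =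
        ctx_psi L (pure_tensor (ctx_S L) (ctx_Q L) (ctx_P L) (fQ q) (fP p))))"


section \<open>External direct sums and operations given on homogeneous elements\<close>

definition homogeneous ::
  "('g, 'w) monoid_scheme \<Rightarrow> ('g \<Rightarrow> ('m, 'y) ring_scheme) \<Rightarrow> 'g \<Rightarrow> 'm \<Rightarrow> 'g \<Rightarrow> 'm" where
  "homogeneous G X \<alpha> m = (\<lambda>\<beta>\<in>carrier G. if \<beta> = \<alpha> then m else \<zero>\<^bsub>X \<beta>\<^esub>)"

definition gr_ring_of ::
  "('g, 'w) monoid_scheme \<Rightarrow> ('g \<Rightarrow> ('r, 'y) ring_scheme) \<Rightarrow>
    (('g \<Rightarrow> 'r) \<Rightarrow> ('g \<Rightarrow> 'r) \<Rightarrow> ('g \<Rightarrow> 'r)) \<Rightarrow> ('g \<Rightarrow> 'r) \<Rightarrow> ('g, 'g \<Rightarrow> 'r) gr_ring" where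
  "gr_ring_of G X m u = (let D = sum_group (carrier G) (\<lambda>\<alpha>. add_monoid (X \<alpha>)) in
     \<lparr>carrier = carrier D, mult = m, one = u, zero = one D, add = mult D,
      rcomp = (\<lambda>\<alpha>. homogeneous G X \<alpha> ` carrier (X \<alpha>))\<rparr>)"

definition gr_bimod_of ::
  "('g, 'w) monoid_scheme \<Rightarrow> ('g \<Rightarrow> ('m, 'y) ring_scheme) \<Rightarrow>
    ('a \<Rightarrow> ('g \<Rightarrow> 'm) \<Rightarrow> ('g \<Rightarrow> 'm)) \<Rightarrow> (('g \<Rightarrow> 'm) \<Rightarrow> 'b \<Rightarrow> ('g \<Rightarrow> 'm)) \<Rightarrow>
    ('g, 'a, 'b, 'g \<Rightarrow> 'm) gr_bimod" where
  "gr_bimod_of G X l r = (let D = sum_group (carrier G) (\<lambda>\<alpha>. add_monoid (X \<alpha>)) in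
     \<lparr>carrier = carrier D, mult = undefined, one = undefined, zero = one D, add = mult D,
      lsmult = l, rsmult = r, bcomp = (\<lambda>\<alpha>. homogeneous G X \<alpha> ` carrier (X \<alpha>))\<rparr>)"

text \<open>The biadditive extension of a family of biadditive maps
  \<open>op \<alpha> \<beta> : X\<^sub>\<alpha> \<times> Y\<^sub>\<beta> \<rightarrow> Z\<^sub>\<alpha>\<^sub>\<beta>\<close> to the direct sums: its component of degree \<open>\<gamma>\<close> is the sum of
  \<open>op \<alpha> \<beta> (v\<^sub>\<alpha>) (w\<^sub>\<beta>)\<close> over all \<open>\<alpha>\<close>, \<open>\<beta>\<close> with \<open>\<alpha>\<beta> = \<gamma>\<close>.\<close>

definition graded_ext ::
  "('g, 'w) monoid_scheme \<Rightarrow> ('g \<Rightarrow> ('x, 'y) ring_scheme) \<Rightarrow> ('g \<Rightarrow> ('z, 'u) ring_scheme) \<Rightarrow>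
    ('g \<Rightarrow> 'g \<Rightarrow> 'x \<Rightarrow> 'v \<Rightarrow> 'z) \<Rightarrow> ('g \<Rightarrow> 'x) \<Rightarrow> ('g \<Rightarrow> 'v) \<Rightarrow> 'g \<Rightarrow> 'z" where
  "graded_ext G X Z op v w = (\<lambda>\<gamma>\<in>carrier G.
     \<Oplus>\<^bsub>Z \<gamma>\<^esub>\<alpha>\<in>{\<alpha>\<in>carrier G. v \<alpha> \<noteq> \<zero>\<^bsub>X \<alpha>\<^esub>}.
       op \<alpha> (inv\<^bsub>G\<^esub> \<alpha> \<otimes>\<^bsub>G\<^esub> \<gamma>) (v \<alpha>) (w (inv\<^bsub>G\<^esub> \<alpha> \<otimes>\<^bsub>G\<^esub> \<gamma>)))"

lemma graded_ext_homogeneous: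
  assumes G: "group G" and ab: "\<alpha> \<in> carrier G" "\<beta> \<in> carrier G"
    and Z: "\<And>\<gamma>. \<gamma> \<in> carrier G \<Longrightarrow> abelian_group (Z \<gamma>)"
    and closed: "op \<alpha> \<beta> a b \<in> carrier (Z (\<alpha> \<otimes>\<^bsub>G\<^esub> \<beta>))"
    and zero_left: "op \<alpha> \<beta> \<zero>\<^bsub>X \<alpha>\<^esub> b = \<zero>\<^bsub>Z (\<alpha> \<otimes>\<^bsub>G\<^esub> \<beta>)\<^esub>"
    and zero_right: "\<And>\<gamma>. \<gamma> \<in> carrier G \<Longrightarrow> op \<alpha> \<gamma> a \<zero>\<^bsub>Y \<gamma>\<^esub> = \<zero>\<^bsub>Z (\<alpha> \<otimes>\<^bsub>G\<^esub> \<gamma>)\<^esub>"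
  shows "graded_ext G X Z op (homogeneous G X \<alpha> a) (homogeneous G Y \<beta> b) =
    homogeneous G Z (\<alpha> \<otimes>\<^bsub>G\<^esub> \<beta>) (op \<alpha> \<beta> a b)"
proof
  fix \<gamma>
  interpret G: group G by (rule G)
  show "graded_ext G X Z op (homogeneous G X \<alpha> a) (homogeneous G Y \<beta> b) \<gamma> =
    homogeneous G Z (\<alpha> \<otimes>\<^bsub>G\<^esub> \<beta>) (op \<alpha> \<beta> a b) \<gamma>"
  proof (cases "\<gamma> \<in> carrier G")
    case False
    then show ?thesis by (simp add: graded_ext_def homogeneous_def)
  next
    case True
    interpret Z: abelian_group "Z \<gamma>" by (rule Z[OF True])
    have mem: "inv\<^bsub>G\<^esub> \<alpha> \<otimes>\<^bsub>G\<^esub> \<gamma> \<in> carrier G" using ab True by simp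
    have deg: "inv\<^bsub>G\<^esub> \<alpha> \<otimes>\<^bsub>G\<^esub> \<gamma> = \<beta> \<longleftrightarrow> \<gamma> = \<alpha> \<otimes>\<^bsub>G\<^esub> \<beta>"
      using ab True by (metis G.inv_solve_left)
    have cancel: "inv\<^bsub>G\<^esub> \<alpha> \<otimes>\<^bsub>G\<^esub> (\<alpha> \<otimes>\<^bsub>G\<^esub> \<beta>) = \<beta>"
      using ab by (simp add: G.m_assoc[symmetric])
    have undo: "\<alpha> \<otimes>\<^bsub>G\<^esub> (inv\<^bsub>G\<^esub> \<alpha> \<otimes>\<^bsub>G\<^esub> \<gamma>) = \<gamma>"
      using ab True by (simp add: G.m_assoc[symmetric])
    show ?thesis
    proof (cases "a = \<zero>\<^bsub>X \<alpha>\<^esub>")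
      case a0: True
      have supp: "{\<delta> \<in> carrier G. homogeneous G X \<alpha> a \<delta> \<noteq> \<zero>\<^bsub>X \<delta>\<^esub>} = {}"
        using a0 by (auto simp: homogeneous_def)
      have "graded_ext G X Z op (homogeneous G X \<alpha> a) (homogeneous G Y \<beta> b) \<gamma> = \<zero>\<^bsub>Z \<gamma>\<^esub>"
        unfolding graded_ext_def supp using True by simp
      then show ?thesis using True a0 zero_left by (simp add: homogeneous_def)
    next
      case a0: False
      have supp: "{\<delta> \<in> carrier G. homogeneous G X \<alpha> a \<delta> \<noteq> \<zero>\<^bsub>X \<delta>\<^esub>} = {\<alpha>}"
        using a0 ab by (auto simp: homogeneous_def)
      have val: "op \<alpha> (inv\<^bsub>G\<^esub> \<alpha> \<otimes>\<^bsub>G\<^esub> \<gamma>) (homogeneous G X \<alpha> a \<alpha>)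
          (homogeneous G Y \<beta> b (inv\<^bsub>G\<^esub> \<alpha> \<otimes>\<^bsub>G\<^esub> \<gamma>)) =
          homogeneous G Z (\<alpha> \<otimes>\<^bsub>G\<^esub> \<beta>) (op \<alpha> \<beta> a b) \<gamma>"
        using True ab mem deg zero_right[OF mem] undo cancel by (auto simp: homogeneous_def)
      have "homogeneous G Z (\<alpha> \<otimes>\<^bsub>G\<^esub> \<beta>) (op \<alpha> \<beta> a b) \<gamma> \<in> carrier (Z \<gamma>)"
        using True closed by (simp add: homogeneous_def)
      then show ?thesis using True supp val by (simp add: graded_ext_def)
    qed
  qed
qed


section \<open>Group corings and the context associated with a grouplike family\<close>

text \<open>Throughout, \<open>f \<in> R\<^sub>\<alpha>\<close> has domain \<open>C\<close> of the inverse of \<open>\<alpha>\<close>.\<close>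

locale coring_data =
  fixes G :: "('g, 'w) monoid_scheme" (structure)
    and A :: "('a, 'z) ring_scheme" (structure)
    and C :: "'g \<Rightarrow> ('a, 'a, 'c) bimod"
    and \<Delta> :: "'g \<Rightarrow> 'g \<Rightarrow> 'c \<Rightarrow> ('c \<times> 'c \<Rightarrow>\<^sub>0 int) set"
    and \<epsilon> :: "'c \<Rightarrow> 'a"
    and x :: "'g \<Rightarrow> 'c"
begin

definition left_homogeneously_finite :: bool where
  "left_homogeneously_finite \<longleftrightarrow>
     (\<forall>\<alpha>\<in>carrier G. left_finitely_generated A (C \<alpha>) \<and> left_projective A (C \<alpha>))"

definition Rc :: "'g \<Rightarrow> ('a, 'a, 'c \<Rightarrow> 'a) bimod" where
  "Rc \<alpha> = left_dual A (C (inv\<^bsub>G\<^esub> \<alpha>))"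

text \<open>\<open>(f # g)(c) = g(c\<^sub>1 f(c\<^sub>2))\<close> for \<open>f \<in> R\<^sub>\<alpha>\<close>, \<open>g \<in> R\<^sub>\<beta>\<close>.\<close>

definition conv :: "'g \<Rightarrow> 'g \<Rightarrow> ('c \<Rightarrow> 'a) \<Rightarrow> ('c \<Rightarrow> 'a) \<Rightarrow> ('c \<Rightarrow> 'a)" where
  "conv \<alpha> \<beta> f g = (\<lambda>c\<in>carrier (C (inv\<^bsub>G\<^esub> (\<alpha> \<otimes>\<^bsub>G\<^esub> \<beta>))).
     tensor_lift A (C (inv\<^bsub>G\<^esub> \<beta>)) (C (inv\<^bsub>G\<^esub> \<alpha>)) (add_monoid A)
       (\<lambda>c1 c2. g (c1 \<triangleleft>\<^bsub>C (inv\<^bsub>G\<^esub> \<beta>)\<^esub> f c2)) (\<Delta> (inv\<^bsub>G\<^esub> \<beta>) (inv\<^bsub>G\<^esub> \<alpha>) c))"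

definition dual_ring :: "('g, 'g \<Rightarrow> 'c \<Rightarrow> 'a) gr_ring" where
  "dual_ring = gr_ring_of G Rc (graded_ext G Rc Rc conv)
     (homogeneous G Rc \<one>\<^bsub>G\<^esub> (restrict \<epsilon> (carrier (C \<one>\<^bsub>G\<^esub>))))"

definition Sset :: "('g \<Rightarrow> 'a) set" where
  "Sset = {b \<in> \<Pi>\<^sub>E \<alpha>\<in>carrier G. carrier A. \<forall>\<alpha>\<in>carrier G. \<forall>\<beta>\<in>carrier G.
     b (\<alpha> \<otimes>\<^bsub>G\<^esub> \<beta>) \<triangleright>\<^bsub>C (inv\<^bsub>G\<^esub> \<beta>)\<^esub> x (inv\<^bsub>G\<^esub> \<beta>) = x (inv\<^bsub>G\<^esub> \<beta>) \<triangleleft>\<^bsub>C (inv\<^bsub>G\<^esub> \<beta>)\<^esub> b \<alpha>}"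

definition Sset' :: "('g \<Rightarrow> 'a) set" where
  "Sset' = {b \<in> \<Pi>\<^sub>E \<alpha>\<in>carrier G. carrier A. \<forall>\<alpha>\<in>carrier G. \<forall>\<beta>\<in>carrier G. \<forall>f\<in>carrier (Rc \<beta>).
     f (b (\<alpha> \<otimes>\<^bsub>G\<^esub> \<beta>) \<triangleright>\<^bsub>C (inv\<^bsub>G\<^esub> \<beta>)\<^esub> x (inv\<^bsub>G\<^esub> \<beta>)) = f (x (inv\<^bsub>G\<^esub> \<beta>) \<triangleleft>\<^bsub>C (inv\<^bsub>G\<^esub> \<beta>)\<^esub> b \<alpha>)}"

text \<open>\<open>c \<mapsto> c\<^sub>1 q(c\<^sub>2)\<close> for \<open>q \<in> R\<^sub>\<alpha>\<close> and \<open>c\<close> of degree the inverse of \<open>\<alpha>\<beta>\<close>; the value has degree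
  the inverse of \<open>\<beta>\<close>.\<close>

definition contract :: "'g \<Rightarrow> 'g \<Rightarrow> ('c \<Rightarrow> 'a) \<Rightarrow> 'c \<Rightarrow> 'c" where
  "contract \<alpha> \<beta> q c = tensor_lift A (C (inv\<^bsub>G\<^esub> \<beta>)) (C (inv\<^bsub>G\<^esub> \<alpha>)) (add_monoid (C (inv\<^bsub>G\<^esub> \<beta>)))
     (\<lambda>c1 c2. c1 \<triangleleft>\<^bsub>C (inv\<^bsub>G\<^esub> \<beta>)\<^esub> q c2) (\<Delta> (inv\<^bsub>G\<^esub> \<beta>) (inv\<^bsub>G\<^esub> \<alpha>) c)"

definition Qset :: "('g \<Rightarrow> 'c \<Rightarrow> 'a) set" where
  "Qset = {q \<in> \<Pi>\<^sub>E \<alpha>\<in>carrier G. carrier (Rc \<alpha>). \<forall>\<alpha>\<in>carrier G. \<forall>\<beta>\<in>carrier G.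
     \<forall>c\<in>carrier (C (inv\<^bsub>G\<^esub> (\<alpha> \<otimes>\<^bsub>G\<^esub> \<beta>))).
       contract \<alpha> \<beta> (q \<alpha>) c = q (\<alpha> \<otimes>\<^bsub>G\<^esub> \<beta>) c \<triangleright>\<^bsub>C (inv\<^bsub>G\<^esub> \<beta>)\<^esub> x (inv\<^bsub>G\<^esub> \<beta>)}"

definition Qset' :: "('g \<Rightarrow> 'c \<Rightarrow> 'a) set" where
  "Qset' = {q \<in> \<Pi>\<^sub>E \<alpha>\<in>carrier G. carrier (Rc \<alpha>). \<forall>\<alpha>\<in>carrier G. \<forall>\<beta>\<in>carrier G.
     \<forall>c\<in>carrier (C (inv\<^bsub>G\<^esub> (\<alpha> \<otimes>\<^bsub>G\<^esub> \<beta>))). \<forall>f\<in>carrier (Rc \<beta>).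
       f (contract \<alpha> \<beta> (q \<alpha>) c) = f (q (\<alpha> \<otimes>\<^bsub>G\<^esub> \<beta>) c \<triangleright>\<^bsub>C (inv\<^bsub>G\<^esub> \<beta>)\<^esub> x (inv\<^bsub>G\<^esub> \<beta>))}"

text \<open>The remaining constructions are the same for \<open>(S, Q)\<close> and for \<open>(S', Q')\<close>, and
  are parametrised by the underlying sets \<open>B\<close> of \<open>S\<close> or \<open>S'\<close> and \<open>W\<close> of \<open>Q\<close> or \<open>Q'\<close>.\<close>

definition Sring :: "('g \<Rightarrow> 'a) set \<Rightarrow> ('g \<Rightarrow> 'a) ring" where
  "Sring B = \<lparr>carrier = B, mult = (\<lambda>b d. \<lambda>\<alpha>\<in>carrier G. b \<alpha> \<otimes>\<^bsub>A\<^esub> d \<alpha>), one = (\<lambda>\<alpha>\<in>carrier G. \<one>\<^bsub>A\<^esub>),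
     zero = (\<lambda>\<alpha>\<in>carrier G. \<zero>\<^bsub>A\<^esub>), add = (\<lambda>b d. \<lambda>\<alpha>\<in>carrier G. b \<alpha> \<oplus>\<^bsub>A\<^esub> d \<alpha>)\<rparr>"

definition Qmod :: "('g \<Rightarrow> 'c \<Rightarrow> 'a) set \<Rightarrow> ('g \<Rightarrow> 'c \<Rightarrow> 'a) ring" where
  "Qmod W = \<lparr>carrier = W, mult = undefined, one = undefined,
     zero = (\<lambda>\<alpha>\<in>carrier G. \<zero>\<^bsub>Rc \<alpha>\<^esub>), add = (\<lambda>p q. \<lambda>\<alpha>\<in>carrier G. p \<alpha> \<oplus>\<^bsub>Rc \<alpha>\<^esub> q \<alpha>)\<rparr>"

definition translate :: "('g \<Rightarrow> 'a) \<Rightarrow> 'g \<Rightarrow> ('g \<Rightarrow> 'a)" where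
  "translate b \<sigma> = (\<lambda>\<alpha>\<in>carrier G. b (\<sigma> \<otimes>\<^bsub>G\<^esub> \<alpha>))"

text \<open>\<open>smash B\<close> is \<open>G * S\<close> with \<open>u\<^sub>\<alpha> b u\<^sub>\<beta> d = u\<^sub>\<alpha>\<^sub>\<beta> b\<^sup>\<beta> d\<close>, \<open>AG\<close> is \<open>A{G}\<close>. In these constructions the first
  argument of \<open>graded_ext\<close> after \<open>G\<close> gives the summands of its left operand, the second those of
  the result, and the third the operation on homogeneous elements, with their degrees.\<close>

definition smash :: "('g \<Rightarrow> 'a) set \<Rightarrow> ('g, 'g \<Rightarrow> 'g \<Rightarrow> 'a) gr_ring" where
  "smash B = gr_ring_of G (\<lambda>_. Sring B)
     (graded_ext G (\<lambda>_. Sring B) (\<lambda>_. Sring B) (\<lambda>\<alpha> \<beta> b d. translate b \<beta> \<otimes>\<^bsub>Sring B\<^esub> d))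
     (homogeneous G (\<lambda>_. Sring B) \<one>\<^bsub>G\<^esub> \<one>\<^bsub>Sring B\<^esub>)"

definition AG :: "('g \<Rightarrow> 'a) set \<Rightarrow> ('g, 'g \<Rightarrow> 'g \<Rightarrow> 'a, 'g \<Rightarrow> 'c \<Rightarrow> 'a, 'g \<Rightarrow> 'a) gr_bimod" where
  "AG B = gr_bimod_of G (\<lambda>_. A)
     (graded_ext G (\<lambda>_. Sring B) (\<lambda>_. A) (\<lambda>\<sigma> \<alpha> b a. b \<alpha> \<otimes>\<^bsub>A\<^esub> a))
     (graded_ext G (\<lambda>_. A) (\<lambda>_. A) (\<lambda>\<alpha> \<beta> a f. f (x (inv\<^bsub>G\<^esub> \<beta>) \<triangleleft>\<^bsub>C (inv\<^bsub>G\<^esub> \<beta>)\<^esub> a)))"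

definition QG :: "('g \<Rightarrow> 'c \<Rightarrow> 'a) set \<Rightarrow>
    ('g, 'g \<Rightarrow> 'c \<Rightarrow> 'a, 'g \<Rightarrow> 'g \<Rightarrow> 'a, 'g \<Rightarrow> 'g \<Rightarrow> 'c \<Rightarrow> 'a) gr_bimod" where
  "QG W = gr_bimod_of G (\<lambda>_. Qmod W)
     (graded_ext G Rc (\<lambda>_. Qmod W)
       (\<lambda>\<beta> \<alpha> f q. \<lambda>\<gamma>\<in>carrier G. conv \<beta> (inv\<^bsub>G\<^esub> \<beta> \<otimes>\<^bsub>G\<^esub> \<gamma>) f (q (inv\<^bsub>G\<^esub> \<beta> \<otimes>\<^bsub>G\<^esub> \<gamma>))))
     (graded_ext G (\<lambda>_. Qmod W) (\<lambda>_. Qmod W)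
       (\<lambda>\<alpha> \<tau> q b. \<lambda>\<gamma>\<in>carrier G. q \<gamma> \<triangleleft>\<^bsub>Rc \<gamma>\<^esub> translate b (inv\<^bsub>G\<^esub> (\<alpha> \<otimes>\<^bsub>G\<^esub> \<tau>)) \<gamma>))"

definition mu_elt :: "'g \<Rightarrow> 'a \<Rightarrow> ('g \<Rightarrow> 'a)" where
  "mu_elt = homogeneous G (\<lambda>_. A)"

definition u_elt :: "('g \<Rightarrow> 'a) set \<Rightarrow> 'g \<Rightarrow> ('g \<Rightarrow> 'a) \<Rightarrow> ('g \<Rightarrow> 'g \<Rightarrow> 'a)" where
  "u_elt B = homogeneous G (\<lambda>_. Sring B)"

definition om_elt :: "('g \<Rightarrow> 'c \<Rightarrow> 'a) set \<Rightarrow> 'g \<Rightarrow> ('g \<Rightarrow> 'c \<Rightarrow> 'a) \<Rightarrow> ('g \<Rightarrow> 'g \<Rightarrow> 'c \<Rightarrow> 'a)" where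
  "om_elt W = homogeneous G (\<lambda>_. Qmod W)"

definition R_elt :: "'g \<Rightarrow> ('c \<Rightarrow> 'a) \<Rightarrow> ('g \<Rightarrow> 'c \<Rightarrow> 'a)" where
  "R_elt = homogeneous G Rc"

text \<open>On homogeneous elements, the connecting maps are
  \<open>\<mu>\<^sub>\<alpha>(a) \<otimes> \<omega>\<^sub>\<sigma>(q) \<mapsto> u\<^sub>\<alpha>\<^sub>\<sigma> (omega_val \<sigma> q a)\<close> and \<open>\<omega>\<^sub>\<sigma>(q) \<otimes> \<mu>\<^sub>\<alpha>(a) \<mapsto> q\<^sub>\<sigma>\<^sub>\<alpha> \<cdot> a\<close>.\<close>

definition omega_val :: "'g \<Rightarrow> ('g \<Rightarrow> 'c \<Rightarrow> 'a) \<Rightarrow> 'a \<Rightarrow> ('g \<Rightarrow> 'a)" where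
  "omega_val \<sigma> q a = (\<lambda>\<beta>\<in>carrier G.
     q (\<sigma> \<otimes>\<^bsub>G\<^esub> \<beta>) (x (inv\<^bsub>G\<^esub> (\<sigma> \<otimes>\<^bsub>G\<^esub> \<beta>)) \<triangleleft>\<^bsub>C (inv\<^bsub>G\<^esub> (\<sigma> \<otimes>\<^bsub>G\<^esub> \<beta>))\<^esub> a))"

definition omega_map :: "('g \<Rightarrow> 'a) set \<Rightarrow> ('g \<Rightarrow> 'c \<Rightarrow> 'a) set \<Rightarrow>
    (('g \<Rightarrow> 'a) \<times> ('g \<Rightarrow> 'g \<Rightarrow> 'c \<Rightarrow> 'a) \<Rightarrow>\<^sub>0 int) set \<Rightarrow> ('g \<Rightarrow> 'g \<Rightarrow> 'a)" where
  "omega_map B W = tensor_lift dual_ring (AG B) (QG W) (add_monoid (smash B))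
     (graded_ext G (\<lambda>_. A) (\<lambda>_. Sring B) (\<lambda>\<alpha> \<sigma> a q. omega_val \<sigma> q a))"

definition nu_map :: "('g \<Rightarrow> 'a) set \<Rightarrow> ('g \<Rightarrow> 'c \<Rightarrow> 'a) set \<Rightarrow>
    (('g \<Rightarrow> 'g \<Rightarrow> 'c \<Rightarrow> 'a) \<times> ('g \<Rightarrow> 'a) \<Rightarrow>\<^sub>0 int) set \<Rightarrow> ('g \<Rightarrow> 'c \<Rightarrow> 'a)" where
  "nu_map B W = tensor_lift (smash B) (QG W) (AG B) (add_monoid dual_ring)
     (graded_ext G (\<lambda>_. Qmod W) Rc (\<lambda>\<sigma> \<alpha> q a. q (\<sigma> \<otimes>\<^bsub>G\<^esub> \<alpha>) \<triangleleft>\<^bsub>Rc (\<sigma> \<otimes>\<^bsub>G\<^esub> \<alpha>)\<^esub> a))"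

definition connecting_formulas :: "('g \<Rightarrow> 'a) set \<Rightarrow> ('g \<Rightarrow> 'c \<Rightarrow> 'a) set \<Rightarrow> bool" where
  "connecting_formulas B W \<longleftrightarrow>
     (\<forall>\<alpha>\<in>carrier G. \<forall>\<sigma>\<in>carrier G. \<forall>a\<in>carrier A. \<forall>q\<in>W.
       omega_map B W (pure_tensor dual_ring (AG B) (QG W) (mu_elt \<alpha> a) (om_elt W \<sigma> q)) =
         u_elt B (\<alpha> \<otimes>\<^bsub>G\<^esub> \<sigma>) (omega_val \<sigma> q a) \<and>
       nu_map B W (pure_tensor (smash B) (QG W) (AG B) (om_elt W \<sigma> q) (mu_elt \<alpha> a)) =
         R_elt (\<sigma> \<otimes>\<^bsub>G\<^esub> \<alpha>) (q (\<sigma> \<otimes>\<^bsub>G\<^esub> \<alpha>) \<triangleleft>\<^bsub>Rc (\<sigma> \<otimes>\<^bsub>G\<^esub> \<alpha>)\<^esub> a))"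

definition context_of :: "('g \<Rightarrow> 'a) set \<Rightarrow> ('g \<Rightarrow> 'c \<Rightarrow> 'a) set \<Rightarrow>
    ('g, 'g \<Rightarrow> 'g \<Rightarrow> 'a, 'g \<Rightarrow> 'c \<Rightarrow> 'a, 'g \<Rightarrow> 'a, 'g \<Rightarrow> 'g \<Rightarrow> 'c \<Rightarrow> 'a) gr_context" where
  "context_of B W = \<lparr>ctx_S = smash B, ctx_R = dual_ring, ctx_P = AG B, ctx_Q = QG W,
     ctx_phi = omega_map B W, ctx_psi = nu_map B W\<rparr>"

definition GM where "GM = context_of Sset Qset"

definition GM' where "GM' = context_of Sset' Qset'"

end

text \<open>\<open>\<alpha>\<beta>\<gamma>\<close> denotes the same index however it is bracketed, so coassociativity compares the two
  iterated comultiplications after identifying \<open>(C\<^sub>\<alpha> \<otimes> C\<^sub>\<beta>) \<otimes> C\<^sub>\<gamma>\<close> with \<open>C\<^sub>\<alpha> \<otimes> (C\<^sub>\<beta> \<otimes> C\<^sub>\<gamma>)\<close>;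
  similarly \<open>C\<^sub>\<alpha> \<otimes> A\<close> and \<open>A \<otimes> C\<^sub>\<alpha>\<close> are identified with \<open>C\<^sub>\<alpha>\<close> in the counit laws.\<close>

locale group_coring = G: group G + A: ring A
  for G :: "('g, 'w) monoid_scheme" (structure) and A :: "('a, 'z) ring_scheme" (structure) +
  fixes C :: "'g \<Rightarrow> ('a, 'a, 'c) bimod"
    and \<Delta> :: "'g \<Rightarrow> 'g \<Rightarrow> 'c \<Rightarrow> ('c \<times> 'c \<Rightarrow>\<^sub>0 int) set"
    and \<epsilon> :: "'c \<Rightarrow> 'a"
  assumes bimodule_C: "\<alpha> \<in> carrier G \<Longrightarrow> bimodule A A (C \<alpha>)"
    and Delta_hom: "\<lbrakk>\<alpha> \<in> carrier G; \<beta> \<in> carrier G\<rbrakk> \<Longrightarrow>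
      \<Delta> \<alpha> \<beta> \<in> bimod_hom A A (C (\<alpha> \<otimes>\<^bsub>G\<^esub> \<beta>)) (tensor A (C \<alpha>) (C \<beta>))"
    and eps_hom: "\<epsilon> \<in> bimod_hom A A (C \<one>\<^bsub>G\<^esub>) (regular_bimod A)"
    and coassoc: "\<lbrakk>\<alpha> \<in> carrier G; \<beta> \<in> carrier G; \<gamma> \<in> carrier G;
        c \<in> carrier (C (\<alpha> \<otimes>\<^bsub>G\<^esub> \<beta> \<otimes>\<^bsub>G\<^esub> \<gamma>))\<rbrakk> \<Longrightarrow>
      tensor_assoc A (C \<alpha>) (C \<beta>) (C \<gamma>)
        (tensor_map A (C (\<alpha> \<otimes>\<^bsub>G\<^esub> \<beta>)) (C \<gamma>) (tensor A (C \<alpha>) (C \<beta>)) (C \<gamma>) (\<Delta> \<alpha> \<beta>) (\<lambda>c. c)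
          (\<Delta> (\<alpha> \<otimes>\<^bsub>G\<^esub> \<beta>) \<gamma> c)) =
      tensor_map A (C \<alpha>) (C (\<beta> \<otimes>\<^bsub>G\<^esub> \<gamma>)) (C \<alpha>) (tensor A (C \<beta>) (C \<gamma>)) (\<lambda>c. c) (\<Delta> \<beta> \<gamma>)
        (\<Delta> \<alpha> (\<beta> \<otimes>\<^bsub>G\<^esub> \<gamma>) c)"
    and counit_right: "\<lbrakk>\<alpha> \<in> carrier G; c \<in> carrier (C \<alpha>)\<rbrakk> \<Longrightarrow>
      tensor_runit A (C \<alpha>)
        (tensor_map A (C \<alpha>) (C \<one>\<^bsub>G\<^esub>) (C \<alpha>) (regular_bimod A) (\<lambda>c. c) \<epsilon> (\<Delta> \<alpha> \<one>\<^bsub>G\<^esub> c)) = c"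
    and counit_left: "\<lbrakk>\<alpha> \<in> carrier G; c \<in> carrier (C \<alpha>)\<rbrakk> \<Longrightarrow>
      tensor_lunit A (C \<alpha>)
        (tensor_map A (C \<one>\<^bsub>G\<^esub>) (C \<alpha>) (regular_bimod A) (C \<alpha>) \<epsilon> (\<lambda>c. c) (\<Delta> \<one>\<^bsub>G\<^esub> \<alpha> c)) = c"

locale group_coring_with_grouplike =
  group_coring G A C \<Delta> \<epsilon> + coring_data G A C \<Delta> \<epsilon> x
  for G :: "('g, 'w) monoid_scheme" (structure)
    and A :: "('a, 'z) ring_scheme" (structure)
    and C :: "'g \<Rightarrow> ('a, 'a, 'c) bimod" and \<Delta> and \<epsilon> and x +
  assumes x_closed: "\<alpha> \<in> carrier G \<Longrightarrow> x \<alpha> \<in> carrier (C \<alpha>)"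
    and Delta_x: "\<lbrakk>\<alpha> \<in> carrier G; \<beta> \<in> carrier G\<rbrakk> \<Longrightarrow>
      \<Delta> \<alpha> \<beta> (x (\<alpha> \<otimes>\<^bsub>G\<^esub> \<beta>)) = pure_tensor A (C \<alpha>) (C \<beta>) (x \<alpha>) (x \<beta>)"
    and eps_x: "\<epsilon> (x \<one>\<^bsub>G\<^esub>) = \<one>\<^bsub>A\<^esub>"

end

theory Submission
  imports Defs
begin

text \<open>Every structure map in sight sends pairs of homogeneous elements to a homogeneous element, so a graded
  Morita context is determined by what happens on homogeneous elements. There it resembles a ring of
  \<open>2 \<times> 2\<close> matrices with \<open>S\<close> and \<open>R\<close> on the diagonal and \<open>P\<close> and \<open>Q\<close> off it: there are eight biadditive
  products, and, besides unit laws, the ring and module axioms, the balancedness and linearity of the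
  connecting maps and the two Morita identities amount to the sixteen laws \<open>(ab)c = a(bc)\<close> for
  composable entries. \<open>graded_ext_associative\<close> carries such a law from homogeneous elements to the direct sums,
  because both sides are additive in each argument, and the locale \<open>homogeneous_morita\<close> assembles the
  context from the sixteen laws. The connecting maps live on tensor products, so the universal property
  of the tensor product (\<open>tensor_lift_props\<close>) is established beforehand.

  To check the sixteen laws for a coring, the comultiplication is only ever used through the maps
  \<open>K\<^sub>f : c \<mapsto> c\<^sub>1 f(c\<^sub>2)\<close> attached to left linear forms \<open>f\<close>; in terms of them \<open>f # g = g \<circ> K\<^sub>f\<close>. The coring
  axioms become: \<open>K\<^sub>f\<close> is left linear; \<open>K\<close> of \<open>f # g\<close> is \<open>K\<^sub>g \<circ> K\<^sub>f\<close> (coassociativity, \<open>slice_comp\<close>);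
  \<open>K\<^sub>\<epsilon>\<close> is the identity and \<open>\<epsilon> \<circ> K\<^sub>f = f\<close> (the counit laws). For the grouplike family,
  \<open>K\<^sub>f (x a) = x f(x a)\<close>; the condition defining \<open>Q\<close> says \<open>K\<close> of \<open>q\<^sub>\<alpha>\<close> is \<open>c \<mapsto> q\<^sub>\<alpha>\<^sub>\<beta>(c) x\<close>, and the condition
  defining \<open>S\<close> says \<open>x b\<^sub>\<alpha> = b\<^sub>\<alpha>\<^sub>\<beta> x\<close>. With these rules each law is a short computation.

  The conditions defining \<open>S'\<close> and \<open>Q'\<close> are those defining \<open>S\<close> and \<open>Q\<close> with every left linear form
  applied to them. A projective module embeds in a free one, so its forms separate its points
  (\<open>left_projective_separates\<close>); hence in the left homogeneously finite case \<open>S' = S\<close> and \<open>Q' = Q\<close>, and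
  the isomorphism of contexts is the identity.\<close>

section \<open>Tensor products over a ring\<close>

definition biadditive ::
  "('m, 'x) ring_scheme \<Rightarrow> ('n, 'y) ring_scheme \<Rightarrow> ('v, 'z) monoid_scheme \<Rightarrow>
    ('m \<Rightarrow> 'n \<Rightarrow> 'v) \<Rightarrow> bool" where
  "biadditive M N V f \<longleftrightarrow>
     (\<forall>m\<in>carrier M. \<forall>n\<in>carrier N. f m n \<in> carrier V) \<and>
     (\<forall>m\<in>carrier M. \<forall>m'\<in>carrier M. \<forall>n\<in>carrier N. f (m \<oplus>\<^bsub>M\<^esub> m') n = f m n \<otimes>\<^bsub>V\<^esub> f m' n) \<and>
     (\<forall>m\<in>carrier M. \<forall>n\<in>carrier N. \<forall>n'\<in>carrier N. f m (n \<oplus>\<^bsub>N\<^esub> n') = f m n \<otimes>\<^bsub>V\<^esub> f m n')"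

lemma biadditiveI:
  assumes "\<And>m n. \<lbrakk>m \<in> carrier M; n \<in> carrier N\<rbrakk> \<Longrightarrow> f m n \<in> carrier V"
    and "\<And>m m' n. \<lbrakk>m \<in> carrier M; m' \<in> carrier M; n \<in> carrier N\<rbrakk> \<Longrightarrow>
      f (m \<oplus>\<^bsub>M\<^esub> m') n = f m n \<otimes>\<^bsub>V\<^esub> f m' n"
    and "\<And>m n n'. \<lbrakk>m \<in> carrier M; n \<in> carrier N; n' \<in> carrier N\<rbrakk> \<Longrightarrow>
      f m (n \<oplus>\<^bsub>N\<^esub> n') = f m n \<otimes>\<^bsub>V\<^esub> f m n'"
  shows "biadditive M N V f"
  using assms by (simp add: biadditive_def)

lemma biadditiveD:
  assumes "biadditive M N V f"
  shows "\<And>m n. \<lbrakk>m \<in> carrier M; n \<in> carrier N\<rbrakk> \<Longrightarrow> f m n \<in> carrier V"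
    and "\<And>m m' n. \<lbrakk>m \<in> carrier M; m' \<in> carrier M; n \<in> carrier N\<rbrakk> \<Longrightarrow>
      f (m \<oplus>\<^bsub>M\<^esub> m') n = f m n \<otimes>\<^bsub>V\<^esub> f m' n"
    and "\<And>m n n'. \<lbrakk>m \<in> carrier M; n \<in> carrier N; n' \<in> carrier N\<rbrakk> \<Longrightarrow>
      f m (n \<oplus>\<^bsub>N\<^esub> n') = f m n \<otimes>\<^bsub>V\<^esub> f m n'"
  using assms by (simp_all add: biadditive_def)

lemma biadditive_zero:
  assumes "biadditive M N V f" "abelian_group M" "abelian_group N" "group V"
  shows "n \<in> carrier N \<Longrightarrow> f \<zero>\<^bsub>M\<^esub> n = \<one>\<^bsub>V\<^esub>" and "m \<in> carrier M \<Longrightarrow> f m \<zero>\<^bsub>N\<^esub> = \<one>\<^bsub>V\<^esub>"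
proof -
  interpret M: abelian_group M by (rule assms)
  interpret N: abelian_group N by (rule assms)
  interpret V: group V by (rule assms)
  note D = biadditiveD[OF assms(1)]
  show "f \<zero>\<^bsub>M\<^esub> n = \<one>\<^bsub>V\<^esub>" if "n \<in> carrier N"
    using D(1)[of "\<zero>\<^bsub>M\<^esub>" n] D(2)[of "\<zero>\<^bsub>M\<^esub>" "\<zero>\<^bsub>M\<^esub>" n] that by simp
  show "f m \<zero>\<^bsub>N\<^esub> = \<one>\<^bsub>V\<^esub>" if "m \<in> carrier M"
    using D(1)[of m "\<zero>\<^bsub>N\<^esub>"] D(3)[of m "\<zero>\<^bsub>N\<^esub>" "\<zero>\<^bsub>N\<^esub>"] that by simp
qed

definition balanced ::
  "('a, 'w) ring_scheme \<Rightarrow> ('b, 'a, 'm, 'x) bimod_scheme \<Rightarrow> ('a, 'c, 'n, 'y) bimod_scheme \<Rightarrow>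
    ('v, 'z) monoid_scheme \<Rightarrow> ('m \<Rightarrow> 'n \<Rightarrow> 'v) \<Rightarrow> bool" where
  "balanced A M N V f \<longleftrightarrow> biadditive M N V f \<and>
     (\<forall>m\<in>carrier M. \<forall>a\<in>carrier A. \<forall>n\<in>carrier N. f (m \<triangleleft>\<^bsub>M\<^esub> a) n = f m (a \<triangleright>\<^bsub>N\<^esub> n))"

lemma balancedI:
  assumes "biadditive M N V f"
    and "\<And>m a n. \<lbrakk>m \<in> carrier M; a \<in> carrier A; n \<in> carrier N\<rbrakk> \<Longrightarrow>
      f (m \<triangleleft>\<^bsub>M\<^esub> a) n = f m (a \<triangleright>\<^bsub>N\<^esub> n)"
  shows "balanced A M N V f"
  using assms by (simp add: balanced_def)

lemma hom_trivial_on_generate: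
  assumes "group_hom F V h" and "R \<subseteq> carrier F" and "\<And>r. r \<in> R \<Longrightarrow> h r = \<one>\<^bsub>V\<^esub>"
    and "r \<in> generate F R"
  shows "h r = \<one>\<^bsub>V\<^esub>"
proof -
  interpret group_hom F V h by (rule assms)
  have "generate F R \<subseteq> kernel F V h"
    using assms(2,3) by (intro G.generate_subgroup_incl subgroup_kernel) (auto simp: kernel_def)
  then show ?thesis using assms(4) by (auto simp: kernel_def)
qed

locale tensor_factors = M: abelian_group M + N: abelian_group N
  for A :: "('a, 'w) ring_scheme"
    and M :: "('b, 'a, 'm, 'x) bimod_scheme"
    and N :: "('a, 'c, 'n, 'y) bimod_scheme" +
  assumes right_closed: "\<lbrakk>m \<in> carrier M; a \<in> carrier A\<rbrakk> \<Longrightarrow> m \<triangleleft>\<^bsub>M\<^esub> a \<in> carrier M"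
    and left_closed: "\<lbrakk>a \<in> carrier A; n \<in> carrier N\<rbrakk> \<Longrightarrow> a \<triangleright>\<^bsub>N\<^esub> n \<in> carrier N"
begin

abbreviation "T \<equiv> tensor_group A M N"

abbreviation "pure \<equiv> pure_tensor A M N"

abbreviation "rels \<equiv> tensor_rels A M N"

abbreviation "F \<equiv> free_Abelian_group (carrier M \<times> carrier N)"

abbreviation "relators \<equiv>
     {frag_of (m \<oplus>\<^bsub>M\<^esub> m', n) - frag_of (m, n) - frag_of (m', n) | m m' n.
         m \<in> carrier M \<and> m' \<in> carrier M \<and> n \<in> carrier N} \<union>
      {frag_of (m, n \<oplus>\<^bsub>N\<^esub> n') - frag_of (m, n) - frag_of (m, n') | m n n'.
         m \<in> carrier M \<and> n \<in> carrier N \<and> n' \<in> carrier N} \<union>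
      {frag_of (m \<triangleleft>\<^bsub>M\<^esub> a, n) - frag_of (m, a \<triangleright>\<^bsub>N\<^esub> n) | m a n.
         m \<in> carrier M \<and> a \<in> carrier A \<and> n \<in> carrier N}"

lemma diff_in_F: "\<lbrakk>u \<in> carrier F; v \<in> carrier F\<rbrakk> \<Longrightarrow> u - v \<in> carrier F"
  using keys_diff by fastforce

lemma relators_in_F: "relators \<subseteq> carrier F"
proof -
  have "frag_of (m, n) \<in> carrier F" if "m \<in> carrier M" "n \<in> carrier N" for m n
    using that by simp
  then show ?thesis
    by (auto simp del: carrier_free_Abelian_group_iff intro!: diff_in_F right_closed left_closed)
qed

lemma subgroup_rels: "subgroup (rels) F"
  unfolding tensor_rels_def
  by (rule group.generate_is_subgroup[OF group_free_Abelian_group relators_in_F])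

lemma normal_rels: "rels \<lhd> F"
  using subgroup_rels by (simp add: comm_group.normal_iff_subgroup abelian_free_Abelian_group)

lemma tensor_comm_group: "comm_group (T)"
  unfolding tensor_group_def
  by (rule comm_group.abelian_FactGroup[OF abelian_free_Abelian_group subgroup_rels])

lemma tensor_group: "group (T)"
  using tensor_comm_group by (rule comm_group.axioms)

lemma coset_hom: "(\<lambda>u. rels #>\<^bsub>F\<^esub> u) \<in> hom F (T)"
  unfolding tensor_group_def by (rule normal.r_coset_hom_Mod[OF normal_rels])

lemma coset_eq:
  assumes "u \<in> carrier F" "v \<in> carrier F" "u - v \<in> rels"
  shows "rels #>\<^bsub>F\<^esub> u = rels #>\<^bsub>F\<^esub> v"
proof -
  have "(u - v) + v \<in> rels #>\<^bsub>F\<^esub> v"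
    unfolding r_coset_def mult_free_Abelian_group using assms(3) by blast
  then have "u \<in> rels #>\<^bsub>F\<^esub> v" by simp
  then show ?thesis
    using group.repr_independence[OF group_free_Abelian_group _ assms(2) subgroup_rels] by simp
qed

lemma coset_add:
  assumes "u \<in> carrier F" "v \<in> carrier F"
  shows "rels #>\<^bsub>F\<^esub> (u + v) =
    (rels #>\<^bsub>F\<^esub> u) \<otimes>\<^bsub>T\<^esub> (rels #>\<^bsub>F\<^esub> v)"
  using hom_mult[OF coset_hom assms] by simp

lemma relator_in_rels: "r \<in> relators \<Longrightarrow> r \<in> rels"
  unfolding tensor_rels_def by (rule generate.incl)

lemma pure_tensor_balanced: "balanced A M N (T) (pure)"
proof (intro balancedI biadditiveI)
  fix m n assume "m \<in> carrier M" "n \<in> carrier N"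
  then show "pure m n \<in> carrier (T)"
    unfolding pure_tensor_def by (intro hom_in_carrier[OF coset_hom]) simp
next
  fix m m' n assume mn: "m \<in> carrier M" "m' \<in> carrier M" "n \<in> carrier N"
  have "pure (m \<oplus>\<^bsub>M\<^esub> m') n =
      rels #>\<^bsub>F\<^esub> (frag_of (m, n) + frag_of (m', n))"
    unfolding pure_tensor_def
  proof (rule coset_eq)
    show "frag_of (m, n) + frag_of (m', n) \<in> carrier F"
      using mn by (metis (no_types, lifting) SigmaI frag_of_in_free_Abelian_group group.is_monoid
          group_free_Abelian_group monoid.m_closed mult_free_Abelian_group)
    show "frag_of (m \<oplus>\<^bsub>M\<^esub> m', n) - (frag_of (m, n) + frag_of (m', n)) \<in> rels"
      using mn by (intro relator_in_rels) (auto simp: algebra_simps)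
  qed (use mn in simp)
  also have "\<dots> = pure m n \<otimes>\<^bsub>T\<^esub> pure m' n"
    unfolding pure_tensor_def using mn by (intro coset_add) auto
  finally show "pure (m \<oplus>\<^bsub>M\<^esub> m') n =
    pure m n \<otimes>\<^bsub>T\<^esub> pure m' n" .
next
  fix m n n' assume mn: "m \<in> carrier M" "n \<in> carrier N" "n' \<in> carrier N"
  have "pure m (n \<oplus>\<^bsub>N\<^esub> n') =
      rels #>\<^bsub>F\<^esub> (frag_of (m, n) + frag_of (m, n'))"
    unfolding pure_tensor_def
  proof (rule coset_eq)
    show "frag_of (m, n) + frag_of (m, n') \<in> carrier F"
      using mn by (metis (no_types, lifting) SigmaI frag_of_in_free_Abelian_group group.is_monoid
          group_free_Abelian_group monoid.m_closed mult_free_Abelian_group)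
    show "frag_of (m, n \<oplus>\<^bsub>N\<^esub> n') - (frag_of (m, n) + frag_of (m, n')) \<in> rels"
      using mn by (intro relator_in_rels) (auto simp: algebra_simps)
  qed (use mn in simp)
  also have "\<dots> = pure m n \<otimes>\<^bsub>T\<^esub> pure m n'"
    unfolding pure_tensor_def using mn by (intro coset_add) auto
  finally show "pure m (n \<oplus>\<^bsub>N\<^esub> n') =
    pure m n \<otimes>\<^bsub>T\<^esub> pure m n'" .
next
  fix m a n assume mn: "m \<in> carrier M" "a \<in> carrier A" "n \<in> carrier N"
  show "pure (m \<triangleleft>\<^bsub>M\<^esub> a) n = pure m (a \<triangleright>\<^bsub>N\<^esub> n)"
    unfolding pure_tensor_def
  proof (rule coset_eq)
    show "frag_of (m \<triangleleft>\<^bsub>M\<^esub> a, n) - frag_of (m, a \<triangleright>\<^bsub>N\<^esub> n) \<in> rels"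
      using mn by (intro relator_in_rels) auto
  qed (use mn right_closed[of m a] left_closed[of a n] in simp_all)
qed

lemma pure_tensor_closed:
  "\<lbrakk>m \<in> carrier M; n \<in> carrier N\<rbrakk> \<Longrightarrow> pure m n \<in> carrier (T)"
  using pure_tensor_balanced by (simp add: balanced_def biadditive_def)

text \<open>The free abelian group is generated by pairs, whose cosets are the pure tensors.\<close>

lemma tensor_induct [consumes 1, case_names pure one mult inv]:
  assumes "t \<in> carrier (T)"
    and pure: "\<And>m n. \<lbrakk>m \<in> carrier M; n \<in> carrier N\<rbrakk> \<Longrightarrow> P (pure m n)"
    and one: "P \<one>\<^bsub>T\<^esub>"
    and mult: "\<And>s t. \<lbrakk>s \<in> carrier (T); t \<in> carrier (T); P s; P t\<rbrakk>
      \<Longrightarrow> P (s \<otimes>\<^bsub>T\<^esub> t)"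
    and inv: "\<And>t. \<lbrakk>t \<in> carrier (T); P t\<rbrakk> \<Longrightarrow> P (inv\<^bsub>T\<^esub> t)"
  shows "P t"
proof -
  interpret T: group "T" by (rule tensor_group)
  interpret c: group_hom F "T" "\<lambda>u. rels #>\<^bsub>F\<^esub> u"
    using coset_hom by (simp add: group_hom_def group_hom_axioms_def T.is_group)
  obtain u where u: "u \<in> carrier F" "t = rels #>\<^bsub>F\<^esub> u"
    using assms(1) by (auto simp: tensor_group_def carrier_FactGroup)
  have "P (rels #>\<^bsub>F\<^esub> u)"
  proof (rule free_Abelian_group_induct[of u "carrier M \<times> carrier N"])
    show "Poly_Mapping.keys u \<subseteq> carrier M \<times> carrier N" using u by simp
    show "P (rels #>\<^bsub>F\<^esub> 0)"
      using one c.hom_one by simp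
  next
    fix v w assume vw: "Poly_Mapping.keys v \<subseteq> carrier M \<times> carrier N"
      "Poly_Mapping.keys w \<subseteq> carrier M \<times> carrier N"
      "P (rels #>\<^bsub>F\<^esub> v)" "P (rels #>\<^bsub>F\<^esub> w)"
    have "rels #>\<^bsub>F\<^esub> (v - w) = (rels #>\<^bsub>F\<^esub> v) \<otimes>\<^bsub>T\<^esub>
        inv\<^bsub>T\<^esub> (rels #>\<^bsub>F\<^esub> w)"
      using vw c.hom_mult[of v "inv\<^bsub>F\<^esub> w"] c.hom_inv[of w] by simp
    then show "P (rels #>\<^bsub>F\<^esub> (v - w))"
      using vw mult inv c.hom_closed by simp
  next
    fix p assume "p \<in> carrier M \<times> carrier N"
    then show "P (rels #>\<^bsub>F\<^esub> frag_of p)"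
      using pure[of "fst p" "snd p"] by (auto simp: pure_tensor_def)
  qed
  then show ?thesis using u by simp
qed

lemma tensor_hom_eqI:
  assumes h: "h \<in> hom (T) V" and k: "k \<in> hom (T) V"
    and V: "group V"
    and eq: "\<And>m n. \<lbrakk>m \<in> carrier M; n \<in> carrier N\<rbrakk> \<Longrightarrow>
      h (pure m n) = k (pure m n)"
    and t: "t \<in> carrier (T)"
  shows "h t = k t"
proof -
  interpret h: group_hom "T" V h
    using h V tensor_group by (simp add: group_hom_def group_hom_axioms_def)
  interpret k: group_hom "T" V k
    using k V tensor_group by (simp add: group_hom_def group_hom_axioms_def)
  show ?thesis
    using t by (induction rule: tensor_induct) (simp_all add: eq)
qed

text \<open>The universal property. The values of \<open>f\<close> on pairs extend to the free abelian group; the extension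
  kills the relators because \<open>f\<close> is biadditive and balanced, so it factors through the quotient. The
  factor is determined by its values on pure tensors, which is what the definite description in
  \<^const>\<open>tensor_lift\<close> asks for.\<close>

lemma tensor_lift_props:
  assumes V: "comm_group V" and f: "balanced A M N V f"
  shows "tensor_lift A M N V f \<in> hom (T) V \<and>
     tensor_lift A M N V f \<in> extensional (carrier (T)) \<and>
     (\<forall>m\<in>carrier M. \<forall>n\<in>carrier N. tensor_lift A M N V f (pure m n) = f m n)"
    (is "?P (tensor_lift A M N V f)")
proof -
  interpret V: comm_group V by (rule V)
  have bal: "biadditive M N V f"
    "\<And>m a n. \<lbrakk>m \<in> carrier M; a \<in> carrier A; n \<in> carrier N\<rbrakk> \<Longrightarrow> f (m \<triangleleft>\<^bsub>M\<^esub> a) n = f m (a \<triangleright>\<^bsub>N\<^esub> n)"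
    using f by (simp_all add: balanced_def)
  note D = biadditiveD[OF bal(1)]
  have "(\<lambda>p. f (fst p) (snd p)) ` (carrier M \<times> carrier N) \<subseteq> carrier V"
    using D(1) by auto
  then obtain h where h: "h \<in> hom F V"
      and "\<And>p. p \<in> carrier M \<times> carrier N \<Longrightarrow> h (frag_of p) = f (fst p) (snd p)"
    using V.free_Abelian_group_universal by blast
  then have hf: "\<And>m n. \<lbrakk>m \<in> carrier M; n \<in> carrier N\<rbrakk> \<Longrightarrow> h (frag_of (m, n)) = f m n"
    by simp
  interpret h: group_hom F V h
    using h by (simp add: group_hom_def group_hom_axioms_def V.is_group)
  have diff: "h (u - v) = h u \<otimes>\<^bsub>V\<^esub> inv\<^bsub>V\<^esub> h v" if "u \<in> carrier F" "v \<in> carrier F" for u v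
    using that h.hom_mult[of u "inv\<^bsub>F\<^esub> v"] h.hom_inv[of v] by simp
  have cancel: "v \<otimes>\<^bsub>V\<^esub> w \<otimes>\<^bsub>V\<^esub> inv\<^bsub>V\<^esub> v \<otimes>\<^bsub>V\<^esub> inv\<^bsub>V\<^esub> w = \<one>\<^bsub>V\<^esub>"
    if "v \<in> carrier V" "w \<in> carrier V" for v w
    using that by (simp add: V.m_comm[of v w] V.m_assoc)
  have pure_F: "frag_of (m, n) \<in> carrier F" if "m \<in> carrier M" "n \<in> carrier N" for m n
    using that by simp
  have "h r = \<one>\<^bsub>V\<^esub>" if r: "r \<in> relators" for r
  proof -
    have r1: "h (frag_of (m \<oplus>\<^bsub>M\<^esub> m', n) - frag_of (m, n) - frag_of (m', n)) = \<one>\<^bsub>V\<^esub>"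
      if "m \<in> carrier M" "m' \<in> carrier M" "n \<in> carrier N" for m m' n
      using that
      by (simp add: diff diff_in_F pure_F hf D cancel
          del: carrier_free_Abelian_group_iff frag_of_in_free_Abelian_group)
    have r2: "h (frag_of (m, n \<oplus>\<^bsub>N\<^esub> n') - frag_of (m, n) - frag_of (m, n')) = \<one>\<^bsub>V\<^esub>"
      if "m \<in> carrier M" "n' \<in> carrier N" "n \<in> carrier N" for m n n'
      using that
      by (simp add: diff diff_in_F pure_F hf D cancel
          del: carrier_free_Abelian_group_iff frag_of_in_free_Abelian_group)
    have r3: "h (frag_of (m \<triangleleft>\<^bsub>M\<^esub> a, n) - frag_of (m, a \<triangleright>\<^bsub>N\<^esub> n)) = \<one>\<^bsub>V\<^esub>"
      if "m \<in> carrier M" "a \<in> carrier A" "n \<in> carrier N" for m a n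
      using that by (simp add: diff pure_F hf bal(2) right_closed left_closed D(1)
          del: carrier_free_Abelian_group_iff frag_of_in_free_Abelian_group)
    from r show ?thesis by (elim UnE CollectE exE conjE) (simp_all only: r1 r2 r3)
  qed
  then have ker: "h r = \<one>\<^bsub>V\<^esub>" if "r \<in> rels" for r
    using hom_trivial_on_generate[OF h.group_hom_axioms relators_in_F] that
    unfolding tensor_rels_def by blast
  have wd: "h u = h v" if "u \<in> carrier F" "v \<in> carrier F"
      "rels #>\<^bsub>F\<^esub> u = rels #>\<^bsub>F\<^esub> v" for u v
  proof -
    have "u \<in> rels #>\<^bsub>F\<^esub> v"
      using that group.rcos_self[OF group_free_Abelian_group that(1) subgroup_rels] by simp
    then obtain r where r: "r \<in> rels" "u = r \<otimes>\<^bsub>F\<^esub> v"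
      unfolding r_coset_def by blast
    then have "h u = h r \<otimes>\<^bsub>V\<^esub> h v"
      using that subgroup.mem_carrier[OF subgroup_rels r(1)] h.hom_mult[of r v] by simp
    then show ?thesis using ker r that by simp
  qed
  obtain g where g: "g \<in> hom (F Mod rels) V"
      "\<And>u. u \<in> carrier F \<Longrightarrow> g (rels #>\<^bsub>F\<^esub> u) = h u"
    using FactGroup_universal[OF h normal_rels wd] by blast
  define k where "k = restrict g (carrier (T))"
  have "k \<in> hom (T) V"
    using g(1) monoid.m_closed[OF group.is_monoid[OF tensor_group]] unfolding k_def hom_def
    by (auto simp: tensor_group_def)
  moreover have "k (pure m n) = f m n" if "m \<in> carrier M" "n \<in> carrier N" for m n
    using g(2)[OF pure_F[OF that]] that pure_tensor_closed[OF that]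
    by (simp add: k_def hf pure_tensor_def)
  moreover have "k \<in> extensional (carrier (T))"
    unfolding k_def by (rule restrict_extensional)
  ultimately have k: "?P k" by blast
  have "l = k" if l: "?P l" for l
  proof (rule extensionalityI)
    show "l \<in> extensional (carrier (T))"
         "k \<in> extensional (carrier (T))" using that k by blast+
    have "l (pure m n) = k (pure m n)"
      if "m \<in> carrier M" "n \<in> carrier N" for m n
      using l k that by simp
    then show "l t = k t" if "t \<in> carrier (T)" for t
      using tensor_hom_eqI[OF conjunct1[OF l] conjunct1[OF k] V.is_group _ that] by blast
  qed
  with k show ?thesis
    unfolding tensor_lift_def by (rule theI[where P = ?P])
qed

lemmas tensor_lift_hom = tensor_lift_props[THEN conjunct1]
  and tensor_lift_pure = tensor_lift_props[THEN conjunct2, THEN conjunct2, rule_format]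

lemma tensor_lift_unique:
  assumes "comm_group V" "h \<in> hom (T) V"
    and "balanced A M N V f"
    and "\<And>m n. \<lbrakk>m \<in> carrier M; n \<in> carrier N\<rbrakk> \<Longrightarrow> h (pure m n) = f m n"
    and "t \<in> carrier (T)"
  shows "tensor_lift A M N V f t = h t"
proof (rule tensor_hom_eqI[OF tensor_lift_hom[OF assms(1,3)] assms(2) _ _ assms(5)])
  show "group V" using assms(1) by (rule comm_group.axioms)
  show "tensor_lift A M N V f (pure m n) = h (pure m n)"
    if "m \<in> carrier M" "n \<in> carrier N" for m n
    using that by (simp add: tensor_lift_pure[OF assms(1,3)] assms(4))
qed

end

lemma subgroup_contains_image:
  assumes "group_hom T V h" and "K \<subseteq> carrier T" and "subgroup H V" and "h ` K \<subseteq> H"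
  shows "h ` generate T K \<subseteq> H"
proof -
  interpret group_hom T V h by (rule assms)
  have "h ` generate T K = generate V (h ` K)" using generate_img[OF assms(2)] by simp
  also have "\<dots> \<subseteq> H" using assms(3,4) by (intro H.generate_subgroup_incl)
  finally show ?thesis .
qed

lemma biadditive_hom:
  assumes "biadditive M N V f"
  shows "n \<in> carrier N \<Longrightarrow> (\<lambda>m. f m n) \<in> hom (add_monoid M) V"
    and "m \<in> carrier M \<Longrightarrow> f m \<in> hom (add_monoid N) V"
  using biadditiveD[OF assms] by (auto intro!: homI)

text \<open>This makes tensor products functorial; with an identity as one of the two maps it also gives the
  outer actions on a tensor product.\<close>

lemma pure_tensor_map_balanced:
  assumes "tensor_factors A M' N'"
    and f: "f \<in> hom (add_monoid M) (add_monoid M')" and g: "g \<in> hom (add_monoid N) (add_monoid N')"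
    and f_lin: "\<And>m a. \<lbrakk>m \<in> carrier M; a \<in> carrier A\<rbrakk> \<Longrightarrow> f (m \<triangleleft>\<^bsub>M\<^esub> a) = f m \<triangleleft>\<^bsub>M'\<^esub> a"
    and g_lin: "\<And>n a. \<lbrakk>n \<in> carrier N; a \<in> carrier A\<rbrakk> \<Longrightarrow> g (a \<triangleright>\<^bsub>N\<^esub> n) = a \<triangleright>\<^bsub>N'\<^esub> g n"
  shows "balanced A M N (tensor_group A M' N') (\<lambda>m n. pure_tensor A M' N' (f m) (g n))"
proof -
  interpret T: tensor_factors A M' N' by (rule assms)
  have bal: "balanced A M' N' (tensor_group A M' N') (pure_tensor A M' N')"
    by (rule T.pure_tensor_balanced)
  then have "biadditive M' N' (tensor_group A M' N') (pure_tensor A M' N')"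
    by (simp add: balanced_def)
  note D = biadditiveD[OF this]
  have f_closed: "f m \<in> carrier M'" and f_add: "f (m \<oplus>\<^bsub>M\<^esub> m') = f m \<oplus>\<^bsub>M'\<^esub> f m'"
    if "m \<in> carrier M" "m' \<in> carrier M" for m m'
    using that hom_in_carrier[OF f] hom_mult[OF f] by auto
  have g_closed: "g n \<in> carrier N'" and g_add: "g (n \<oplus>\<^bsub>N\<^esub> n') = g n \<oplus>\<^bsub>N'\<^esub> g n'"
    if "n \<in> carrier N" "n' \<in> carrier N" for n n'
    using that hom_in_carrier[OF g] hom_mult[OF g] by auto
  show ?thesis
  proof (intro balancedI biadditiveI)
    fix m a n assume "m \<in> carrier M" "a \<in> carrier A" "n \<in> carrier N"
    then show "pure_tensor A M' N' (f (m \<triangleleft>\<^bsub>M\<^esub> a)) (g n) = pure_tensor A M' N' (f m) (g (a \<triangleright>\<^bsub>N\<^esub> n))"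
      using bal f_closed g_closed by (simp add: balanced_def f_lin g_lin)
  qed (simp_all add: D f_closed f_add g_closed g_add)
qed

lemma carrier_tensor [simp]: "carrier (tensor A M N) = carrier (tensor_group A M N)"
  and add_tensor [simp]: "add (tensor A M N) = mult (tensor_group A M N)"
  and zero_tensor [simp]: "zero (tensor A M N) = one (tensor_group A M N)"
  by (simp_all add: tensor_def Let_def)

section \<open>Tensor products of bimodules and contraction against forms\<close>

lemma tensor_map_props:
  assumes "tensor_factors A M N" and T': "tensor_factors A M' N'"
    and "f \<in> hom (add_monoid M) (add_monoid M')" and "g \<in> hom (add_monoid N) (add_monoid N')"
    and "\<And>m a. \<lbrakk>m \<in> carrier M; a \<in> carrier A\<rbrakk> \<Longrightarrow> f (m \<triangleleft>\<^bsub>M\<^esub> a) = f m \<triangleleft>\<^bsub>M'\<^esub> a"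
    and "\<And>n a. \<lbrakk>n \<in> carrier N; a \<in> carrier A\<rbrakk> \<Longrightarrow> g (a \<triangleright>\<^bsub>N\<^esub> n) = a \<triangleright>\<^bsub>N'\<^esub> g n"
  shows "tensor_map A M N M' N' f g \<in> hom (tensor_group A M N) (tensor_group A M' N')"
    and "\<lbrakk>m \<in> carrier M; n \<in> carrier N\<rbrakk> \<Longrightarrow>
      tensor_map A M N M' N' f g (pure_tensor A M N m n) = pure_tensor A M' N' (f m) (g n)"
proof -
  have bal: "balanced A M N (tensor_group A M' N') (\<lambda>m n. pure_tensor A M' N' (f m) (g n))"
    using assms(2-) by (rule pure_tensor_map_balanced)
  have cg: "comm_group (tensor_group A M' N')" using T' by (rule tensor_factors.tensor_comm_group)
  note props = tensor_factors.tensor_lift_props[OF assms(1) cg bal, folded tensor_map_def]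
  show "tensor_map A M N M' N' f g \<in> hom (tensor_group A M N) (tensor_group A M' N')"
    and "\<lbrakk>m \<in> carrier M; n \<in> carrier N\<rbrakk> \<Longrightarrow>
      tensor_map A M N M' N' f g (pure_tensor A M N m n) = pure_tensor A M' N' (f m) (g n)"
    using props by auto
qed

text \<open>Unlike \<^const>\<open>left_hom\<close>, this does not ask for extensionality, so that composites such as
  \<open>\<lambda>c. g (K c)\<close> qualify without being restricted to a carrier.\<close>

definition left_form ::
  "('a, 'w) ring_scheme \<Rightarrow> ('a, 'b, 'm, 'x) bimod_scheme \<Rightarrow> ('m \<Rightarrow> 'a) \<Rightarrow> bool" where
  "left_form A M f \<longleftrightarrow> f \<in> hom (add_monoid M) (add_monoid A) \<and>
     (\<forall>a\<in>carrier A. \<forall>m\<in>carrier M. f (a \<triangleright>\<^bsub>M\<^esub> m) = a \<otimes>\<^bsub>A\<^esub> f m)"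

lemma left_formI:
  assumes "\<And>m. m \<in> carrier M \<Longrightarrow> f m \<in> carrier A"
    and "\<And>m m'. \<lbrakk>m \<in> carrier M; m' \<in> carrier M\<rbrakk> \<Longrightarrow> f (m \<oplus>\<^bsub>M\<^esub> m') = f m \<oplus>\<^bsub>A\<^esub> f m'"
    and "\<And>a m. \<lbrakk>a \<in> carrier A; m \<in> carrier M\<rbrakk> \<Longrightarrow> f (a \<triangleright>\<^bsub>M\<^esub> m) = a \<otimes>\<^bsub>A\<^esub> f m"
  shows "left_form A M f"
  using assms by (auto simp: left_form_def intro!: homI)

lemma left_formD:
  assumes "left_form A M f"
  shows "\<And>m. m \<in> carrier M \<Longrightarrow> f m \<in> carrier A"
    and "\<And>m m'. \<lbrakk>m \<in> carrier M; m' \<in> carrier M\<rbrakk> \<Longrightarrow> f (m \<oplus>\<^bsub>M\<^esub> m') = f m \<oplus>\<^bsub>A\<^esub> f m'"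
    and "\<And>a m. \<lbrakk>a \<in> carrier A; m \<in> carrier M\<rbrakk> \<Longrightarrow> f (a \<triangleright>\<^bsub>M\<^esub> m) = a \<otimes>\<^bsub>A\<^esub> f m"
proof -
  have f: "f \<in> hom (add_monoid M) (add_monoid A)" using assms by (simp add: left_form_def)
  show "f m \<in> carrier A" if "m \<in> carrier M" for m using hom_in_carrier[OF f] that by simp
  show "f (m \<oplus>\<^bsub>M\<^esub> m') = f m \<oplus>\<^bsub>A\<^esub> f m'" if "m \<in> carrier M" "m' \<in> carrier M" for m m'
    using hom_mult[OF f] that by simp
  show "f (a \<triangleright>\<^bsub>M\<^esub> m) = a \<otimes>\<^bsub>A\<^esub> f m" if "a \<in> carrier A" "m \<in> carrier M" for a m
    using assms that by (simp add: left_form_def)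
qed

text \<open>The map \<open>m \<otimes> n \<mapsto> m f(n)\<close>. The expression \<open>c\<^sub>1 f(c\<^sub>2)\<close> is its value at \<open>\<Delta>(c)\<close>.\<close>

definition contract_right ::
  "('a, 'w) ring_scheme \<Rightarrow> ('b, 'a, 'm, 'x) bimod_scheme \<Rightarrow> ('a, 'd, 'n, 'y) bimod_scheme \<Rightarrow>
    ('n \<Rightarrow> 'a) \<Rightarrow> ('m \<times> 'n \<Rightarrow>\<^sub>0 int) set \<Rightarrow> 'm" where
  "contract_right A M N f = tensor_lift A M N (add_monoid M) (\<lambda>m n. m \<triangleleft>\<^bsub>M\<^esub> f n)"

lemma bimodule_tensor_factors:
  assumes "bimodule B A M" and "bimodule A D N"
  shows "tensor_factors A M N"
proof -
  interpret M: bimodule B A M by (rule assms)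
  interpret N: bimodule A D N by (rule assms)
  show ?thesis by unfold_locales (simp_all add: M.rsmult_closed N.lsmult_closed)
qed

locale tensor_bimodules = M: bimodule B A M + N: bimodule A D N
  for B :: "('b, 'v) ring_scheme" and A :: "('a, 'w) ring_scheme" and D :: "('d, 'u) ring_scheme"
    and M :: "('b, 'a, 'm, 'x) bimod_scheme" and N :: "('a, 'd, 'n, 'y) bimod_scheme"
begin

sublocale tensor_factors A M N
  by (rule bimodule_tensor_factors) unfold_locales

lemma abelian_group_tensor: "abelian_group (tensor A M N)"
proof -
  interpret T: comm_group "T" by (rule tensor_comm_group)
  show ?thesis
    by (rule abelian_groupI) (simp_all add: T.m_ac T.l_inv_ex)
qed

lemma tensor_lsmult:
  assumes b: "b \<in> carrier B"
  shows "lsmult (tensor A M N) b \<in> hom (T) (T)"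
    and "\<lbrakk>m \<in> carrier M; n \<in> carrier N\<rbrakk> \<Longrightarrow>
      b \<triangleright>\<^bsub>tensor A M N\<^esub> pure m n = pure (b \<triangleright>\<^bsub>M\<^esub> m) n"
proof -
  have "balanced A M N (T) (\<lambda>m n. pure (b \<triangleright>\<^bsub>M\<^esub> m) n)"
    using b by (intro pure_tensor_map_balanced[where g = "\<lambda>n. n"] tensor_factors_axioms)
      (auto intro!: homI simp: M.lsmult_closed M.lsmult_r_distr M.smult_commute)
  note bal = tensor_lift_props[OF tensor_comm_group this]
  show "lsmult (tensor A M N) b \<in> hom (T) (T)"
    and "\<lbrakk>m \<in> carrier M; n \<in> carrier N\<rbrakk> \<Longrightarrow>
      b \<triangleright>\<^bsub>tensor A M N\<^esub> pure m n = pure (b \<triangleright>\<^bsub>M\<^esub> m) n"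
    using bal by (simp_all add: tensor_def Let_def)
qed

lemma tensor_rsmult:
  assumes d: "d \<in> carrier D"
  shows "(\<lambda>t. rsmult (tensor A M N) t d) \<in> hom (T) (T)"
    and "\<lbrakk>m \<in> carrier M; n \<in> carrier N\<rbrakk> \<Longrightarrow>
      pure m n \<triangleleft>\<^bsub>tensor A M N\<^esub> d = pure m (n \<triangleleft>\<^bsub>N\<^esub> d)"
proof -
  have "balanced A M N (T) (\<lambda>m n. pure m (n \<triangleleft>\<^bsub>N\<^esub> d))"
    using d by (intro pure_tensor_map_balanced[where f = "\<lambda>m. m"] tensor_factors_axioms)
      (auto intro!: homI simp: N.rsmult_closed N.rsmult_l_distr N.smult_commute)
  note bal = tensor_lift_props[OF tensor_comm_group this]
  show "(\<lambda>t. rsmult (tensor A M N) t d) \<in> hom (T) (T)"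
    and "\<lbrakk>m \<in> carrier M; n \<in> carrier N\<rbrakk> \<Longrightarrow>
      pure m n \<triangleleft>\<^bsub>tensor A M N\<^esub> d = pure m (n \<triangleleft>\<^bsub>N\<^esub> d)"
    using bal by (simp_all add: tensor_def Let_def)
qed

lemma pure_tensor_biadditive: "biadditive M N T (pure)"
  using pure_tensor_balanced by (simp add: balanced_def)

lemmas pure_tensor_add_left = biadditiveD(2)[OF pure_tensor_biadditive]
  and pure_tensor_add_right = biadditiveD(3)[OF pure_tensor_biadditive]

lemma pure_tensor_middle:
  "\<lbrakk>m \<in> carrier M; a \<in> carrier A; n \<in> carrier N\<rbrakk> \<Longrightarrow>
    pure (m \<triangleleft>\<^bsub>M\<^esub> a) n = pure m (a \<triangleright>\<^bsub>N\<^esub> n)"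
  using pure_tensor_balanced by (simp add: balanced_def)

lemma tensor_lsmult_closed:
  "\<lbrakk>b \<in> carrier B; t \<in> carrier T\<rbrakk> \<Longrightarrow>
    b \<triangleright>\<^bsub>tensor A M N\<^esub> t \<in> carrier T"
  using hom_in_carrier[OF tensor_lsmult(1)] .

lemma tensor_rsmult_closed:
  "\<lbrakk>d \<in> carrier D; t \<in> carrier T\<rbrakk> \<Longrightarrow>
    t \<triangleleft>\<^bsub>tensor A M N\<^esub> d \<in> carrier T"
  using hom_in_carrier[OF tensor_rsmult(1)] .

text \<open>Each axiom compares two additive functions of \<open>t\<close>, hence needs to be checked on pure tensors only,
  where it is an axiom for one of the factors.\<close>

lemma bimodule_tensor: "bimodule B D (tensor A M N)"
proof -
  let ?TT = "tensor A M N"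
  interpret T: comm_group T by (rule tensor_comm_group)
  have sum_hom: "(\<lambda>t. h t \<otimes>\<^bsub>T\<^esub> k t) \<in> hom T T" if hk: "h \<in> hom T T" "k \<in> hom T T" for h k
  proof (rule homI)
    fix t t' assume t: "t \<in> carrier T" "t' \<in> carrier T"
    note closed = hom_in_carrier[OF hk(1)] hom_in_carrier[OF hk(2)]
    show "h t \<otimes>\<^bsub>T\<^esub> k t \<in> carrier T" using t closed by simp
    show "h (t \<otimes>\<^bsub>T\<^esub> t') \<otimes>\<^bsub>T\<^esub> k (t \<otimes>\<^bsub>T\<^esub> t') = h t \<otimes>\<^bsub>T\<^esub> k t \<otimes>\<^bsub>T\<^esub> (h t' \<otimes>\<^bsub>T\<^esub> k t')"
      unfolding hom_mult[OF hk(1) t] hom_mult[OF hk(2) t] using t closed by (simp add: T.m_ac)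
  qed
  have comp_hom: "(\<lambda>t. h (k t)) \<in> hom T T" if "h \<in> hom T T" "k \<in> hom T T" for h k
    using Group.hom_compose[OF that(2,1)] by (simp add: comp_def)
  have id_hom: "(\<lambda>t. t) \<in> hom T T" by (rule homI) simp_all
  note simps = tensor_lsmult(2) tensor_rsmult(2) M.lsmult_closed N.rsmult_closed
  have eq: "h t = k t" if "t \<in> carrier T" "h \<in> hom T T" "k \<in> hom T T"
      "\<And>m n. \<lbrakk>m \<in> carrier M; n \<in> carrier N\<rbrakk> \<Longrightarrow> h (pure m n) = k (pure m n)"
    for h k t
    using tensor_hom_eqI[OF that(2,3) T.is_group that(4,1)] .
  have "bimodule_axioms B D ?TT"
  proof (unfold_locales, unfold carrier_tensor add_tensor)
    fix b t assume bt: "b \<in> carrier B" "t \<in> carrier T"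
    then show "b \<triangleright>\<^bsub>?TT\<^esub> t \<in> carrier T" by (rule tensor_lsmult_closed)
    fix t' assume t': "t' \<in> carrier T"
    show "b \<triangleright>\<^bsub>?TT\<^esub> (t \<otimes>\<^bsub>T\<^esub> t') = (b \<triangleright>\<^bsub>?TT\<^esub> t) \<otimes>\<^bsub>T\<^esub> (b \<triangleright>\<^bsub>?TT\<^esub> t')"
      using hom_mult[OF tensor_lsmult(1)[OF bt(1)] bt(2) t'] .
  next
    fix b b' t assume b: "b \<in> carrier B" "b' \<in> carrier B" and t: "t \<in> carrier T"
    then have bb: "b \<oplus>\<^bsub>B\<^esub> b' \<in> carrier B" "b \<otimes>\<^bsub>B\<^esub> b' \<in> carrier B" by simp_all
    show "(b \<oplus>\<^bsub>B\<^esub> b') \<triangleright>\<^bsub>?TT\<^esub> t = (b \<triangleright>\<^bsub>?TT\<^esub> t) \<otimes>\<^bsub>T\<^esub> (b' \<triangleright>\<^bsub>?TT\<^esub> t)"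
      by (rule eq[OF t tensor_lsmult(1)[OF bb(1)]
            sum_hom[OF tensor_lsmult(1)[OF b(1)] tensor_lsmult(1)[OF b(2)]]])
        (simp add: b bb simps M.lsmult_l_distr pure_tensor_add_left)
    show "(b \<otimes>\<^bsub>B\<^esub> b') \<triangleright>\<^bsub>?TT\<^esub> t = b \<triangleright>\<^bsub>?TT\<^esub> (b' \<triangleright>\<^bsub>?TT\<^esub> t)"
      by (rule eq[OF t tensor_lsmult(1)[OF bb(2)]
            comp_hom[OF tensor_lsmult(1)[OF b(1)] tensor_lsmult(1)[OF b(2)]]])
        (simp add: b bb simps M.lsmult_assoc)
  next
    fix t assume t: "t \<in> carrier T"
    show "\<one>\<^bsub>B\<^esub> \<triangleright>\<^bsub>?TT\<^esub> t = t"
      by (rule eq[OF t tensor_lsmult(1)[OF M.A.one_closed] id_hom]) (simp add: simps M.lsmult_one)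
    show "t \<triangleleft>\<^bsub>?TT\<^esub> \<one>\<^bsub>D\<^esub> = t"
      by (rule eq[OF t tensor_rsmult(1)[OF N.B.one_closed] id_hom]) (simp add: simps N.rsmult_one)
  next
    fix d t assume dt: "d \<in> carrier D" "t \<in> carrier T"
    then show "t \<triangleleft>\<^bsub>?TT\<^esub> d \<in> carrier T" by (rule tensor_rsmult_closed)
    fix t' assume t': "t' \<in> carrier T"
    show "(t \<otimes>\<^bsub>T\<^esub> t') \<triangleleft>\<^bsub>?TT\<^esub> d = (t \<triangleleft>\<^bsub>?TT\<^esub> d) \<otimes>\<^bsub>T\<^esub> (t' \<triangleleft>\<^bsub>?TT\<^esub> d)"
      using hom_mult[OF tensor_rsmult(1)[OF dt(1)] dt(2) t'] .
  next
    fix d d' t assume d: "d \<in> carrier D" "d' \<in> carrier D" and t: "t \<in> carrier T"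
    then have dd: "d \<oplus>\<^bsub>D\<^esub> d' \<in> carrier D" "d \<otimes>\<^bsub>D\<^esub> d' \<in> carrier D" by simp_all
    show "t \<triangleleft>\<^bsub>?TT\<^esub> (d \<oplus>\<^bsub>D\<^esub> d') = (t \<triangleleft>\<^bsub>?TT\<^esub> d) \<otimes>\<^bsub>T\<^esub> (t \<triangleleft>\<^bsub>?TT\<^esub> d')"
      by (rule eq[OF t tensor_rsmult(1)[OF dd(1)]
            sum_hom[OF tensor_rsmult(1)[OF d(1)] tensor_rsmult(1)[OF d(2)]]])
        (simp add: d dd simps N.rsmult_r_distr pure_tensor_add_right)
    show "t \<triangleleft>\<^bsub>?TT\<^esub> (d \<otimes>\<^bsub>D\<^esub> d') = (t \<triangleleft>\<^bsub>?TT\<^esub> d) \<triangleleft>\<^bsub>?TT\<^esub> d'"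
      by (rule eq[OF t tensor_rsmult(1)[OF dd(2)]
            comp_hom[OF tensor_rsmult(1)[OF d(2)] tensor_rsmult(1)[OF d(1)]]])
        (simp add: d dd simps N.rsmult_assoc)
  next
    fix b d t assume bd: "b \<in> carrier B" "d \<in> carrier D" and t: "t \<in> carrier T"
    show "(b \<triangleright>\<^bsub>?TT\<^esub> t) \<triangleleft>\<^bsub>?TT\<^esub> d = b \<triangleright>\<^bsub>?TT\<^esub> (t \<triangleleft>\<^bsub>?TT\<^esub> d)"
      by (rule eq[OF t comp_hom[OF tensor_rsmult(1)[OF bd(2)] tensor_lsmult(1)[OF bd(1)]]
            comp_hom[OF tensor_lsmult(1)[OF bd(1)] tensor_rsmult(1)[OF bd(2)]]])
        (simp add: bd simps)
  qed
  then show ?thesis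
    using M.A.ring_axioms N.B.ring_axioms abelian_group_tensor by (simp add: bimodule_def)
qed

lemma contract_right:
  assumes f: "left_form A N f"
  shows "contract_right A M N f \<in> hom T (add_monoid M)"
    and "\<lbrakk>m \<in> carrier M; n \<in> carrier N\<rbrakk> \<Longrightarrow> contract_right A M N f (pure m n) = m \<triangleleft>\<^bsub>M\<^esub> f n"
proof -
  note D = left_formD[OF f]
  have "balanced A M N (add_monoid M) (\<lambda>m n. m \<triangleleft>\<^bsub>M\<^esub> f n)"
    by (intro balancedI biadditiveI)
      (simp_all add: D M.rsmult_closed M.rsmult_l_distr M.rsmult_r_distr M.rsmult_assoc)
  note props = tensor_lift_props[OF M.M.a_comm_group this, folded contract_right_def]
  show "contract_right A M N f \<in> hom T (add_monoid M)"
    and "\<lbrakk>m \<in> carrier M; n \<in> carrier N\<rbrakk> \<Longrightarrow> contract_right A M N f (pure m n) = m \<triangleleft>\<^bsub>M\<^esub> f n"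
    using props by auto
qed

lemma contract_right_closed:
  "\<lbrakk>left_form A N f; t \<in> carrier T\<rbrakk> \<Longrightarrow> contract_right A M N f t \<in> carrier M"
  using hom_in_carrier[OF contract_right(1)] by simp

lemma contract_right_add:
  "\<lbrakk>left_form A N f; t \<in> carrier T; t' \<in> carrier T\<rbrakk> \<Longrightarrow>
    contract_right A M N f (t \<otimes>\<^bsub>T\<^esub> t') =
      contract_right A M N f t \<oplus>\<^bsub>M\<^esub> contract_right A M N f t'"
  using hom_mult[OF contract_right(1)] by simp

lemma contract_right_eqI:
  assumes f: "left_form A N f" and h: "h \<in> hom T (add_monoid M)"
    and eq: "\<And>m n. \<lbrakk>m \<in> carrier M; n \<in> carrier N\<rbrakk> \<Longrightarrow> h (pure m n) = m \<triangleleft>\<^bsub>M\<^esub> f n"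
    and t: "t \<in> carrier T"
  shows "contract_right A M N f t = h t"
  by (rule tensor_hom_eqI[OF contract_right(1)[OF f] h M.M.a_group _ t])
    (simp add: contract_right(2)[OF f] eq)

text \<open>Contraction depends only on the values of the form on the carrier; this bridges the gap between
  extensional elements of a dual and unrestricted composites.\<close>

lemma contract_right_cong:
  assumes "left_form A N f" and "\<And>n. n \<in> carrier N \<Longrightarrow> g n = f n"
    and "t \<in> carrier T"
  shows "contract_right A M N g t = contract_right A M N f t"
proof -
  have g: "left_form A N g"
    using left_formD[OF assms(1)] assms(2) N.lsmult_closed by (intro left_formI) simp_all
  show ?thesis
    by (rule contract_right_eqI[OF g contract_right(1)[OF assms(1)] _ assms(3)])
      (simp add: contract_right(2)[OF assms(1)] assms(2))
qed

lemma contract_right_lsmult: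
  assumes f: "left_form A N f" and b: "b \<in> carrier B" and t: "t \<in> carrier T"
  shows "contract_right A M N f (b \<triangleright>\<^bsub>tensor A M N\<^esub> t) = b \<triangleright>\<^bsub>M\<^esub> contract_right A M N f t"
proof (rule tensor_hom_eqI[where V = "add_monoid M", OF _ _ M.M.a_group _ t])
  show "(\<lambda>t. contract_right A M N f (b \<triangleright>\<^bsub>tensor A M N\<^esub> t)) \<in> hom T (add_monoid M)"
    using Group.hom_compose[OF tensor_lsmult(1)[OF b] contract_right(1)[OF f]] by (simp add: comp_def)
  show "(\<lambda>t. b \<triangleright>\<^bsub>M\<^esub> contract_right A M N f t) \<in> hom T (add_monoid M)"
    using b f by (intro homI)
      (simp_all add: contract_right_closed contract_right_add M.lsmult_closed M.lsmult_r_distr)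
  fix m n assume "m \<in> carrier M" "n \<in> carrier N"
  then show "contract_right A M N f (b \<triangleright>\<^bsub>tensor A M N\<^esub> pure m n) =
      b \<triangleright>\<^bsub>M\<^esub> contract_right A M N f (pure m n)"
    using b f by (simp add: tensor_lsmult(2) contract_right(2) M.lsmult_closed left_formD(1)[OF f]
        M.smult_commute)
qed

lemma contract_right_form_add:
  assumes f: "left_form A N f" and g: "left_form A N g" and h: "left_form A N h"
    and eq: "\<And>n. n \<in> carrier N \<Longrightarrow> h n = f n \<oplus>\<^bsub>A\<^esub> g n" and t: "t \<in> carrier T"
  shows "contract_right A M N h t = contract_right A M N f t \<oplus>\<^bsub>M\<^esub> contract_right A M N g t"
proof (rule contract_right_eqI[OF h _ _ t])
  show "(\<lambda>t. contract_right A M N f t \<oplus>\<^bsub>M\<^esub> contract_right A M N g t) \<in>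
      hom T (add_monoid M)"
    using f g by (intro homI) (simp_all add: contract_right_closed contract_right_add M.M.a_ac)
qed (simp add: f g eq contract_right(2) M.rsmult_r_distr left_formD(1)[OF f] left_formD(1)[OF g])

lemma contract_right_form_rsmult:
  assumes f: "left_form A N f" and g: "left_form A N g" and a: "a \<in> carrier A"
    and eq: "\<And>n. n \<in> carrier N \<Longrightarrow> g n = f n \<otimes>\<^bsub>A\<^esub> a" and t: "t \<in> carrier T"
  shows "contract_right A M N g t = contract_right A M N f t \<triangleleft>\<^bsub>M\<^esub> a"
proof (rule contract_right_eqI[OF g _ _ t])
  show "(\<lambda>t. contract_right A M N f t \<triangleleft>\<^bsub>M\<^esub> a) \<in> hom T (add_monoid M)"
    using f a by (intro homI)
      (simp_all add: contract_right_closed contract_right_add M.rsmult_closed M.rsmult_l_distr)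
qed (simp add: f a eq contract_right(2) M.rsmult_assoc left_formD(1)[OF f])

end

text \<open>Contraction acts in the right factor, so it commutes with right linear maps of the left factor.\<close>

lemma contract_right_natural_left:
  assumes "tensor_bimodules B A D M N" and "tensor_bimodules B' A D M' N"
    and h: "h \<in> hom (add_monoid M) (add_monoid M')"
    and h_lin: "\<And>m a. \<lbrakk>m \<in> carrier M; a \<in> carrier A\<rbrakk> \<Longrightarrow> h (m \<triangleleft>\<^bsub>M\<^esub> a) = h m \<triangleleft>\<^bsub>M'\<^esub> a"
    and f: "left_form A N f" and t: "t \<in> carrier (tensor_group A M N)"
  shows "contract_right A M' N f (tensor_map A M N M' N h (\<lambda>n. n) t) = h (contract_right A M N f t)"
proof -
  interpret T: tensor_bimodules B A D M N by (rule assms)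
  interpret T': tensor_bimodules B' A D M' N by (rule assms)
  have id: "(\<lambda>n. n) \<in> hom (add_monoid N) (add_monoid N)" by (auto intro!: homI)
  note map = tensor_map_props[OF T.tensor_factors_axioms T'.tensor_factors_axioms h id h_lin refl]
  show ?thesis
  proof (rule T.tensor_hom_eqI[where V = "add_monoid M'", OF _ _ T'.M.M.a_group _ t])
    show "(\<lambda>t. contract_right A M' N f (tensor_map A M N M' N h (\<lambda>n. n) t)) \<in>
        hom (tensor_group A M N) (add_monoid M')"
      using Group.hom_compose[OF map(1) T'.contract_right(1)[OF f]] by (simp add: comp_def)
    show "(\<lambda>t. h (contract_right A M N f t)) \<in> hom (tensor_group A M N) (add_monoid M')"
      using Group.hom_compose[OF T.contract_right(1)[OF f] h] by (simp add: comp_def)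
    fix m n assume mn: "m \<in> carrier M" "n \<in> carrier N"
    then have "h m \<in> carrier M'" using hom_in_carrier[OF h] by simp
    then show "contract_right A M' N f (tensor_map A M N M' N h (\<lambda>n. n) (pure_tensor A M N m n)) =
      h (contract_right A M N f (pure_tensor A M N m n))"
      using mn f by (simp add: map(2) T.contract_right(2) T'.contract_right(2) h_lin left_formD(1)[OF f])
  qed
qed

text \<open>A left linear map \<open>k\<close> of the right factor can be absorbed into the form. For \<open>k\<close> a comultiplication
  or counit this eliminates iterated tensor products.\<close>

lemma contract_right_natural_right:
  assumes "tensor_bimodules B A D M N" and "tensor_bimodules B A D' M N'"
    and k: "k \<in> hom (add_monoid N) (add_monoid N')"
    and k_lin: "\<And>n a. \<lbrakk>n \<in> carrier N; a \<in> carrier A\<rbrakk> \<Longrightarrow> k (a \<triangleright>\<^bsub>N\<^esub> n) = a \<triangleright>\<^bsub>N'\<^esub> k n"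
    and f: "left_form A N' f" and t: "t \<in> carrier (tensor_group A M N)"
  shows "contract_right A M N' f (tensor_map A M N M N' (\<lambda>m. m) k t) =
    contract_right A M N (\<lambda>n. f (k n)) t"
proof -
  interpret T: tensor_bimodules B A D M N by (rule assms)
  interpret T': tensor_bimodules B A D' M N' by (rule assms)
  have id: "(\<lambda>m. m) \<in> hom (add_monoid M) (add_monoid M)" by (auto intro!: homI)
  note map = tensor_map_props[OF T.tensor_factors_axioms T'.tensor_factors_axioms id k refl k_lin]
  have kN: "k n \<in> carrier N'" if "n \<in> carrier N" for n using hom_in_carrier[OF k] that by simp
  have fk: "left_form A N (\<lambda>n. f (k n))"
    using left_formD[OF f] hom_mult[OF k] by (intro left_formI) (simp_all add: kN k_lin)
  show ?thesis
  proof (rule T.contract_right_eqI[OF fk _ _ t, symmetric])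
    show "(\<lambda>t. contract_right A M N' f (tensor_map A M N M N' (\<lambda>m. m) k t)) \<in>
        hom (tensor_group A M N) (add_monoid M)"
      using Group.hom_compose[OF map(1) T'.contract_right(1)[OF f]] by (simp add: comp_def)
  qed (simp add: map(2) T'.contract_right(2)[OF f] kN)
qed

section \<open>Contraction of triple tensor products\<close>

locale tensor_bimodules3 =
  MN: tensor_bimodules A A A M N + NP: tensor_bimodules A A A N P
  for A :: "('a, 'w) ring_scheme" and M :: "('a, 'a, 'm, 'x) bimod_scheme"
    and N :: "('a, 'a, 'n, 'y) bimod_scheme" and P :: "('a, 'a, 'p, 'z) bimod_scheme"
begin

sublocale MN_P: tensor_bimodules A A A "tensor A M N" P
  by (rule tensor_bimodules.intro[OF MN.bimodule_tensor NP.N.bimodule_axioms])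

sublocale M_NP: tensor_bimodules A A A M "tensor A N P"
  by (rule tensor_bimodules.intro[OF MN.M.bimodule_axioms NP.bimodule_tensor])

text \<open>For fixed \<open>p\<close>, the map \<open>m \<otimes> n \<mapsto> m \<otimes> (n \<otimes> p)\<close> from which \<^const>\<open>tensor_assoc\<close> is built.\<close>

abbreviation "assoc_inner p \<equiv> tensor_lift A M N M_NP.T
  (\<lambda>m n. M_NP.pure m (NP.pure n p))"

lemma assoc_inner:
  assumes p: "p \<in> carrier P"
  shows "assoc_inner p \<in> hom MN.T M_NP.T"
    and "\<lbrakk>m \<in> carrier M; n \<in> carrier N\<rbrakk> \<Longrightarrow> assoc_inner p (MN.pure m n) =
      M_NP.pure m (NP.pure n p)"
proof -
  have id: "(\<lambda>m. m) \<in> hom (add_monoid M) (add_monoid M)" by (rule homI) simp_all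
  have "(\<lambda>n. NP.pure n p) \<in> hom (add_monoid N) (add_monoid (tensor A N P))"
    using p by (intro homI) (simp_all add: NP.pure_tensor_closed NP.pure_tensor_add_left)
  from pure_tensor_map_balanced[OF M_NP.tensor_factors_axioms id this refl]
  have "balanced A M N M_NP.T
      (\<lambda>m n. M_NP.pure m (NP.pure n p))"
    using p by (simp add: NP.tensor_lsmult(2))
  note props = MN.tensor_lift_props[OF M_NP.tensor_comm_group this]
  show "assoc_inner p \<in> hom MN.T M_NP.T"
    and "\<lbrakk>m \<in> carrier M; n \<in> carrier N\<rbrakk> \<Longrightarrow> assoc_inner p (MN.pure m n) =
      M_NP.pure m (NP.pure n p)"
    using props by auto
qed

lemma tensor_assoc:
  "tensor_assoc A M N P \<in> hom MN_P.T M_NP.T"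
  "\<lbrakk>t \<in> carrier MN.T; p \<in> carrier P\<rbrakk> \<Longrightarrow>
    tensor_assoc A M N P (MN_P.pure t p) = assoc_inner p t"
proof -
  let ?V = M_NP.T
  interpret V: comm_group ?V by (rule M_NP.tensor_comm_group)
  have "balanced A (tensor A M N) P ?V (\<lambda>t p. assoc_inner p t)"
  proof (intro balancedI biadditiveI, unfold carrier_tensor add_tensor)
    fix t p assume t: "t \<in> carrier MN.T" and p: "p \<in> carrier P"
    show "assoc_inner p t \<in> carrier ?V" using hom_in_carrier[OF assoc_inner(1)[OF p] t] .
    show "assoc_inner p (t \<otimes>\<^bsub>MN.T\<^esub> t') = assoc_inner p t \<otimes>\<^bsub>?V\<^esub> assoc_inner p t'"
      if "t' \<in> carrier MN.T" for t'
      using hom_mult[OF assoc_inner(1)[OF p] t that] .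
    show "assoc_inner (p \<oplus>\<^bsub>P\<^esub> p') t = assoc_inner p t \<otimes>\<^bsub>?V\<^esub> assoc_inner p' t"
      if p': "p' \<in> carrier P" for p'
    proof (rule MN.tensor_hom_eqI[OF _ _ V.is_group _ t])
      show "assoc_inner (p \<oplus>\<^bsub>P\<^esub> p') \<in> hom MN.T ?V" using p p' by (intro assoc_inner(1)) simp
      show "(\<lambda>t. assoc_inner p t \<otimes>\<^bsub>?V\<^esub> assoc_inner p' t) \<in> hom MN.T ?V"
        using hom_in_carrier[OF assoc_inner(1)[OF p]] hom_in_carrier[OF assoc_inner(1)[OF p']]
        by (auto intro!: homI simp: hom_mult[OF assoc_inner(1)[OF p]]
            hom_mult[OF assoc_inner(1)[OF p']] V.m_ac)
    qed (simp add: p p' assoc_inner(2) NP.pure_tensor_add_right NP.pure_tensor_closed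
        M_NP.pure_tensor_add_right[unfolded carrier_tensor add_tensor])
    show "assoc_inner p (t \<triangleleft>\<^bsub>tensor A M N\<^esub> a) = assoc_inner (a \<triangleright>\<^bsub>P\<^esub> p) t" if a: "a \<in> carrier A" for a
    proof (rule MN.tensor_hom_eqI[OF _ _ V.is_group _ t])
      show "(\<lambda>t. assoc_inner p (t \<triangleleft>\<^bsub>tensor A M N\<^esub> a)) \<in> hom MN.T ?V"
        using Group.hom_compose[OF MN.tensor_rsmult(1)[OF a] assoc_inner(1)[OF p]]
        by (simp add: comp_def)
      show "assoc_inner (a \<triangleright>\<^bsub>P\<^esub> p) \<in> hom MN.T ?V"
        using a p by (intro assoc_inner(1)) (simp add: NP.N.lsmult_closed)
    qed (simp add: a p assoc_inner(2) MN.tensor_rsmult(2) MN.N.rsmult_closed NP.N.lsmult_closed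
        NP.pure_tensor_middle)
  qed
  note props = MN_P.tensor_lift_props[OF M_NP.tensor_comm_group this]
  show "tensor_assoc A M N P \<in> hom MN_P.T M_NP.T"
    and "\<lbrakk>t \<in> carrier MN.T; p \<in> carrier P\<rbrakk> \<Longrightarrow>
      tensor_assoc A M N P (MN_P.pure t p) = assoc_inner p t"
    using props by (auto simp: tensor_assoc_def Let_def)
qed

text \<open>On \<open>(m \<otimes> n) \<otimes> p\<close> both sides are \<open>m g(n f(p))\<close>. Through this identity the coassociativity law, which
  compares elements of two different triple tensor products, becomes a law about maps between modules.\<close>

lemma contract_right_assoc:
  assumes f: "left_form A P f" and g: "left_form A N g"
    and u: "u \<in> carrier MN_P.T"
  shows "contract_right A M (tensor A N P) (\<lambda>t. g (contract_right A N P f t)) (tensor_assoc A M N P u) =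
    contract_right A M N g (contract_right A (tensor A M N) P f u)"
proof -
  let ?gf = "\<lambda>t. g (contract_right A N P f t)"
  have gf: "left_form A (tensor A N P) ?gf"
    using f g by (intro left_formI) (simp_all add: left_formD[OF g] NP.contract_right_closed
        NP.contract_right_add NP.contract_right_lsmult)
  show ?thesis
  proof (rule MN_P.tensor_hom_eqI[where V = "add_monoid M", OF _ _ MN.M.M.a_group _ u])
    show "(\<lambda>u. contract_right A M (tensor A N P) ?gf (tensor_assoc A M N P u)) \<in>
        hom MN_P.T (add_monoid M)"
      using Group.hom_compose[OF tensor_assoc(1) M_NP.contract_right(1)[OF gf]]
      by (simp add: comp_def)
    have "contract_right A (tensor A M N) P f \<in> hom MN_P.T MN.T"
      using MN_P.contract_right(1)[OF f] by (simp add: hom_def)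
    then show "(\<lambda>u. contract_right A M N g (contract_right A (tensor A M N) P f u)) \<in>
        hom MN_P.T (add_monoid M)"
      using Group.hom_compose[OF _ MN.contract_right(1)[OF g]] by (simp add: comp_def)
    fix t p assume t: "t \<in> carrier (tensor A M N)" and p: "p \<in> carrier P"
    then have tT: "t \<in> carrier MN.T" and fp: "f p \<in> carrier A"
      by (simp_all add: left_formD[OF f])
    have "contract_right A M (tensor A N P) ?gf (assoc_inner p t) =
      contract_right A M N g (t \<triangleleft>\<^bsub>tensor A M N\<^esub> f p)"
    proof (rule MN.tensor_hom_eqI[where V = "add_monoid M", OF _ _ MN.M.M.a_group _ tT])
      show "(\<lambda>t. contract_right A M (tensor A N P) ?gf (assoc_inner p t)) \<in>
          hom MN.T (add_monoid M)"
        using Group.hom_compose[OF assoc_inner(1)[OF p] M_NP.contract_right(1)[OF gf]]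
        by (simp add: comp_def)
      show "(\<lambda>t. contract_right A M N g (t \<triangleleft>\<^bsub>tensor A M N\<^esub> f p)) \<in> hom MN.T (add_monoid M)"
        using Group.hom_compose[OF MN.tensor_rsmult(1)[OF fp] MN.contract_right(1)[OF g]]
        by (simp add: comp_def)
    qed (simp add: p fp assoc_inner(2) M_NP.contract_right(2)[OF gf] NP.pure_tensor_closed
        NP.contract_right(2)[OF f] MN.tensor_rsmult(2) MN.contract_right(2)[OF g] MN.N.rsmult_closed)
    then show "contract_right A M (tensor A N P) ?gf
        (tensor_assoc A M N P (MN_P.pure t p)) =
      contract_right A M N g (contract_right A (tensor A M N) P f (MN_P.pure t p))"
      using tT p t by (simp add: tensor_assoc(2) MN_P.contract_right(2)[OF f])
  qed
qed

end

section \<open>External direct sums\<close>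

text \<open>Only the additive part of \<open>M\<close> is described, so that the rings and the bimodules whose underlying
  group is the direct sum of the \<open>X \<alpha>\<close> are all instances.\<close>

locale external_sum = G: group G
  for G :: "('g, 'w) monoid_scheme" (structure) and X :: "'g \<Rightarrow> ('m, 'y) ring_scheme"
    and M :: "('g \<Rightarrow> 'm, 'z) ring_scheme" +
  assumes component: "\<alpha> \<in> carrier G \<Longrightarrow> abelian_group (X \<alpha>)"
    and carrier_eq: "carrier M =
      {v \<in> \<Pi>\<^sub>E \<alpha>\<in>carrier G. carrier (X \<alpha>). finite {\<alpha> \<in> carrier G. v \<alpha> \<noteq> \<zero>\<^bsub>X \<alpha>\<^esub>}}"
    and zero_eq: "\<zero>\<^bsub>M\<^esub> = (\<lambda>\<alpha>\<in>carrier G. \<zero>\<^bsub>X \<alpha>\<^esub>)"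
    and add_eq: "v \<oplus>\<^bsub>M\<^esub> w = (\<lambda>\<alpha>\<in>carrier G. v \<alpha> \<oplus>\<^bsub>X \<alpha>\<^esub> w \<alpha>)"
begin

abbreviation "support v \<equiv> {\<alpha> \<in> carrier G. v \<alpha> \<noteq> \<zero>\<^bsub>X \<alpha>\<^esub>}"

lemma component_closed: "\<lbrakk>v \<in> carrier M; \<alpha> \<in> carrier G\<rbrakk> \<Longrightarrow> v \<alpha> \<in> carrier (X \<alpha>)"
  by (auto simp: carrier_eq)

lemma finite_support: "v \<in> carrier M \<Longrightarrow> finite (support v)"
  by (simp add: carrier_eq)

lemma memberI:
  assumes "\<And>\<alpha>. \<alpha> \<in> carrier G \<Longrightarrow> v \<alpha> \<in> carrier (X \<alpha>)" "v \<in> extensional (carrier G)"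
    and "finite F" "\<And>\<alpha>. \<lbrakk>\<alpha> \<in> carrier G; \<alpha> \<notin> F\<rbrakk> \<Longrightarrow> v \<alpha> = \<zero>\<^bsub>X \<alpha>\<^esub>"
  shows "v \<in> carrier M"
proof -
  have "finite (support v)"
    using assms(3,4) by (intro finite_subset[OF _ assms(3)]) auto
  then show ?thesis using assms(1,2) by (simp add: carrier_eq PiE_iff)
qed

lemma sum_eqI:
  assumes "v \<in> carrier M" "w \<in> carrier M" "\<And>\<alpha>. \<alpha> \<in> carrier G \<Longrightarrow> v \<alpha> = w \<alpha>"
  shows "v = w"
  using assms by (auto simp: carrier_eq intro: PiE_ext)

lemma zero_component_closed [simp]: "\<alpha> \<in> carrier G \<Longrightarrow> \<zero>\<^bsub>X \<alpha>\<^esub> \<in> carrier (X \<alpha>)"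
  using component abelian_group.axioms(1) abelian_monoid.zero_closed by blast

lemma homogeneous_closed:
  "\<lbrakk>\<alpha> \<in> carrier G; m \<in> carrier (X \<alpha>)\<rbrakk> \<Longrightarrow> homogeneous G X \<alpha> m \<in> carrier M"
  by (rule memberI[where F = "{\<alpha>}"]) (auto simp: homogeneous_def)

lemma zero_closed: "\<zero>\<^bsub>M\<^esub> \<in> carrier M"
  by (rule memberI[where F = "{}"]) (auto simp: zero_eq)

lemma add_closed:
  assumes v: "v \<in> carrier M" and w: "w \<in> carrier M"
  shows "v \<oplus>\<^bsub>M\<^esub> w \<in> carrier M"
proof (rule memberI[where F = "support v \<union> support w"])
  fix \<alpha> assume \<alpha>: "\<alpha> \<in> carrier G"
  interpret X: abelian_group "X \<alpha>" using \<alpha> by (rule component)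
  show "(v \<oplus>\<^bsub>M\<^esub> w) \<alpha> \<in> carrier (X \<alpha>)"
    using \<alpha> v w by (simp add: add_eq component_closed)
  show "(v \<oplus>\<^bsub>M\<^esub> w) \<alpha> = \<zero>\<^bsub>X \<alpha>\<^esub>"
    if "\<alpha> \<notin> support v \<union> support w"
    using \<alpha> that by (simp add: add_eq)
qed (use v w in \<open>auto simp: finite_support add_eq\<close>)

lemma abelian_group_M: "abelian_group M"
proof (rule abelian_groupI)
  fix u v w assume uvw: "u \<in> carrier M" "v \<in> carrier M" "w \<in> carrier M"
  show "u \<oplus>\<^bsub>M\<^esub> v \<in> carrier M" using uvw by (intro add_closed)
  show "(u \<oplus>\<^bsub>M\<^esub> v) \<oplus>\<^bsub>M\<^esub> w = u \<oplus>\<^bsub>M\<^esub> (v \<oplus>\<^bsub>M\<^esub> w)"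
    using uvw by (auto simp: add_eq component_closed abelian_groupE(3)[OF component])
  show "u \<oplus>\<^bsub>M\<^esub> v = v \<oplus>\<^bsub>M\<^esub> u"
    using uvw by (auto simp: add_eq component_closed abelian_groupE(4)[OF component])
next
  show "\<zero>\<^bsub>M\<^esub> \<in> carrier M" by (rule zero_closed)
next
  fix v assume v: "v \<in> carrier M"
  show "\<zero>\<^bsub>M\<^esub> \<oplus>\<^bsub>M\<^esub> v = v"
    using v by (intro sum_eqI add_closed zero_closed)
      (auto simp: add_eq zero_eq component_closed abelian_groupE(5)[OF component])
  define w where "w = (\<lambda>\<alpha>\<in>carrier G. \<ominus>\<^bsub>X \<alpha>\<^esub> v \<alpha>)"
  have w: "w \<in> carrier M"
  proof (rule memberI[where F = "support v"])
    fix \<alpha> assume \<alpha>: "\<alpha> \<in> carrier G"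
    interpret X: abelian_group "X \<alpha>" using \<alpha> by (rule component)
    show "w \<alpha> \<in> carrier (X \<alpha>)" using \<alpha> v by (simp add: w_def component_closed)
    show "w \<alpha> = \<zero>\<^bsub>X \<alpha>\<^esub>" if "\<alpha> \<notin> support v"
      using \<alpha> that X.minus_equality[of "\<zero>\<^bsub>X \<alpha>\<^esub>" "\<zero>\<^bsub>X \<alpha>\<^esub>"] by (simp add: w_def)
  qed (use v in \<open>auto simp: finite_support w_def\<close>)
  moreover have "w \<oplus>\<^bsub>M\<^esub> v = \<zero>\<^bsub>M\<^esub>"
    using v abelian_group.l_neg[OF component]
    by (auto simp: add_eq zero_eq w_def component_closed)
  ultimately show "\<exists>w\<in>carrier M. w \<oplus>\<^bsub>M\<^esub> v = \<zero>\<^bsub>M\<^esub>" by blast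
qed

lemma homogeneous_add:
  assumes "\<alpha> \<in> carrier G" "m \<in> carrier (X \<alpha>)" "n \<in> carrier (X \<alpha>)"
  shows "homogeneous G X \<alpha> (m \<oplus>\<^bsub>X \<alpha>\<^esub> n) = homogeneous G X \<alpha> m \<oplus>\<^bsub>M\<^esub> homogeneous G X \<alpha> n"
  using assms abelian_groupE(5)[OF component] by (auto simp: homogeneous_def add_eq)

lemma homogeneous_zero: "homogeneous G X \<alpha> \<zero>\<^bsub>X \<alpha>\<^esub> = \<zero>\<^bsub>M\<^esub>"
  by (auto simp: homogeneous_def zero_eq)

text \<open>A family with nonempty support is the sum of one of its homogeneous components and a family of
  smaller support.\<close>

lemma sum_induct [consumes 1, case_names zero homogeneous add]:
  assumes "v \<in> carrier M" and zero: "P \<zero>\<^bsub>M\<^esub>"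
    and homogeneous: "\<And>\<alpha> m. \<lbrakk>\<alpha> \<in> carrier G; m \<in> carrier (X \<alpha>)\<rbrakk> \<Longrightarrow> P (homogeneous G X \<alpha> m)"
    and add: "\<And>v w. \<lbrakk>v \<in> carrier M; w \<in> carrier M; P v; P w\<rbrakk> \<Longrightarrow> P (v \<oplus>\<^bsub>M\<^esub> w)"
  shows "P v"
proof -
  have "P v" if "finite F" "v \<in> carrier M" "support v \<subseteq> F" for F v
    using that
  proof (induction F arbitrary: v rule: finite_induct)
    case empty
    then have "v = \<zero>\<^bsub>M\<^esub>" by (intro sum_eqI zero_closed) (auto simp: zero_eq)
    then show ?case using zero by simp
  next
    case (insert \<beta> F)
    show ?case
    proof (cases "\<beta> \<in> carrier G")
      case False
      then show ?thesis using insert by blast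
    next
      case \<beta>: True
      define w where "w = (\<lambda>\<alpha>\<in>carrier G. if \<alpha> = \<beta> then \<zero>\<^bsub>X \<alpha>\<^esub> else v \<alpha>)"
      have w: "w \<in> carrier M"
        using insert by (intro memberI[where F = F]) (auto simp: w_def component_closed)
      have h: "homogeneous G X \<beta> (v \<beta>) \<in> carrier M"
        using \<beta> insert by (intro homogeneous_closed component_closed)
      have "v = homogeneous G X \<beta> (v \<beta>) \<oplus>\<^bsub>M\<^esub> w"
        using w h insert \<beta>
        by (intro sum_eqI add_closed) (auto simp: add_eq w_def homogeneous_def component_closed
            abelian_groupE(5)[OF component] abelian_monoid.r_zero[OF abelian_group.axioms(1)[OF component]])
      moreover have "P w"
      proof (rule insert.IH[OF w])
        show "support w \<subseteq> F"
          using insert.prems(2) by (auto simp: w_def)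
      qed
      moreover have "P (homogeneous G X \<beta> (v \<beta>))"
        using \<beta> insert by (intro homogeneous component_closed)
      ultimately show ?thesis using add w h by metis
    qed
  qed
  then show ?thesis using assms(1) finite_support by blast
qed

lemma hom_eqI:
  assumes h: "h \<in> hom (add_monoid M) V" and k: "k \<in> hom (add_monoid M) V" and V: "group V"
    and eq: "\<And>\<alpha> m. \<lbrakk>\<alpha> \<in> carrier G; m \<in> carrier (X \<alpha>)\<rbrakk> \<Longrightarrow>
      h (homogeneous G X \<alpha> m) = k (homogeneous G X \<alpha> m)"
    and v: "v \<in> carrier M"
  shows "h v = k v"
proof -
  interpret M: abelian_group M by (rule abelian_group_M)
  interpret h: group_hom "add_monoid M" V h
    using h V M.a_group by (simp add: group_hom_def group_hom_axioms_def)
  interpret k: group_hom "add_monoid M" V k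
    using k V M.a_group by (simp add: group_hom_def group_hom_axioms_def)
  show ?thesis
    using v
  proof (induction rule: sum_induct)
    case zero
    then show ?case using h.hom_one k.hom_one by simp
  next
    case (add v w)
    then show ?case using h.hom_mult[of v w] k.hom_mult[of v w] by simp
  qed (rule eq)
qed

lemma finsum_component:
  assumes "finite F" "\<And>i. i \<in> F \<Longrightarrow> d i \<in> carrier M" "\<alpha> \<in> carrier G"
  shows "finsum M d F \<alpha> = (\<Oplus>\<^bsub>X \<alpha>\<^esub>i\<in>F. d i \<alpha>)"
proof -
  interpret M: abelian_group M by (rule abelian_group_M)
  interpret X: abelian_group "X \<alpha>" using assms(3) by (rule component)
  show ?thesis
    using assms(1,2)
  proof (induction F rule: finite_induct)
    case empty
    then show ?case using assms(3) by (simp add: zero_eq)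
  next
    case (insert i F)
    then show ?case
      using assms(3) by (simp add: add_eq Pi_iff component_closed)
  qed
qed

lemma subgroup_component:
  assumes \<alpha>: "\<alpha> \<in> carrier G"
  shows "subgroup (homogeneous G X \<alpha> ` carrier (X \<alpha>)) (add_monoid M)"
proof -
  interpret M: abelian_group M by (rule abelian_group_M)
  interpret X: abelian_group "X \<alpha>" using \<alpha> by (rule component)
  have "group_hom (add_monoid (X \<alpha>)) (add_monoid M) (homogeneous G X \<alpha>)"
    using \<alpha> homogeneous_add homogeneous_closed X.a_group M.a_group
    by (auto simp: group_hom_def group_hom_axioms_def intro!: homI)
  then have "subgroup (homogeneous G X \<alpha> ` carrier (add_monoid (X \<alpha>))) (add_monoid M)"
    by (rule group_hom.img_is_subgroup)
  then show ?thesis by simp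
qed

text \<open>The homogeneous components of \<open>m\<close> form one decomposition, and evaluating a decomposition at each
  degree shows that there is no other.\<close>

lemma internal_direct_sum: "internal_direct_sum G M (\<lambda>\<alpha>. homogeneous G X \<alpha> ` carrier (X \<alpha>))"
  unfolding internal_direct_sum_def
proof (intro conjI ballI subgroup_component)
  interpret M: abelian_group M by (rule abelian_group_M)
  fix m assume m: "m \<in> carrier M"
  let ?D = "\<lambda>\<alpha>. homogeneous G X \<alpha> ` carrier (X \<alpha>)"
  define d where "d = (\<lambda>\<alpha>\<in>carrier G. homogeneous G X \<alpha> (m \<alpha>))"
  have zero_iff: "homogeneous G X \<alpha> n = \<zero>\<^bsub>M\<^esub> \<longleftrightarrow> n = \<zero>\<^bsub>X \<alpha>\<^esub>" if "\<alpha> \<in> carrier G" for \<alpha> n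
    using that homogeneous_zero[of \<alpha>] by (auto simp: homogeneous_def zero_eq fun_eq_iff dest!: spec[of _ \<alpha>])
  \<comment> \<open>The component of degree \<open>\<beta>\<close> of a sum of homogeneous elements is the summand with index \<open>\<beta>\<close>.\<close>
  have eval: "finsum M e {\<alpha> \<in> carrier G. e \<alpha> \<noteq> \<zero>\<^bsub>M\<^esub>} \<beta> = e \<beta> \<beta>"
    if e: "e \<in> (\<Pi>\<^sub>E \<alpha>\<in>carrier G. ?D \<alpha>)" and fin: "finite {\<alpha> \<in> carrier G. e \<alpha> \<noteq> \<zero>\<^bsub>M\<^esub>}"
      and \<beta>: "\<beta> \<in> carrier G" for e \<beta>
  proof -
    interpret X: abelian_group "X \<beta>" using \<beta> by (rule component)
    have eM: "e \<alpha> \<in> carrier M" if "\<alpha> \<in> carrier G" for \<alpha>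
      using e that homogeneous_closed by fastforce
    have off: "e \<alpha> \<beta> = \<zero>\<^bsub>X \<beta>\<^esub>" if "\<alpha> \<in> carrier G" "\<alpha> \<noteq> \<beta>" for \<alpha>
      using PiE_mem[OF e that(1)] that(2) \<beta> by (auto simp: homogeneous_def)
    have eb: "e \<beta> \<beta> \<in> carrier (X \<beta>)" using eM \<beta> by (intro component_closed)
    have "finsum M e {\<alpha> \<in> carrier G. e \<alpha> \<noteq> \<zero>\<^bsub>M\<^esub>} \<beta> =
        (\<Oplus>\<^bsub>X \<beta>\<^esub>\<alpha>\<in>{\<alpha> \<in> carrier G. e \<alpha> \<noteq> \<zero>\<^bsub>M\<^esub>}. e \<alpha> \<beta>)"
      using fin eM \<beta> by (intro finsum_component) auto
    also have "\<dots> = (\<Oplus>\<^bsub>X \<beta>\<^esub>\<alpha>\<in>{\<alpha> \<in> carrier G. e \<alpha> \<noteq> \<zero>\<^bsub>M\<^esub>}. if \<beta> = \<alpha> then e \<alpha> \<beta> else \<zero>\<^bsub>X \<beta>\<^esub>)"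
      using off eM component_closed \<beta> by (intro X.finsum_cong) (auto simp: simp_implies_def)
    also have "\<dots> = e \<beta> \<beta>"
    proof (cases "e \<beta> = \<zero>\<^bsub>M\<^esub>")
      case True
      then have "e \<beta> \<beta> = \<zero>\<^bsub>X \<beta>\<^esub>" using \<beta> by (simp add: zero_eq)
      then show ?thesis by (auto intro: X.add.finprod_one_eqI)
    next
      case False
      then show ?thesis
        using fin \<beta> eM component_closed X.finsum_singleton[of \<beta> _ "\<lambda>\<alpha>. e \<alpha> \<beta>"] by auto
    qed
    finally show ?thesis .
  qed
  have d: "d \<in> (\<Pi>\<^sub>E \<alpha>\<in>carrier G. ?D \<alpha>)" using m by (auto simp: d_def component_closed)
  show "\<exists>!d. d \<in> (\<Pi>\<^sub>E \<alpha>\<in>carrier G. ?D \<alpha>) \<and> finite {\<alpha> \<in> carrier G. d \<alpha> \<noteq> \<zero>\<^bsub>M\<^esub>} \<and>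
      m = (\<Oplus>\<^bsub>M\<^esub>\<alpha>\<in>{\<alpha> \<in> carrier G. d \<alpha> \<noteq> \<zero>\<^bsub>M\<^esub>}. d \<alpha>)"
  proof (intro ex1I conjI)
    show "d \<in> (\<Pi>\<^sub>E \<alpha>\<in>carrier G. ?D \<alpha>)" by (rule d)
    have "{\<alpha> \<in> carrier G. d \<alpha> \<noteq> \<zero>\<^bsub>M\<^esub>} = {\<alpha> \<in> carrier G. m \<alpha> \<noteq> \<zero>\<^bsub>X \<alpha>\<^esub>}"
      by (auto simp: d_def zero_iff)
    then show fin: "finite {\<alpha> \<in> carrier G. d \<alpha> \<noteq> \<zero>\<^bsub>M\<^esub>}" using finite_support[OF m] by simp
    show "m = (\<Oplus>\<^bsub>M\<^esub>\<alpha>\<in>{\<alpha> \<in> carrier G. d \<alpha> \<noteq> \<zero>\<^bsub>M\<^esub>}. d \<alpha>)"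
    proof (rule sum_eqI[OF m])
      show "(\<Oplus>\<^bsub>M\<^esub>\<alpha>\<in>{\<alpha> \<in> carrier G. d \<alpha> \<noteq> \<zero>\<^bsub>M\<^esub>}. d \<alpha>) \<in> carrier M"
        using m by (intro M.finsum_closed) (auto simp: d_def component_closed homogeneous_closed)
      show "m \<alpha> = (\<Oplus>\<^bsub>M\<^esub>\<alpha>\<in>{\<alpha> \<in> carrier G. d \<alpha> \<noteq> \<zero>\<^bsub>M\<^esub>}. d \<alpha>) \<alpha>" if "\<alpha> \<in> carrier G" for \<alpha>
        using that eval[OF d fin] by (simp add: d_def homogeneous_def)
    qed
  next
    fix e assume e: "e \<in> (\<Pi>\<^sub>E \<alpha>\<in>carrier G. ?D \<alpha>) \<and> finite {\<alpha> \<in> carrier G. e \<alpha> \<noteq> \<zero>\<^bsub>M\<^esub>} \<and>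
      m = (\<Oplus>\<^bsub>M\<^esub>\<alpha>\<in>{\<alpha> \<in> carrier G. e \<alpha> \<noteq> \<zero>\<^bsub>M\<^esub>}. e \<alpha>)"
    have "e \<beta> = d \<beta>" if \<beta>: "\<beta> \<in> carrier G" for \<beta>
    proof -
      have eD: "e \<in> (\<Pi>\<^sub>E \<alpha>\<in>carrier G. ?D \<alpha>)" using e by blast
      obtain n where n: "e \<beta> = homogeneous G X \<beta> n" using PiE_mem[OF eD \<beta>] by blast
      have "e \<beta> \<beta> = m \<beta>" using e eval[of e \<beta>] \<beta> by metis
      then have "n = m \<beta>" using n \<beta> by (simp add: homogeneous_def)
      then show ?thesis using n \<beta> by (simp add: d_def)
    qed
    then show "e = d"
      using e by (intro PiE_ext[of e "carrier G" ?D d]) (use d in blast)+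
  qed
qed

end

lemma external_sum_gr_ring_of:
  assumes "group G" "\<And>\<alpha>. \<alpha> \<in> carrier G \<Longrightarrow> abelian_group (X \<alpha>)"
  shows "external_sum G X (gr_ring_of G X m u)"
  using assms
  by (simp add: external_sum_def external_sum_axioms_def gr_ring_of_def Let_def carrier_sum_group
      abelian_group.a_group)

lemma external_sum_gr_bimod_of:
  assumes "group G" "\<And>\<alpha>. \<alpha> \<in> carrier G \<Longrightarrow> abelian_group (X \<alpha>)"
  shows "external_sum G X (gr_bimod_of G X l r)"
  using assms
  by (simp add: external_sum_def external_sum_axioms_def gr_bimod_of_def Let_def carrier_sum_group
      abelian_group.a_group)

section \<open>Biadditive extension of homogeneous operations\<close>

definition graded_pairing ::
  "('g, 'w) monoid_scheme \<Rightarrow> ('g \<Rightarrow> ('x, 'u) ring_scheme) \<Rightarrow> ('g \<Rightarrow> ('y, 'v) ring_scheme) \<Rightarrow>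
    ('g \<Rightarrow> ('z, 't) ring_scheme) \<Rightarrow> ('g \<Rightarrow> 'g \<Rightarrow> 'x \<Rightarrow> 'y \<Rightarrow> 'z) \<Rightarrow> bool" where
  "graded_pairing G X Y Z op \<longleftrightarrow> (\<forall>\<alpha>\<in>carrier G. \<forall>\<beta>\<in>carrier G.
     biadditive (X \<alpha>) (Y \<beta>) (add_monoid (Z (\<alpha> \<otimes>\<^bsub>G\<^esub> \<beta>))) (op \<alpha> \<beta>))"

lemma graded_pairingI:
  assumes "\<And>\<alpha> \<beta> a b. \<lbrakk>\<alpha> \<in> carrier G; \<beta> \<in> carrier G; a \<in> carrier (X \<alpha>); b \<in> carrier (Y \<beta>)\<rbrakk> \<Longrightarrow>
      op \<alpha> \<beta> a b \<in> carrier (Z (\<alpha> \<otimes>\<^bsub>G\<^esub> \<beta>))"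
    and "\<And>\<alpha> \<beta> a a' b. \<lbrakk>\<alpha> \<in> carrier G; \<beta> \<in> carrier G; a \<in> carrier (X \<alpha>); a' \<in> carrier (X \<alpha>);
        b \<in> carrier (Y \<beta>)\<rbrakk> \<Longrightarrow>
      op \<alpha> \<beta> (a \<oplus>\<^bsub>X \<alpha>\<^esub> a') b = op \<alpha> \<beta> a b \<oplus>\<^bsub>Z (\<alpha> \<otimes>\<^bsub>G\<^esub> \<beta>)\<^esub> op \<alpha> \<beta> a' b"
    and "\<And>\<alpha> \<beta> a b b'. \<lbrakk>\<alpha> \<in> carrier G; \<beta> \<in> carrier G; a \<in> carrier (X \<alpha>); b \<in> carrier (Y \<beta>);
        b' \<in> carrier (Y \<beta>)\<rbrakk> \<Longrightarrow>
      op \<alpha> \<beta> a (b \<oplus>\<^bsub>Y \<beta>\<^esub> b') = op \<alpha> \<beta> a b \<oplus>\<^bsub>Z (\<alpha> \<otimes>\<^bsub>G\<^esub> \<beta>)\<^esub> op \<alpha> \<beta> a b'"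
  shows "graded_pairing G X Y Z op"
  using assms by (simp add: graded_pairing_def biadditive_def)

locale paired_sums =
  X: external_sum G X M + Y: external_sum G Y N + Z: external_sum G Z V
  for G :: "('g, 'w) monoid_scheme" (structure)
    and X :: "'g \<Rightarrow> ('x, 'u) ring_scheme" and M :: "('g \<Rightarrow> 'x, 'u1) ring_scheme"
    and Y :: "'g \<Rightarrow> ('y, 'v) ring_scheme" and N :: "('g \<Rightarrow> 'y, 'v1) ring_scheme"
    and Z :: "'g \<Rightarrow> ('z, 't) ring_scheme" and V :: "('g \<Rightarrow> 'z, 't1) ring_scheme" +
  fixes op :: "'g \<Rightarrow> 'g \<Rightarrow> 'x \<Rightarrow> 'y \<Rightarrow> 'z"
  assumes pairing: "graded_pairing G X Y Z op"
begin

abbreviation "summand v w \<gamma> \<alpha> \<equiv> op \<alpha> (inv \<alpha> \<otimes> \<gamma>) (v \<alpha>) (w (inv \<alpha> \<otimes> \<gamma>))"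

lemma op_biadditive:
  "\<lbrakk>\<alpha> \<in> carrier G; \<beta> \<in> carrier G\<rbrakk> \<Longrightarrow>
    biadditive (X \<alpha>) (Y \<beta>) (add_monoid (Z (\<alpha> \<otimes> \<beta>))) (op \<alpha> \<beta>)"
  using pairing by (simp add: graded_pairing_def)

lemmas op_closed = biadditiveD(1)[OF op_biadditive, simplified]
  and op_add_left = biadditiveD(2)[OF op_biadditive, simplified]
  and op_add_right = biadditiveD(3)[OF op_biadditive, simplified]

lemma op_zero_left:
  assumes "\<alpha> \<in> carrier G" "\<beta> \<in> carrier G" "b \<in> carrier (Y \<beta>)"
  shows "op \<alpha> \<beta> \<zero>\<^bsub>X \<alpha>\<^esub> b = \<zero>\<^bsub>Z (\<alpha> \<otimes> \<beta>)\<^esub>"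
  using biadditive_zero(1)[OF op_biadditive[OF assms(1,2)] X.component Y.component
      abelian_group.a_group[OF Z.component]] assms by simp

lemma op_zero_right:
  assumes "\<alpha> \<in> carrier G" "\<beta> \<in> carrier G" "a \<in> carrier (X \<alpha>)"
  shows "op \<alpha> \<beta> a \<zero>\<^bsub>Y \<beta>\<^esub> = \<zero>\<^bsub>Z (\<alpha> \<otimes> \<beta>)\<^esub>"
  using biadditive_zero(2)[OF op_biadditive[OF assms(1,2)] X.component Y.component
      abelian_group.a_group[OF Z.component]] assms by simp

lemma undo: "\<lbrakk>\<alpha> \<in> carrier G; \<gamma> \<in> carrier G\<rbrakk> \<Longrightarrow> \<alpha> \<otimes> (inv \<alpha> \<otimes> \<gamma>) = \<gamma>"
  by (simp add: X.G.m_assoc[symmetric])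

lemma term_closed:
  assumes "v \<in> carrier M" "w \<in> carrier N" "\<alpha> \<in> carrier G" "\<gamma> \<in> carrier G"
  shows "summand v w \<gamma> \<alpha> \<in> carrier (Z \<gamma>)"
  using assms op_closed[of \<alpha> "inv \<alpha> \<otimes> \<gamma>" "v \<alpha>" "w (inv \<alpha> \<otimes> \<gamma>)"]
  by (simp add: undo X.component_closed Y.component_closed)

text \<open>Degrees outside the support of \<open>v\<close> contribute zero, so the sum may run over any larger finite set. This
  gives a common index set for \<open>v\<close>, \<open>v'\<close> and \<open>v \<oplus> v'\<close>, from which additivity follows.\<close>

lemma graded_ext_over:
  assumes v: "v \<in> carrier M" and w: "w \<in> carrier N" and \<gamma>: "\<gamma> \<in> carrier G"
    and F: "finite F" "F \<subseteq> carrier G" "X.support v \<subseteq> F"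
  shows "graded_ext G X Z op v w \<gamma> =
    (\<Oplus>\<^bsub>Z \<gamma>\<^esub>\<alpha>\<in>F. summand v w \<gamma> \<alpha>)"
proof -
  interpret Zg: abelian_group "Z \<gamma>" using \<gamma> by (rule Z.component)
  have "summand v w \<gamma> \<alpha> = \<zero>\<^bsub>Z \<gamma>\<^esub>"
    if "\<alpha> \<in> F - X.support v" for \<alpha>
    using that F \<gamma> w op_zero_left[of \<alpha> "inv \<alpha> \<otimes> \<gamma>" "w (inv \<alpha> \<otimes> \<gamma>)"]
    by (auto simp: undo Y.component_closed)
  then show ?thesis
    unfolding graded_ext_def using \<gamma> F v w
    by (simp, intro Zg.add.finprod_mono_neutral_cong_left) (auto simp: term_closed)
qed

text \<open>The support of the product lies in the finite set of products of the two supports.\<close>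

lemma graded_ext_closed:
  assumes v: "v \<in> carrier M" and w: "w \<in> carrier N"
  shows "graded_ext G X Z op v w \<in> carrier V"
proof (rule Z.memberI[where F = "(\<lambda>(\<alpha>, \<beta>). \<alpha> \<otimes> \<beta>) `
    (X.support v \<times> Y.support w)"])
  fix \<gamma> assume \<gamma>: "\<gamma> \<in> carrier G"
  interpret Zg: abelian_group "Z \<gamma>" using \<gamma> by (rule Z.component)
  show "graded_ext G X Z op v w \<gamma> \<in> carrier (Z \<gamma>)"
    using \<gamma> v w by (auto simp: graded_ext_def intro!: Zg.finsum_closed term_closed)
  assume out: "\<gamma> \<notin> (\<lambda>(\<alpha>, \<beta>). \<alpha> \<otimes> \<beta>) `
    (X.support v \<times> Y.support w)"
  have "summand v w \<gamma> \<alpha> = \<zero>\<^bsub>Z \<gamma>\<^esub>"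
    if "\<alpha> \<in> X.support v" for \<alpha>
  proof -
    have "w (inv \<alpha> \<otimes> \<gamma>) = \<zero>\<^bsub>Y (inv \<alpha> \<otimes> \<gamma>)\<^esub>"
    proof (rule ccontr)
      assume "w (inv \<alpha> \<otimes> \<gamma>) \<noteq> \<zero>\<^bsub>Y (inv \<alpha> \<otimes> \<gamma>)\<^esub>"
      then have "\<gamma> \<in> (\<lambda>(\<alpha>, \<beta>). \<alpha> \<otimes> \<beta>) `
          (X.support v \<times> Y.support w)"
        using that \<gamma> undo[of \<alpha> \<gamma>] by (intro image_eqI[of _ _ "(\<alpha>, inv \<alpha> \<otimes> \<gamma>)"]) auto
      then show False using out by simp
    qed
    then show ?thesis
      using that \<gamma> v op_zero_right[of \<alpha> "inv \<alpha> \<otimes> \<gamma>" "v \<alpha>"]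
      by (simp add: undo X.component_closed)
  qed
  then show "graded_ext G X Z op v w \<gamma> = \<zero>\<^bsub>Z \<gamma>\<^esub>"
    using \<gamma> by (simp add: graded_ext_def Zg.add.finprod_one_eqI cong: Zg.finsum_cong)
qed (use v w in \<open>auto simp: X.finite_support Y.finite_support graded_ext_def\<close>)

lemma graded_ext_biadditive: "biadditive M N (add_monoid V) (graded_ext G X Z op)"
proof (intro biadditiveI, goal_cases)
  case (1 v w)
  then show ?case by (simp add: graded_ext_closed)
next
  case (2 v v' w)
  let ?F = "X.support v \<union> X.support v'"
  have F: "finite ?F" using 2 by (simp add: X.finite_support)
  have "graded_ext G X Z op (v \<oplus>\<^bsub>M\<^esub> v') w = graded_ext G X Z op v w \<oplus>\<^bsub>V\<^esub> graded_ext G X Z op v' w"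
  proof (rule Z.sum_eqI)
    fix \<gamma> assume \<gamma>: "\<gamma> \<in> carrier G"
    interpret Zg: abelian_group "Z \<gamma>" using \<gamma> by (rule Z.component)
    have supp: "{\<alpha> \<in> carrier G. (v \<oplus>\<^bsub>M\<^esub> v') \<alpha> \<noteq> \<zero>\<^bsub>X \<alpha>\<^esub>} \<subseteq> ?F"
      using abelian_groupE(5)[OF X.component] by (auto simp: X.add_eq)
    have "graded_ext G X Z op (v \<oplus>\<^bsub>M\<^esub> v') w \<gamma> =
      (\<Oplus>\<^bsub>Z \<gamma>\<^esub>\<alpha>\<in>?F. summand (v \<oplus>\<^bsub>M\<^esub> v') w \<gamma> \<alpha>)"
      using 2 \<gamma> F supp by (intro graded_ext_over) (auto simp: X.add_closed)
    also have "\<dots> = (\<Oplus>\<^bsub>Z \<gamma>\<^esub>\<alpha>\<in>?F. summand v w \<gamma> \<alpha> \<oplus>\<^bsub>Z \<gamma>\<^esub>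
        summand v' w \<gamma> \<alpha>)"
    proof (rule Zg.finsum_cong')
      show "(\<lambda>\<alpha>. summand v w \<gamma> \<alpha> \<oplus>\<^bsub>Z \<gamma>\<^esub>
        summand v' w \<gamma> \<alpha>) \<in> ?F \<rightarrow> carrier (Z \<gamma>)"
        using 2 \<gamma> by (auto intro!: term_closed)
      fix \<alpha> assume "\<alpha> \<in> ?F"
      then have \<alpha>: "\<alpha> \<in> carrier G" by auto
      show "summand (v \<oplus>\<^bsub>M\<^esub> v') w \<gamma> \<alpha> =
        summand v w \<gamma> \<alpha> \<oplus>\<^bsub>Z \<gamma>\<^esub>
        summand v' w \<gamma> \<alpha>"
        using \<alpha> \<gamma> 2 op_add_left[of \<alpha> "inv \<alpha> \<otimes> \<gamma>" "v \<alpha>" "v' \<alpha>" "w (inv \<alpha> \<otimes> \<gamma>)"]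
        by (simp add: X.add_eq undo X.component_closed Y.component_closed)
    qed simp
    also have "\<dots> = (\<Oplus>\<^bsub>Z \<gamma>\<^esub>\<alpha>\<in>?F. summand v w \<gamma> \<alpha>) \<oplus>\<^bsub>Z \<gamma>\<^esub>
        (\<Oplus>\<^bsub>Z \<gamma>\<^esub>\<alpha>\<in>?F. summand v' w \<gamma> \<alpha>)"
      using 2 \<gamma> by (intro Zg.finsum_addf) (auto intro!: term_closed)
    also have "\<dots> = (graded_ext G X Z op v w \<oplus>\<^bsub>V\<^esub> graded_ext G X Z op v' w) \<gamma>"
      using graded_ext_over[of v w \<gamma> ?F] graded_ext_over[of v' w \<gamma> ?F] 2 \<gamma> F by (simp add: Z.add_eq)
    finally show "graded_ext G X Z op (v \<oplus>\<^bsub>M\<^esub> v') w \<gamma> =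
      (graded_ext G X Z op v w \<oplus>\<^bsub>V\<^esub> graded_ext G X Z op v' w) \<gamma>" .
  qed (use 2 in \<open>auto intro!: graded_ext_closed X.add_closed Z.add_closed\<close>)
  then show ?case by simp
next
  case (3 v w w')
  have "graded_ext G X Z op v (w \<oplus>\<^bsub>N\<^esub> w') = graded_ext G X Z op v w \<oplus>\<^bsub>V\<^esub> graded_ext G X Z op v w'"
  proof (rule Z.sum_eqI)
    fix \<gamma> assume \<gamma>: "\<gamma> \<in> carrier G"
    interpret Zg: abelian_group "Z \<gamma>" using \<gamma> by (rule Z.component)
    let ?F = "X.support v"
    have "(\<Oplus>\<^bsub>Z \<gamma>\<^esub>\<alpha>\<in>?F. summand v (w \<oplus>\<^bsub>N\<^esub> w') \<gamma> \<alpha>) =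
      (\<Oplus>\<^bsub>Z \<gamma>\<^esub>\<alpha>\<in>?F. summand v w \<gamma> \<alpha> \<oplus>\<^bsub>Z \<gamma>\<^esub>
        summand v w' \<gamma> \<alpha>)"
    proof (rule Zg.finsum_cong')
      show "(\<lambda>\<alpha>. summand v w \<gamma> \<alpha> \<oplus>\<^bsub>Z \<gamma>\<^esub>
        summand v w' \<gamma> \<alpha>) \<in> ?F \<rightarrow> carrier (Z \<gamma>)"
        using 3 \<gamma> by (auto intro!: term_closed)
      fix \<alpha> assume "\<alpha> \<in> ?F"
      then have \<alpha>: "\<alpha> \<in> carrier G" by auto
      show "summand v (w \<oplus>\<^bsub>N\<^esub> w') \<gamma> \<alpha> =
        summand v w \<gamma> \<alpha> \<oplus>\<^bsub>Z \<gamma>\<^esub>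
        summand v w' \<gamma> \<alpha>"
        using \<alpha> \<gamma> 3 op_add_right[of \<alpha> "inv \<alpha> \<otimes> \<gamma>" "v \<alpha>" "w (inv \<alpha> \<otimes> \<gamma>)" "w' (inv \<alpha> \<otimes> \<gamma>)"]
        by (simp add: Y.add_eq undo X.component_closed Y.component_closed)
    qed simp
    also have "\<dots> = (\<Oplus>\<^bsub>Z \<gamma>\<^esub>\<alpha>\<in>?F. summand v w \<gamma> \<alpha>) \<oplus>\<^bsub>Z \<gamma>\<^esub>
        (\<Oplus>\<^bsub>Z \<gamma>\<^esub>\<alpha>\<in>?F. summand v w' \<gamma> \<alpha>)"
      using 3 \<gamma> by (intro Zg.finsum_addf) (auto intro!: term_closed)
    finally show "graded_ext G X Z op v (w \<oplus>\<^bsub>N\<^esub> w') \<gamma> =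
      (graded_ext G X Z op v w \<oplus>\<^bsub>V\<^esub> graded_ext G X Z op v w') \<gamma>"
      using \<gamma> by (simp add: graded_ext_def Z.add_eq)
  qed (use 3 in \<open>auto intro!: graded_ext_closed Y.add_closed Z.add_closed\<close>)
  then show ?case by simp
qed

lemmas graded_ext_add_left = biadditiveD(2)[OF graded_ext_biadditive, simplified]
  and graded_ext_add_right = biadditiveD(3)[OF graded_ext_biadditive, simplified]

lemma graded_ext_homogeneous_eq:
  assumes "\<alpha> \<in> carrier G" "\<beta> \<in> carrier G" "a \<in> carrier (X \<alpha>)" "b \<in> carrier (Y \<beta>)"
  shows "graded_ext G X Z op (homogeneous G X \<alpha> a) (homogeneous G Y \<beta> b) =
    homogeneous G Z (\<alpha> \<otimes> \<beta>) (op \<alpha> \<beta> a b)"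
  using assms X.G.group_axioms Z.component op_closed op_zero_left op_zero_right
  by (intro graded_ext_homogeneous) auto

end

section \<open>Morita contexts from homogeneous data\<close>

text \<open>The law \<open>(ab)c = a(bc)\<close> for homogeneous elements. The four products may all be different, which is
  why balancedness, linearity of a pairing and the Morita identities are of this form too.\<close>

definition graded_associative ::
  "('g, 'w) monoid_scheme \<Rightarrow> ('g \<Rightarrow> ('x, 'x1) ring_scheme) \<Rightarrow> ('g \<Rightarrow> ('y, 'y1) ring_scheme) \<Rightarrow>
    ('g \<Rightarrow> ('z, 'z1) ring_scheme) \<Rightarrow> ('g \<Rightarrow> 'g \<Rightarrow> 'x \<Rightarrow> 'y \<Rightarrow> 'xy) \<Rightarrow> ('g \<Rightarrow> 'g \<Rightarrow> 'xy \<Rightarrow> 'z \<Rightarrow> 'v) \<Rightarrow>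
    ('g \<Rightarrow> 'g \<Rightarrow> 'y \<Rightarrow> 'z \<Rightarrow> 'yz) \<Rightarrow> ('g \<Rightarrow> 'g \<Rightarrow> 'x \<Rightarrow> 'yz \<Rightarrow> 'v) \<Rightarrow> bool" where
  "graded_associative G X Y Z p q p' q' \<longleftrightarrow>
     (\<forall>\<alpha>\<in>carrier G. \<forall>\<beta>\<in>carrier G. \<forall>\<gamma>\<in>carrier G.
       \<forall>a\<in>carrier (X \<alpha>). \<forall>b\<in>carrier (Y \<beta>). \<forall>c\<in>carrier (Z \<gamma>).
         q (\<alpha> \<otimes>\<^bsub>G\<^esub> \<beta>) \<gamma> (p \<alpha> \<beta> a b) c = q' \<alpha> (\<beta> \<otimes>\<^bsub>G\<^esub> \<gamma>) a (p' \<beta> \<gamma> b c))"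

lemma graded_associativeI:
  assumes "\<And>\<alpha> \<beta> \<gamma> a b c. \<lbrakk>\<alpha> \<in> carrier G; \<beta> \<in> carrier G; \<gamma> \<in> carrier G;
      a \<in> carrier (X \<alpha>); b \<in> carrier (Y \<beta>); c \<in> carrier (Z \<gamma>)\<rbrakk> \<Longrightarrow>
      q (\<alpha> \<otimes>\<^bsub>G\<^esub> \<beta>) \<gamma> (p \<alpha> \<beta> a b) c = q' \<alpha> (\<beta> \<otimes>\<^bsub>G\<^esub> \<gamma>) a (p' \<beta> \<gamma> b c)"
  shows "graded_associative G X Y Z p q p' q'"
  using assms by (simp add: graded_associative_def)

text \<open>An additive map on a direct sum is determined by its values on homogeneous elements; this is applied
  to one argument after the other.\<close>

lemma triadditive_eqI:
  fixes F F' :: "('g \<Rightarrow> 'x) \<Rightarrow> ('g \<Rightarrow> 'y) \<Rightarrow> ('g \<Rightarrow> 'z) \<Rightarrow> 'v"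
  assumes X: "external_sum G X M" and Y: "external_sum G Y N" and Z: "external_sum G Z K"
    and V: "group V"
    and F1: "\<And>v w. \<lbrakk>v \<in> carrier N; w \<in> carrier K\<rbrakk> \<Longrightarrow> (\<lambda>u. F u v w) \<in> hom (add_monoid M) V"
    and F2: "\<And>u w. \<lbrakk>u \<in> carrier M; w \<in> carrier K\<rbrakk> \<Longrightarrow> (\<lambda>v. F u v w) \<in> hom (add_monoid N) V"
    and F3: "\<And>u v. \<lbrakk>u \<in> carrier M; v \<in> carrier N\<rbrakk> \<Longrightarrow> F u v \<in> hom (add_monoid K) V"
    and F1': "\<And>v w. \<lbrakk>v \<in> carrier N; w \<in> carrier K\<rbrakk> \<Longrightarrow> (\<lambda>u. F' u v w) \<in> hom (add_monoid M) V"
    and F2': "\<And>u w. \<lbrakk>u \<in> carrier M; w \<in> carrier K\<rbrakk> \<Longrightarrow> (\<lambda>v. F' u v w) \<in> hom (add_monoid N) V"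
    and F3': "\<And>u v. \<lbrakk>u \<in> carrier M; v \<in> carrier N\<rbrakk> \<Longrightarrow> F' u v \<in> hom (add_monoid K) V"
    and eq: "\<And>\<alpha> \<beta> \<gamma> a b c. \<lbrakk>\<alpha> \<in> carrier G; \<beta> \<in> carrier G; \<gamma> \<in> carrier G; a \<in> carrier (X \<alpha>);
        b \<in> carrier (Y \<beta>); c \<in> carrier (Z \<gamma>)\<rbrakk> \<Longrightarrow>
      F (homogeneous G X \<alpha> a) (homogeneous G Y \<beta> b) (homogeneous G Z \<gamma> c) =
      F' (homogeneous G X \<alpha> a) (homogeneous G Y \<beta> b) (homogeneous G Z \<gamma> c)"
    and uvw: "u \<in> carrier M" "v \<in> carrier N" "w \<in> carrier K"
  shows "F u v w = F' u v w"
proof -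
  interpret X: external_sum G X M by (rule X)
  interpret Y: external_sum G Y N by (rule Y)
  interpret Z: external_sum G Z K by (rule Z)
  have 1: "F u (homogeneous G Y \<beta> b) (homogeneous G Z \<gamma> c) =
      F' u (homogeneous G Y \<beta> b) (homogeneous G Z \<gamma> c)"
    if "\<beta> \<in> carrier G" "\<gamma> \<in> carrier G" "b \<in> carrier (Y \<beta>)" "c \<in> carrier (Z \<gamma>)" for \<beta> \<gamma> b c
  proof (rule X.hom_eqI[where h = "\<lambda>u. F u _ _" and k = "\<lambda>u. F' u _ _", OF F1 F1' V _ uvw(1)])
    show "homogeneous G Y \<beta> b \<in> carrier N" "homogeneous G Y \<beta> b \<in> carrier N"
      "homogeneous G Z \<gamma> c \<in> carrier K" "homogeneous G Z \<gamma> c \<in> carrier K"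
      using that by (simp_all add: Y.homogeneous_closed Z.homogeneous_closed)
  qed (use that in \<open>auto intro: eq\<close>)
  have 2: "F u v (homogeneous G Z \<gamma> c) = F' u v (homogeneous G Z \<gamma> c)"
    if "\<gamma> \<in> carrier G" "c \<in> carrier (Z \<gamma>)" for \<gamma> c
  proof (rule Y.hom_eqI[where h = "\<lambda>v. F u v _" and k = "\<lambda>v. F' u v _", OF F2 F2' V _ uvw(2)])
    show "homogeneous G Z \<gamma> c \<in> carrier K" "homogeneous G Z \<gamma> c \<in> carrier K"
      using that by (simp_all add: Z.homogeneous_closed)
  qed (use that uvw in \<open>simp_all add: 1\<close>)
  show ?thesis
    using Z.hom_eqI[where h = "F u v" and k = "F' u v", OF F3 F3' V 2 uvw(3)] uvw by blast
qed

text \<open>Both sides are additive in each of \<open>u\<close>, \<open>v\<close> and \<open>w\<close>, and on homogeneous elements they agree by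
  hypothesis.\<close>

lemma graded_ext_associative:
  assumes XY: "paired_sums G X M Y N XY MN p" and XY_Z: "paired_sums G XY MN Z K W V q"
    and YZ: "paired_sums G Y N Z K YZ NK p'" and X_YZ: "paired_sums G X M YZ NK W V q'"
    and assoc: "graded_associative G X Y Z p q p' q'"
    and uvw: "u \<in> carrier M" "v \<in> carrier N" "w \<in> carrier K"
  shows "graded_ext G XY W q (graded_ext G X XY p u v) w =
    graded_ext G X W q' u (graded_ext G Y YZ p' v w)"
proof -
  interpret a: paired_sums G X M Y N XY MN p by (rule XY)
  interpret b: paired_sums G XY MN Z K W V q by (rule XY_Z)
  interpret c: paired_sums G Y N Z K YZ NK p' by (rule YZ)
  interpret d: paired_sums G X M YZ NK W V q' by (rule X_YZ)
  let ?F = "\<lambda>u v w. graded_ext G XY W q (graded_ext G X XY p u v) w"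
  let ?F' = "\<lambda>u v w. graded_ext G X W q' u (graded_ext G Y YZ p' v w)"
  show ?thesis
  proof (rule triadditive_eqI[of G X M Y N Z K "add_monoid V" ?F ?F'])
    show "external_sum G X M" "external_sum G Y N" "external_sum G Z K" by unfold_locales
    show "group (add_monoid V)" using b.Z.abelian_group_M by (rule abelian_group.a_group)
  next
    fix \<alpha> \<beta> \<gamma> a b c
    assume "\<alpha> \<in> carrier G" "\<beta> \<in> carrier G" "\<gamma> \<in> carrier G" "a \<in> carrier (X \<alpha>)"
      "b \<in> carrier (Y \<beta>)" "c \<in> carrier (Z \<gamma>)"
    then show "?F (homogeneous G X \<alpha> a) (homogeneous G Y \<beta> b) (homogeneous G Z \<gamma> c) =
      ?F' (homogeneous G X \<alpha> a) (homogeneous G Y \<beta> b) (homogeneous G Z \<gamma> c)"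
      using assoc
      by (simp add: a.graded_ext_homogeneous_eq b.graded_ext_homogeneous_eq
          c.graded_ext_homogeneous_eq d.graded_ext_homogeneous_eq a.op_closed c.op_closed
          a.X.G.m_assoc graded_associative_def)
  qed (use uvw in \<open>auto intro!: homI simp: a.graded_ext_closed b.graded_ext_closed
      c.graded_ext_closed d.graded_ext_closed a.graded_ext_add_left a.graded_ext_add_right
      b.graded_ext_add_left b.graded_ext_add_right c.graded_ext_add_left c.graded_ext_add_right
      d.graded_ext_add_left d.graded_ext_add_right\<close>)
qed

lemma graded_ext_left_unit:
  assumes "paired_sums G X M Y N Y N p" and e: "e \<in> carrier (X \<one>\<^bsub>G\<^esub>)"
    and unit: "\<And>\<beta> b. \<lbrakk>\<beta> \<in> carrier G; b \<in> carrier (Y \<beta>)\<rbrakk> \<Longrightarrow> p \<one>\<^bsub>G\<^esub> \<beta> e b = b"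
    and v: "v \<in> carrier N"
  shows "graded_ext G X Y p (homogeneous G X \<one>\<^bsub>G\<^esub> e) v = v"
proof -
  interpret paired_sums G X M Y N Y N p by (rule assms)
  have h: "homogeneous G X \<one>\<^bsub>G\<^esub> e \<in> carrier M" using e by (simp add: X.homogeneous_closed)
  show ?thesis
  proof (rule Y.hom_eqI[where V = "add_monoid N" and k = "\<lambda>v. v", OF _ _ _ _ v])
    show "graded_ext G X Y p (homogeneous G X \<one>\<^bsub>G\<^esub> e) \<in> hom (add_monoid N) (add_monoid N)"
      using biadditive_hom(2)[OF graded_ext_biadditive h] .
    show "group (add_monoid N)" using Y.abelian_group_M by (rule abelian_group.a_group)
  qed (use e unit in \<open>auto intro!: homI simp: graded_ext_homogeneous_eq\<close>)
qed

lemma graded_ext_right_unit: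
  assumes "paired_sums G X M Y N X M p" and e: "e \<in> carrier (Y \<one>\<^bsub>G\<^esub>)"
    and unit: "\<And>\<alpha> a. \<lbrakk>\<alpha> \<in> carrier G; a \<in> carrier (X \<alpha>)\<rbrakk> \<Longrightarrow> p \<alpha> \<one>\<^bsub>G\<^esub> a e = a"
    and v: "v \<in> carrier M"
  shows "graded_ext G X X p v (homogeneous G Y \<one>\<^bsub>G\<^esub> e) = v"
proof -
  interpret paired_sums G X M Y N X M p by (rule assms)
  have h: "homogeneous G Y \<one>\<^bsub>G\<^esub> e \<in> carrier N" using e by (simp add: Y.homogeneous_closed)
  show ?thesis
  proof (rule X.hom_eqI[where V = "add_monoid M" and k = "\<lambda>v. v", OF _ _ _ _ v])
    show "(\<lambda>v. graded_ext G X X p v (homogeneous G Y \<one>\<^bsub>G\<^esub> e)) \<in> hom (add_monoid M) (add_monoid M)"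
      using biadditive_hom(1)[OF graded_ext_biadditive h] .
    show "group (add_monoid M)" using X.abelian_group_M by (rule abelian_group.a_group)
  qed (use e unit in \<open>auto intro!: homI simp: graded_ext_homogeneous_eq\<close>)
qed

lemma gr_ring_of_simps:
  "mult (gr_ring_of G X m u) = m" "one (gr_ring_of G X m u) = u"
  "rcomp (gr_ring_of G X m u) = (\<lambda>\<alpha>. homogeneous G X \<alpha> ` carrier (X \<alpha>))"
  by (simp_all add: gr_ring_of_def Let_def)

lemma gr_bimod_of_simps:
  "lsmult (gr_bimod_of G X l r) = l" "rsmult (gr_bimod_of G X l r) = r"
  "bcomp (gr_bimod_of G X l r) = (\<lambda>\<alpha>. homogeneous G X \<alpha> ` carrier (X \<alpha>))"
  by (simp_all add: gr_bimod_of_def Let_def)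

text \<open>The homogeneous data of a Morita context: eight products, written \<open>mS\<close>, \<open>mR\<close> for the rings, \<open>l\<close> and \<open>r\<close>
  for the left and right actions, and one law for each of the sixteen composable triples. The laws in
  \<open>assoc_S\<close> begin in the row of \<open>S\<close>, those in \<open>assoc_R\<close> in the row of \<open>R\<close>, in corresponding order:
  exchanging \<open>S\<close> with \<open>R\<close> and \<open>P\<close> with \<open>Q\<close> exchanges the two lists.\<close>

locale homogeneous_morita = G: group G
  for G :: "('g, 'w) monoid_scheme"
    and S :: "'g \<Rightarrow> ('s, 's1) ring_scheme" and R :: "'g \<Rightarrow> ('r, 'r1) ring_scheme"
    and P :: "'g \<Rightarrow> ('p, 'p1) ring_scheme" and Q :: "'g \<Rightarrow> ('q, 'q1) ring_scheme" +
  fixes mS :: "'g \<Rightarrow> 'g \<Rightarrow> 's \<Rightarrow> 's \<Rightarrow> 's" and mR :: "'g \<Rightarrow> 'g \<Rightarrow> 'r \<Rightarrow> 'r \<Rightarrow> 'r"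
    and lP :: "'g \<Rightarrow> 'g \<Rightarrow> 's \<Rightarrow> 'p \<Rightarrow> 'p" and rP :: "'g \<Rightarrow> 'g \<Rightarrow> 'p \<Rightarrow> 'r \<Rightarrow> 'p"
    and lQ :: "'g \<Rightarrow> 'g \<Rightarrow> 'r \<Rightarrow> 'q \<Rightarrow> 'q" and rQ :: "'g \<Rightarrow> 'g \<Rightarrow> 'q \<Rightarrow> 's \<Rightarrow> 'q"
    and \<phi> :: "'g \<Rightarrow> 'g \<Rightarrow> 'p \<Rightarrow> 'q \<Rightarrow> 's" and \<psi> :: "'g \<Rightarrow> 'g \<Rightarrow> 'q \<Rightarrow> 'p \<Rightarrow> 'r"
    and uS :: 's and uR :: 'r
  assumes abelian: "\<alpha> \<in> carrier G \<Longrightarrow> abelian_group (S \<alpha>)" "\<alpha> \<in> carrier G \<Longrightarrow> abelian_group (R \<alpha>)"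
      "\<alpha> \<in> carrier G \<Longrightarrow> abelian_group (P \<alpha>)" "\<alpha> \<in> carrier G \<Longrightarrow> abelian_group (Q \<alpha>)"
    and pairings: "graded_pairing G S S S mS" "graded_pairing G R R R mR"
      "graded_pairing G S P P lP" "graded_pairing G P R P rP"
      "graded_pairing G R Q Q lQ" "graded_pairing G Q S Q rQ"
      "graded_pairing G P Q S \<phi>" "graded_pairing G Q P R \<psi>"
    and assoc_S: "graded_associative G S S S mS mS mS mS"
      "graded_associative G S S P mS lP lP lP" "graded_associative G S P R lP rP rP lP"
      "graded_associative G P R R rP rP mR rP" "graded_associative G S P Q lP \<phi> \<phi> mS"
      "graded_associative G P R Q rP \<phi> lQ \<phi>" "graded_associative G P Q S \<phi> mS rQ \<phi>"
      "graded_associative G P Q P \<phi> lP \<psi> rP"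
    and assoc_R: "graded_associative G R R R mR mR mR mR"
      "graded_associative G R R Q mR lQ lQ lQ" "graded_associative G R Q S lQ rQ rQ lQ"
      "graded_associative G Q S S rQ rQ mS rQ" "graded_associative G R Q P lQ \<psi> \<psi> mR"
      "graded_associative G Q S P rQ \<psi> lP \<psi>" "graded_associative G Q P R \<psi> mR rP \<psi>"
      "graded_associative G Q P Q \<psi> lQ \<phi> rQ"
    and units_closed: "uS \<in> carrier (S \<one>\<^bsub>G\<^esub>)" "uR \<in> carrier (R \<one>\<^bsub>G\<^esub>)"
    and unit_S: "\<lbrakk>\<alpha> \<in> carrier G; s \<in> carrier (S \<alpha>)\<rbrakk> \<Longrightarrow> mS \<one>\<^bsub>G\<^esub> \<alpha> uS s = s"
      "\<lbrakk>\<alpha> \<in> carrier G; s \<in> carrier (S \<alpha>)\<rbrakk> \<Longrightarrow> mS \<alpha> \<one>\<^bsub>G\<^esub> s uS = s"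
      "\<lbrakk>\<alpha> \<in> carrier G; p \<in> carrier (P \<alpha>)\<rbrakk> \<Longrightarrow> lP \<one>\<^bsub>G\<^esub> \<alpha> uS p = p"
      "\<lbrakk>\<alpha> \<in> carrier G; p \<in> carrier (P \<alpha>)\<rbrakk> \<Longrightarrow> rP \<alpha> \<one>\<^bsub>G\<^esub> p uR = p"
    and unit_R: "\<lbrakk>\<alpha> \<in> carrier G; r \<in> carrier (R \<alpha>)\<rbrakk> \<Longrightarrow> mR \<one>\<^bsub>G\<^esub> \<alpha> uR r = r"
      "\<lbrakk>\<alpha> \<in> carrier G; r \<in> carrier (R \<alpha>)\<rbrakk> \<Longrightarrow> mR \<alpha> \<one>\<^bsub>G\<^esub> r uR = r"
      "\<lbrakk>\<alpha> \<in> carrier G; q \<in> carrier (Q \<alpha>)\<rbrakk> \<Longrightarrow> lQ \<one>\<^bsub>G\<^esub> \<alpha> uR q = q"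
      "\<lbrakk>\<alpha> \<in> carrier G; q \<in> carrier (Q \<alpha>)\<rbrakk> \<Longrightarrow> rQ \<alpha> \<one>\<^bsub>G\<^esub> q uS = q"
begin

definition "SS = gr_ring_of G S (graded_ext G S S mS) (homogeneous G S \<one>\<^bsub>G\<^esub> uS)"
definition "RR = gr_ring_of G R (graded_ext G R R mR) (homogeneous G R \<one>\<^bsub>G\<^esub> uR)"
definition "PP = gr_bimod_of G P (graded_ext G S P lP) (graded_ext G P P rP)"
definition "QQ = gr_bimod_of G Q (graded_ext G R Q lQ) (graded_ext G Q Q rQ)"
definition "phi = tensor_lift RR PP QQ (add_monoid SS) (graded_ext G P S \<phi>)"
definition "psi = tensor_lift SS QQ PP (add_monoid RR) (graded_ext G Q R \<psi>)"

text \<open>By this symmetry, what is shown below for \<open>S\<close>, \<open>P\<close> and \<open>\<phi>\<close> also holds for \<open>R\<close>, \<open>Q\<close> and \<open>\<psi>\<close>.\<close>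

lemma swap: "homogeneous_morita G R S Q P mR mS lQ rQ lP rP \<psi> \<phi> uR uS"
  by (intro homogeneous_morita.intro homogeneous_morita_axioms.intro G.group_axioms
      abelian pairings assoc_S assoc_R units_closed unit_S unit_R)

lemma sums: "external_sum G S SS" "external_sum G R RR" "external_sum G P PP" "external_sum G Q QQ"
  unfolding SS_def RR_def PP_def QQ_def
  by (intro external_sum_gr_ring_of external_sum_gr_bimod_of G.group_axioms abelian; assumption)+

lemma SS_simps: "mult SS = graded_ext G S S mS" "one SS = homogeneous G S \<one>\<^bsub>G\<^esub> uS"
    "rcomp SS = (\<lambda>\<alpha>. homogeneous G S \<alpha> ` carrier (S \<alpha>))"
  and RR_simps: "mult RR = graded_ext G R R mR" "one RR = homogeneous G R \<one>\<^bsub>G\<^esub> uR"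
    "rcomp RR = (\<lambda>\<alpha>. homogeneous G R \<alpha> ` carrier (R \<alpha>))"
  and PP_simps: "lsmult PP = graded_ext G S P lP" "rsmult PP = graded_ext G P P rP"
    "bcomp PP = (\<lambda>\<alpha>. homogeneous G P \<alpha> ` carrier (P \<alpha>))"
  and QQ_simps: "lsmult QQ = graded_ext G R Q lQ" "rsmult QQ = graded_ext G Q Q rQ"
    "bcomp QQ = (\<lambda>\<alpha>. homogeneous G Q \<alpha> ` carrier (Q \<alpha>))"
  by (simp_all add: SS_def RR_def PP_def QQ_def gr_ring_of_simps gr_bimod_of_simps)

lemma paired:
  "paired_sums G S SS S SS S SS mS" "paired_sums G R RR R RR R RR mR"
  "paired_sums G S SS P PP P PP lP" "paired_sums G P PP R RR P PP rP"
  "paired_sums G R RR Q QQ Q QQ lQ" "paired_sums G Q QQ S SS Q QQ rQ"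
  "paired_sums G P PP Q QQ S SS \<phi>" "paired_sums G Q QQ P PP R RR \<psi>"
  using sums pairings by (simp_all add: paired_sums_def paired_sums_axioms_def)

lemmas closed = paired[THEN paired_sums.graded_ext_closed]
lemmas additive_left = paired[THEN paired_sums.graded_ext_add_left]
lemmas additive_right = paired[THEN paired_sums.graded_ext_add_right]
lemmas homogeneous_eq = paired[THEN paired_sums.graded_ext_homogeneous_eq]
lemmas op_closed = paired[THEN paired_sums.op_closed]

lemmas ext_assoc =
  graded_ext_associative[OF paired(1) paired(1) paired(1) paired(1) assoc_S(1)]
  graded_ext_associative[OF paired(1) paired(3) paired(3) paired(3) assoc_S(2)]
  graded_ext_associative[OF paired(3) paired(4) paired(4) paired(3) assoc_S(3)]
  graded_ext_associative[OF paired(4) paired(4) paired(2) paired(4) assoc_S(4)]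
  graded_ext_associative[OF paired(3) paired(7) paired(7) paired(1) assoc_S(5)]
  graded_ext_associative[OF paired(4) paired(7) paired(5) paired(7) assoc_S(6)]
  graded_ext_associative[OF paired(7) paired(1) paired(6) paired(7) assoc_S(7)]
  graded_ext_associative[OF paired(7) paired(3) paired(8) paired(4) assoc_S(8)]

lemma ext_unit:
  "u \<in> carrier SS \<Longrightarrow> graded_ext G S S mS (homogeneous G S \<one>\<^bsub>G\<^esub> uS) u = u"
  "u \<in> carrier SS \<Longrightarrow> graded_ext G S S mS u (homogeneous G S \<one>\<^bsub>G\<^esub> uS) = u"
  "p \<in> carrier PP \<Longrightarrow> graded_ext G S P lP (homogeneous G S \<one>\<^bsub>G\<^esub> uS) p = p"
  "p \<in> carrier PP \<Longrightarrow> graded_ext G P P rP p (homogeneous G R \<one>\<^bsub>G\<^esub> uR) = p"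
  by - (rule graded_ext_left_unit[OF paired(1) units_closed(1)]
        graded_ext_right_unit[OF paired(1) units_closed(1)]
        graded_ext_left_unit[OF paired(3) units_closed(1)]
        graded_ext_right_unit[OF paired(4) units_closed(2)];
      simp add: unit_S)+

lemma graded_ring_SS: "graded_ring G SS"
proof -
  interpret S: external_sum G S SS by (rule sums)
  interpret SS: abelian_group SS by (rule S.abelian_group_M)
  have "monoid SS"
    using units_closed
    by unfold_locales
      (simp_all add: SS_simps closed ext_assoc ext_unit S.homogeneous_closed)
  then have "ring SS"
    using SS.abelian_group_axioms additive_left(1) additive_right(1)
    by (simp add: ring_def ring_axioms_def SS_simps)
  moreover have "internal_direct_sum G SS (rcomp SS)"
    unfolding SS_simps by (rule S.internal_direct_sum)
  ultimately show ?thesis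
    unfolding graded_ring_def graded_ring_axioms_def
    by (auto simp: SS_simps homogeneous_eq op_closed G.group_axioms)
qed

lemma graded_ring_RR: "graded_ring G RR"
proof -
  interpret swap: homogeneous_morita G R S Q P mR mS lQ rQ lP rP \<psi> \<phi> uR uS by (rule swap)
  show ?thesis using swap.graded_ring_SS by (simp add: swap.SS_def RR_def)
qed

lemma graded_bimodule_PP: "graded_bimodule G SS RR PP"
proof -
  interpret P: external_sum G P PP by (rule sums)
  have "bimodule_axioms SS RR PP"
    by (unfold_locales)
      (simp_all add: SS_simps RR_simps PP_simps closed additive_left additive_right ext_assoc ext_unit)
  then have "bimodule SS RR PP"
    using graded_ring_SS graded_ring_RR P.abelian_group_M
    by (simp add: bimodule_def graded_ring_def)
  moreover have "internal_direct_sum G PP (bcomp PP)"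
    unfolding PP_simps by (rule P.internal_direct_sum)
  ultimately show ?thesis
    using graded_ring_SS graded_ring_RR
    unfolding graded_bimodule_def graded_bimodule_axioms_def
    by (auto simp: PP_simps SS_simps RR_simps homogeneous_eq op_closed)
qed

lemma graded_bimodule_QQ: "graded_bimodule G RR SS QQ"
proof -
  interpret swap: homogeneous_morita G R S Q P mR mS lQ rQ lP rP \<psi> \<phi> uR uS by (rule swap)
  show ?thesis
    using swap.graded_bimodule_PP by (simp add: swap.SS_def swap.RR_def swap.PP_def SS_def RR_def QQ_def)
qed

lemma tensor_factors_PQ: "tensor_factors RR PP QQ"
  using sums closed
  by (simp add: tensor_factors_def tensor_factors_axioms_def external_sum.abelian_group_M
      PP_simps QQ_simps)

lemma phi_balanced: "balanced RR PP QQ (add_monoid SS) (graded_ext G P S \<phi>)"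
  using paired_sums.graded_ext_biadditive[OF paired(7)]
  by (rule balancedI) (simp add: PP_simps QQ_simps ext_assoc)

lemma comm_group_SS: "comm_group (add_monoid SS)"
  using external_sum.abelian_group_M[OF sums(1)] by (rule abelian_group.a_comm_group)

lemmas phi_hom = tensor_factors.tensor_lift_hom[OF tensor_factors_PQ comm_group_SS phi_balanced,
    folded phi_def]
  and phi_pure = tensor_factors.tensor_lift_pure[OF tensor_factors_PQ comm_group_SS phi_balanced,
    folded phi_def]

lemma tensor_bimodules_PQ: "tensor_bimodules SS RR SS PP QQ"
  using graded_bimodule_PP graded_bimodule_QQ
  by (simp add: tensor_bimodules_def graded_bimodule_def)

lemma phi_lsmult:
  assumes s: "s \<in> carrier SS" and t: "t \<in> carrier (tensor_group RR PP QQ)"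
  shows "phi (s \<triangleright>\<^bsub>tensor RR PP QQ\<^esub> t) = s \<otimes>\<^bsub>SS\<^esub> phi t"
proof -
  interpret T: tensor_bimodules SS RR SS PP QQ by (rule tensor_bimodules_PQ)
  let ?T = "tensor_group RR PP QQ"
  show ?thesis
  proof (rule T.tensor_hom_eqI[where V = "add_monoid SS", OF _ _ _ _ t])
    show "(\<lambda>t. phi (s \<triangleright>\<^bsub>tensor RR PP QQ\<^esub> t)) \<in> hom ?T (add_monoid SS)"
      using Group.hom_compose[OF T.tensor_lsmult(1)[OF s] phi_hom] by (simp add: comp_def)
    show "(\<lambda>t. s \<otimes>\<^bsub>SS\<^esub> phi t) \<in> hom ?T (add_monoid SS)"
      using s hom_in_carrier[OF phi_hom] hom_mult[OF phi_hom]
      by (auto intro!: homI simp: closed additive_right SS_simps)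
    show "group (add_monoid SS)" using comm_group_SS by (rule comm_group.axioms)
  next
    fix p q assume pq: "p \<in> carrier PP" "q \<in> carrier QQ"
    show "phi (s \<triangleright>\<^bsub>tensor RR PP QQ\<^esub> pure_tensor RR PP QQ p q) = s \<otimes>\<^bsub>SS\<^esub> phi (pure_tensor RR PP QQ p q)"
      unfolding T.tensor_lsmult(2)[OF s pq]
      using s pq by (simp add: phi_pure PP_simps SS_simps closed ext_assoc)
  qed
qed

lemma phi_rsmult:
  assumes s: "s \<in> carrier SS" and t: "t \<in> carrier (tensor_group RR PP QQ)"
  shows "phi (t \<triangleleft>\<^bsub>tensor RR PP QQ\<^esub> s) = phi t \<otimes>\<^bsub>SS\<^esub> s"
proof -
  interpret T: tensor_bimodules SS RR SS PP QQ by (rule tensor_bimodules_PQ)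
  let ?T = "tensor_group RR PP QQ"
  show ?thesis
  proof (rule T.tensor_hom_eqI[where V = "add_monoid SS", OF _ _ _ _ t])
    show "(\<lambda>t. phi (t \<triangleleft>\<^bsub>tensor RR PP QQ\<^esub> s)) \<in> hom ?T (add_monoid SS)"
      using Group.hom_compose[OF T.tensor_rsmult(1)[OF s] phi_hom] by (simp add: comp_def)
    show "(\<lambda>t. phi t \<otimes>\<^bsub>SS\<^esub> s) \<in> hom ?T (add_monoid SS)"
      using s hom_in_carrier[OF phi_hom] hom_mult[OF phi_hom]
      by (auto intro!: homI simp: closed additive_left SS_simps)
    show "group (add_monoid SS)" using comm_group_SS by (rule comm_group.axioms)
  next
    fix p q assume pq: "p \<in> carrier PP" "q \<in> carrier QQ"
    show "phi (pure_tensor RR PP QQ p q \<triangleleft>\<^bsub>tensor RR PP QQ\<^esub> s) = phi (pure_tensor RR PP QQ p q) \<otimes>\<^bsub>SS\<^esub> s"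
      unfolding T.tensor_rsmult(2)[OF s pq]
      using s pq by (simp add: phi_pure QQ_simps SS_simps closed ext_assoc)
  qed
qed

lemma phi_gr_bimod_hom: "phi \<in> gr_bimod_hom G SS SS (gr_tensor G RR PP QQ) (gr_regular SS)"
proof -
  interpret T: tensor_factors RR PP QQ by (rule tensor_factors_PQ)
  interpret S: external_sum G S SS by (rule sums)
  interpret P: external_sum G P PP by (rule sums)
  interpret Q: external_sum G Q QQ by (rule sums)
  interpret phi: group_hom "tensor_group RR PP QQ" "add_monoid SS" phi
    using phi_hom T.tensor_group comm_group.axioms(2)[OF comm_group_SS]
    by (simp add: group_hom_def group_hom_axioms_def)
  have "phi \<in> hom (add_monoid (gr_tensor G RR PP QQ)) (add_monoid (gr_regular SS))"
    using phi_hom by (simp add: hom_def gr_tensor_def gr_regular_def tensor_def Let_def)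
  then have "phi \<in> bimod_hom SS SS (gr_tensor G RR PP QQ) (gr_regular SS)"
    using phi_lsmult phi_rsmult
    by (simp add: bimod_hom_def gr_tensor_def gr_regular_def tensor_def Let_def)
  moreover have "phi ` bcomp (gr_tensor G RR PP QQ) \<gamma> \<subseteq> bcomp (gr_regular SS) \<gamma>"
    if \<gamma>: "\<gamma> \<in> carrier G" for \<gamma>
  proof -
    let ?K = "{pure_tensor RR PP QQ p q | \<alpha> \<beta> p q.
        \<alpha> \<in> carrier G \<and> \<beta> \<in> carrier G \<and> \<alpha> \<otimes>\<^bsub>G\<^esub> \<beta> = \<gamma> \<and> p \<in> bcomp PP \<alpha> \<and> q \<in> bcomp QQ \<beta>}"
    \<comment> \<open>The elements mapped into degree \<open>\<gamma>\<close> form a subgroup, so generators suffice.\<close>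
    have "phi ` generate (tensor_group RR PP QQ) ?K \<subseteq> rcomp SS \<gamma>"
    proof (rule subgroup_contains_image[OF phi.group_hom_axioms])
      show "?K \<subseteq> carrier (tensor_group RR PP QQ)"
        by (auto simp: PP_simps QQ_simps intro!: T.pure_tensor_closed P.homogeneous_closed
            Q.homogeneous_closed)
      show "subgroup (rcomp SS \<gamma>) (add_monoid SS)"
        unfolding SS_simps using \<gamma> by (rule S.subgroup_component)
      show "phi ` ?K \<subseteq> rcomp SS \<gamma>"
        by (auto simp: PP_simps QQ_simps SS_simps phi_pure P.homogeneous_closed
            Q.homogeneous_closed homogeneous_eq op_closed)
    qed
    then show ?thesis by (simp add: gr_tensor_def gr_regular_def Let_def)
  qed
  ultimately show ?thesis by (simp add: gr_bimod_hom_def)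
qed

lemma phi_associative:
  assumes "p \<in> carrier PP" "q \<in> carrier QQ" "p' \<in> carrier PP"
  shows "phi (pure_tensor RR PP QQ p q) \<triangleright>\<^bsub>PP\<^esub> p' = p \<triangleleft>\<^bsub>PP\<^esub> psi (pure_tensor SS QQ PP q p')"
proof -
  interpret swap: homogeneous_morita G R S Q P mR mS lQ rQ lP rP \<psi> \<phi> uR uS by (rule swap)
  have eqs: "swap.PP = QQ" "swap.RR = SS" "swap.SS = RR" "swap.QQ = PP" "swap.phi = psi"
    by (simp_all add: swap.PP_def swap.RR_def swap.SS_def swap.QQ_def QQ_def SS_def RR_def PP_def
        swap.phi_def psi_def)
  show ?thesis
    using assms swap.phi_pure[unfolded eqs] by (simp add: phi_pure PP_simps ext_assoc)
qed

lemma phi_homogeneous: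
  assumes "\<alpha> \<in> carrier G" "\<beta> \<in> carrier G" "p \<in> carrier (P \<alpha>)" "q \<in> carrier (Q \<beta>)"
  shows "phi (pure_tensor RR PP QQ (homogeneous G P \<alpha> p) (homogeneous G Q \<beta> q)) =
    homogeneous G S (\<alpha> \<otimes>\<^bsub>G\<^esub> \<beta>) (\<phi> \<alpha> \<beta> p q)"
  using assms sums[THEN external_sum.homogeneous_closed] by (simp add: phi_pure homogeneous_eq)

lemma psi_homogeneous:
  assumes "\<alpha> \<in> carrier G" "\<beta> \<in> carrier G" "q \<in> carrier (Q \<alpha>)" "p \<in> carrier (P \<beta>)"
  shows "psi (pure_tensor SS QQ PP (homogeneous G Q \<alpha> q) (homogeneous G P \<beta> p)) =
    homogeneous G R (\<alpha> \<otimes>\<^bsub>G\<^esub> \<beta>) (\<psi> \<alpha> \<beta> q p)"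
proof -
  interpret swap: homogeneous_morita G R S Q P mR mS lQ rQ lP rP \<psi> \<phi> uR uS by (rule swap)
  have eqs: "swap.PP = QQ" "swap.RR = SS" "swap.QQ = PP" "swap.phi = psi"
    by (simp_all add: swap.PP_def swap.RR_def swap.SS_def swap.QQ_def QQ_def SS_def RR_def PP_def
        swap.phi_def psi_def)
  show ?thesis using swap.phi_homogeneous[unfolded eqs, OF assms] .
qed

theorem graded_morita_context:
  "graded_morita_context G
    \<lparr>ctx_S = SS, ctx_R = RR, ctx_P = PP, ctx_Q = QQ, ctx_phi = phi, ctx_psi = psi\<rparr>"
proof -
  interpret swap: homogeneous_morita G R S Q P mR mS lQ rQ lP rP \<psi> \<phi> uR uS by (rule swap)
  have eqs: "swap.PP = QQ" "swap.RR = SS" "swap.SS = RR" "swap.QQ = PP" "swap.phi = psi"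
      "swap.psi = phi"
    by (simp_all add: swap.PP_def swap.RR_def swap.SS_def swap.QQ_def QQ_def SS_def RR_def PP_def
        swap.phi_def psi_def swap.psi_def phi_def)
  show ?thesis
    unfolding graded_morita_context_def Let_def
    using graded_ring_SS graded_ring_RR graded_bimodule_PP graded_bimodule_QQ phi_gr_bimod_hom
      swap.phi_gr_bimod_hom[unfolded eqs] phi_associative swap.phi_associative[unfolded eqs]
    by simp
qed

end

section \<open>Linear forms on bimodules\<close>

lemma regular_bimod_simps [simp]:
  "carrier (regular_bimod A) = carrier A" "add (regular_bimod A) = add A"
  "zero (regular_bimod A) = zero A" "lsmult (regular_bimod A) = mult A" "rsmult (regular_bimod A) = mult A"
  by (simp_all add: regular_bimod_def)

lemma bimodule_regular:
  assumes "ring A"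
  shows "bimodule A A (regular_bimod A)"
proof -
  interpret A: ring A by (rule assms)
  have "abelian_group (regular_bimod A)"
    by (rule abelian_groupI) (simp_all add: A.a_ac A.add.l_inv_ex)
  moreover have "bimodule_axioms A A (regular_bimod A)"
    by unfold_locales (simp_all add: A.l_distr A.r_distr A.m_assoc)
  ultimately show ?thesis using assms by (simp add: bimodule_def)
qed

lemma left_hom_regular:
  "f \<in> left_hom A M (regular_bimod A) \<longleftrightarrow> left_form A M f \<and> f \<in> extensional (carrier M)"
  by (auto simp: left_hom_def left_form_def hom_def)

text \<open>A projective module embeds into a free module, and the coordinates of the embedding are linear
  forms.\<close>

lemma left_projective_separates:
  fixes M :: "('a, 'd, 'm, 'y) bimod_scheme"
  assumes A: "ring A" and M: "bimodule A D M" and proj: "left_projective A M"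
    and mn: "m \<in> carrier M" "n \<in> carrier M"
    and eq: "\<And>f. f \<in> left_hom A M (regular_bimod A) \<Longrightarrow> f m = f n"
  shows "m = n"
proof -
  interpret A: ring A by (rule A)
  interpret M: bimodule A D M by (rule M)
  obtain I :: "'m set" and i p where i: "i \<in> left_hom A M (free_bimod A I)"
    and p: "\<And>m. m \<in> carrier M \<Longrightarrow> p (i m) = m"
    using proj unfolding left_projective_def by blast
  have carrier_F: "carrier (free_bimod A I) \<subseteq> (\<Pi>\<^sub>E j\<in>I. carrier A)"
    by (auto simp: free_bimod_def Let_def carrier_sum_group A.a_group)
  have i_mem: "i m \<in> (\<Pi>\<^sub>E j\<in>I. carrier A)" if "m \<in> carrier M" for m
    using i that carrier_F by (auto simp: left_hom_def hom_def)
  have i_add: "i (m \<oplus>\<^bsub>M\<^esub> m') = (\<lambda>j\<in>I. i m j \<oplus>\<^bsub>A\<^esub> i m' j)"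
    if "m \<in> carrier M" "m' \<in> carrier M" for m m'
    using i that by (simp add: left_hom_def hom_def free_bimod_def Let_def)
  have i_lsmult: "i (a \<triangleright>\<^bsub>M\<^esub> m) = (\<lambda>j\<in>I. a \<otimes>\<^bsub>A\<^esub> i m j)"
    if "a \<in> carrier A" "m \<in> carrier M" for a m
    using i that by (simp add: left_hom_def free_bimod_def Let_def)
  have "i m j = i n j" if j: "j \<in> I" for j
  proof -
    have val: "i m j \<in> carrier A" if "m \<in> carrier M" for m using i_mem[OF that] j by auto
    have "left_form A M (\<lambda>m\<in>carrier M. i m j)"
      by (rule left_formI) (use j in \<open>simp_all add: val i_add i_lsmult M.lsmult_closed\<close>)
    then have "(\<lambda>m\<in>carrier M. i m j) \<in> left_hom A M (regular_bimod A)"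
      by (simp add: left_hom_regular)
    from eq[OF this] show ?thesis using mn by simp
  qed
  then have "i m = i n" by (rule PiE_ext[OF i_mem[OF mn(1)] i_mem[OF mn(2)]])
  then show ?thesis using p mn by metis
qed

text \<open>The ring itself, with the identity as a form, turns the right unit isomorphism into a contraction, so
  that the naturality lemmas apply to the counit laws.\<close>

lemma tensor_runit_eq: "tensor_runit A M = contract_right A M (regular_bimod A) (\<lambda>a. a)"
  by (simp add: tensor_runit_def contract_right_def)

lemma form_tensor_lunit:
  assumes "ring A" and N: "bimodule A A N" and f: "left_form A N f"
    and t: "t \<in> carrier (tensor_group A (regular_bimod A) N)"
  shows "f (tensor_lunit A N t) = contract_right A (regular_bimod A) N f t"
proof -
  interpret A: ring A by (rule assms)
  interpret T: tensor_bimodules A A A "regular_bimod A" N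
    by (rule tensor_bimodules.intro[OF bimodule_regular[OF assms(1)] N])
  note D = left_formD[OF f]
  have bal: "balanced A (regular_bimod A) N (add_monoid N) (\<lambda>a n. a \<triangleright>\<^bsub>N\<^esub> n)"
    by (intro balancedI biadditiveI)
      (simp_all add: T.N.lsmult_closed T.N.lsmult_l_distr T.N.lsmult_r_distr T.N.lsmult_assoc)
  note props = T.tensor_lift_props[OF T.N.M.a_comm_group bal, folded tensor_lunit_def]
  have lunit: "tensor_lunit A N \<in> hom (tensor_group A (regular_bimod A) N) (add_monoid N)"
    using props by blast
  have fh: "f \<in> hom (add_monoid N) (add_monoid (regular_bimod A))"
    using f by (simp add: left_form_def hom_def)
  show ?thesis
  proof (rule T.contract_right_eqI[OF f _ _ t, symmetric])
    show "(\<lambda>t. f (tensor_lunit A N t)) \<in>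
        hom (tensor_group A (regular_bimod A) N) (add_monoid (regular_bimod A))"
      using Group.hom_compose[OF lunit fh] by (simp add: comp_def)
    show "f (tensor_lunit A N (pure_tensor A (regular_bimod A) N a n)) = a \<triangleleft>\<^bsub>regular_bimod A\<^esub> f n"
      if "a \<in> carrier (regular_bimod A)" "n \<in> carrier N" for a n
      using that props by (simp add: D)
  qed
qed

lemma tensor_lift_form_contract:
  assumes "tensor_bimodules A A A M N" and f: "left_form A N f" and g: "left_form A M g"
    and t: "t \<in> carrier (tensor_group A M N)"
  shows "tensor_lift A M N (add_monoid A) (\<lambda>m n. g (m \<triangleleft>\<^bsub>M\<^esub> f n)) t = g (contract_right A M N f t)"
proof -
  interpret T: tensor_bimodules A A A M N by (rule assms)
  note Df = left_formD[OF f] and Dg = left_formD[OF g]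
  have bal: "balanced A M N (add_monoid A) (\<lambda>m n. g (m \<triangleleft>\<^bsub>M\<^esub> f n))"
    by (intro balancedI biadditiveI)
      (simp_all add: Df Dg T.M.rsmult_closed T.M.rsmult_l_distr T.M.rsmult_r_distr T.M.rsmult_assoc)
  have gh: "g \<in> hom (add_monoid M) (add_monoid A)" using g by (simp add: left_form_def)
  show ?thesis
  proof (rule T.tensor_lift_unique[OF T.M.A.a_comm_group _ bal _ t])
    show "(\<lambda>t. g (contract_right A M N f t)) \<in> hom (tensor_group A M N) (add_monoid A)"
      using Group.hom_compose[OF T.contract_right(1)[OF f] gh] by (simp add: comp_def)
  qed (simp add: T.contract_right(2)[OF f])
qed

section \<open>Comultiplication and counit through linear forms\<close>

context group_coring
begin

lemma bimodules:
  "\<lbrakk>\<alpha> \<in> carrier G; \<beta> \<in> carrier G\<rbrakk> \<Longrightarrow> tensor_bimodules A A A (C \<alpha>) (C \<beta>)"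
  by (rule tensor_bimodules.intro[OF bimodule_C bimodule_C])

lemma Delta_closed:
  "\<lbrakk>\<alpha> \<in> carrier G; \<beta> \<in> carrier G; c \<in> carrier (C (\<alpha> \<otimes> \<beta>))\<rbrakk> \<Longrightarrow>
    \<Delta> \<alpha> \<beta> c \<in> carrier (tensor_group A (C \<alpha>) (C \<beta>))"
  using Delta_hom[of \<alpha> \<beta>] hom_in_carrier[of "\<Delta> \<alpha> \<beta>"] by (fastforce simp: bimod_hom_def)

lemma Delta_add:
  "\<lbrakk>\<alpha> \<in> carrier G; \<beta> \<in> carrier G; c \<in> carrier (C (\<alpha> \<otimes> \<beta>)); c' \<in> carrier (C (\<alpha> \<otimes> \<beta>))\<rbrakk> \<Longrightarrow>
    \<Delta> \<alpha> \<beta> (c \<oplus>\<^bsub>C (\<alpha> \<otimes> \<beta>)\<^esub> c') = \<Delta> \<alpha> \<beta> c \<otimes>\<^bsub>tensor_group A (C \<alpha>) (C \<beta>)\<^esub> \<Delta> \<alpha> \<beta> c'"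
  using Delta_hom[of \<alpha> \<beta>] hom_mult[of "\<Delta> \<alpha> \<beta>"] by (fastforce simp: bimod_hom_def)

lemma Delta_lsmult:
  "\<lbrakk>\<alpha> \<in> carrier G; \<beta> \<in> carrier G; c \<in> carrier (C (\<alpha> \<otimes> \<beta>)); a \<in> carrier A\<rbrakk> \<Longrightarrow>
    \<Delta> \<alpha> \<beta> (a \<triangleright>\<^bsub>C (\<alpha> \<otimes> \<beta>)\<^esub> c) = a \<triangleright>\<^bsub>tensor A (C \<alpha>) (C \<beta>)\<^esub> \<Delta> \<alpha> \<beta> c"
  using Delta_hom[of \<alpha> \<beta>] by (simp add: bimod_hom_def)

lemma Delta_rsmult:
  "\<lbrakk>\<alpha> \<in> carrier G; \<beta> \<in> carrier G; c \<in> carrier (C (\<alpha> \<otimes> \<beta>)); a \<in> carrier A\<rbrakk> \<Longrightarrow>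
    \<Delta> \<alpha> \<beta> (c \<triangleleft>\<^bsub>C (\<alpha> \<otimes> \<beta>)\<^esub> a) = \<Delta> \<alpha> \<beta> c \<triangleleft>\<^bsub>tensor A (C \<alpha>) (C \<beta>)\<^esub> a"
  using Delta_hom[of \<alpha> \<beta>] by (simp add: bimod_hom_def)

lemma eps_form: "left_form A (C \<one>) \<epsilon>"
  using eps_hom by (simp add: left_form_def bimod_hom_def hom_def)

lemma eps_rsmult:
  "\<lbrakk>c \<in> carrier (C \<one>); a \<in> carrier A\<rbrakk> \<Longrightarrow> \<epsilon> (c \<triangleleft>\<^bsub>C \<one>\<^esub> a) = \<epsilon> c \<otimes>\<^bsub>A\<^esub> a"
  using eps_hom by (simp add: bimod_hom_def)

text \<open>The map \<open>c \<mapsto> c\<^sub>1 f(c\<^sub>2)\<close> from \<open>C\<^sub>\<alpha>\<^sub>\<beta>\<close> to \<open>C\<^sub>\<alpha>\<close>. Everything about the comultiplication that is used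
  later is expressed by it.\<close>

definition slice :: "'g \<Rightarrow> 'g \<Rightarrow> ('c \<Rightarrow> 'a) \<Rightarrow> 'c \<Rightarrow> 'c" where
  "slice \<alpha> \<beta> f c = contract_right A (C \<alpha>) (C \<beta>) f (\<Delta> \<alpha> \<beta> c)"

context
  fixes \<alpha> \<beta> assumes deg: "\<alpha> \<in> carrier G" "\<beta> \<in> carrier G"
begin

interpretation T: tensor_bimodules A A A "C \<alpha>" "C \<beta>"
  using deg by (rule bimodules)

lemma slice_closed:
  "\<lbrakk>left_form A (C \<beta>) f; c \<in> carrier (C (\<alpha> \<otimes> \<beta>))\<rbrakk> \<Longrightarrow> slice \<alpha> \<beta> f c \<in> carrier (C \<alpha>)"
  using deg by (simp add: slice_def T.contract_right_closed Delta_closed)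

lemma slice_add:
  "\<lbrakk>left_form A (C \<beta>) f; c \<in> carrier (C (\<alpha> \<otimes> \<beta>)); c' \<in> carrier (C (\<alpha> \<otimes> \<beta>))\<rbrakk> \<Longrightarrow>
    slice \<alpha> \<beta> f (c \<oplus>\<^bsub>C (\<alpha> \<otimes> \<beta>)\<^esub> c') = slice \<alpha> \<beta> f c \<oplus>\<^bsub>C \<alpha>\<^esub> slice \<alpha> \<beta> f c'"
  using deg by (simp add: slice_def T.contract_right_add Delta_closed Delta_add)

lemma slice_lsmult:
  "\<lbrakk>left_form A (C \<beta>) f; c \<in> carrier (C (\<alpha> \<otimes> \<beta>)); a \<in> carrier A\<rbrakk> \<Longrightarrow>
    slice \<alpha> \<beta> f (a \<triangleright>\<^bsub>C (\<alpha> \<otimes> \<beta>)\<^esub> c) = a \<triangleright>\<^bsub>C \<alpha>\<^esub> slice \<alpha> \<beta> f c"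
  using deg by (simp add: slice_def T.contract_right_lsmult Delta_closed Delta_lsmult)

lemma slice_cong:
  "\<lbrakk>left_form A (C \<beta>) f; c \<in> carrier (C (\<alpha> \<otimes> \<beta>)); \<And>c'. c' \<in> carrier (C \<beta>) \<Longrightarrow> g c' = f c'\<rbrakk> \<Longrightarrow>
    slice \<alpha> \<beta> g c = slice \<alpha> \<beta> f c"
  unfolding slice_def using deg by (intro T.contract_right_cong Delta_closed)

lemma slice_form_add:
  assumes "left_form A (C \<beta>) f" "left_form A (C \<beta>) g" "left_form A (C \<beta>) h"
    and "\<And>c. c \<in> carrier (C \<beta>) \<Longrightarrow> h c = f c \<oplus>\<^bsub>A\<^esub> g c" and "c \<in> carrier (C (\<alpha> \<otimes> \<beta>))"
  shows "slice \<alpha> \<beta> h c = slice \<alpha> \<beta> f c \<oplus>\<^bsub>C \<alpha>\<^esub> slice \<alpha> \<beta> g c"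
  unfolding slice_def by (rule T.contract_right_form_add[OF assms(1-4) Delta_closed[OF deg assms(5)]])

lemma slice_form_rsmult:
  assumes "left_form A (C \<beta>) f" "left_form A (C \<beta>) g" "a \<in> carrier A"
    and "\<And>c. c \<in> carrier (C \<beta>) \<Longrightarrow> g c = f c \<otimes>\<^bsub>A\<^esub> a" and "c \<in> carrier (C (\<alpha> \<otimes> \<beta>))"
  shows "slice \<alpha> \<beta> g c = slice \<alpha> \<beta> f c \<triangleleft>\<^bsub>C \<alpha>\<^esub> a"
  unfolding slice_def by (rule T.contract_right_form_rsmult[OF assms(1-4) Delta_closed[OF deg assms(5)]])

lemma form_slice:
  assumes f: "left_form A (C \<beta>) f" and g: "left_form A (C \<alpha>) g"
  shows "left_form A (C (\<alpha> \<otimes> \<beta>)) (\<lambda>c. g (slice \<alpha> \<beta> f c))"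
  using f by (intro left_formI)
    (simp_all add: left_formD[OF g] slice_closed slice_add slice_lsmult)

end

text \<open>Coassociativity: \<open>c\<^sub>1 g(c\<^sub>2 f(c\<^sub>3))\<close> can be computed from either bracketing. The two sides are
  contractions of the two triple tensors that \<open>coassoc\<close> identifies.\<close>

lemma slice_comp:
  assumes deg: "\<alpha> \<in> carrier G" "\<beta> \<in> carrier G" "\<gamma> \<in> carrier G"
    and f: "left_form A (C \<gamma>) f" and g: "left_form A (C \<beta>) g"
    and c: "c \<in> carrier (C (\<alpha> \<otimes> \<beta> \<otimes> \<gamma>))"
  shows "slice \<alpha> (\<beta> \<otimes> \<gamma>) (\<lambda>c. g (slice \<beta> \<gamma> f c)) c =
    slice \<alpha> \<beta> g (slice (\<alpha> \<otimes> \<beta>) \<gamma> f c)"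
proof -
  interpret ABC: tensor_bimodules3 A "C \<alpha>" "C \<beta>" "C \<gamma>"
    using deg by (intro tensor_bimodules3.intro bimodules)
  let ?u = "\<Delta> (\<alpha> \<otimes> \<beta>) \<gamma> c" and ?v = "\<Delta> \<alpha> (\<beta> \<otimes> \<gamma>) c"
  let ?gf = "\<lambda>t. g (contract_right A (C \<beta>) (C \<gamma>) f t)"
  let ?u' = "tensor_map A (C (\<alpha> \<otimes> \<beta>)) (C \<gamma>) (tensor A (C \<alpha>) (C \<beta>)) (C \<gamma>) (\<Delta> \<alpha> \<beta>) (\<lambda>c. c) ?u"
  have ab: "\<alpha> \<otimes> \<beta> \<in> carrier G" "\<beta> \<otimes> \<gamma> \<in> carrier G" using deg by simp_all
  note AB_C = bimodules[OF ab(1) deg(3)] and A_BC = bimodules[OF deg(1) ab(2)]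
  have c': "c \<in> carrier (C (\<alpha> \<otimes> (\<beta> \<otimes> \<gamma>)))" using c deg by (simp add: G.m_assoc)
  have u: "?u \<in> carrier (tensor_group A (C (\<alpha> \<otimes> \<beta>)) (C \<gamma>))"
    using Delta_closed[OF ab(1) deg(3) c] .
  have v: "?v \<in> carrier (tensor_group A (C \<alpha>) (C (\<beta> \<otimes> \<gamma>)))"
    using Delta_closed[OF deg(1) ab(2) c'] .
  have D_ab: "\<Delta> \<alpha> \<beta> \<in> hom (add_monoid (C (\<alpha> \<otimes> \<beta>))) (add_monoid (tensor A (C \<alpha>) (C \<beta>)))"
    and D_bc: "\<Delta> \<beta> \<gamma> \<in> hom (add_monoid (C (\<beta> \<otimes> \<gamma>))) (add_monoid (tensor A (C \<beta>) (C \<gamma>)))"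
    using Delta_hom deg by (simp_all add: bimod_hom_def)
  have gf: "left_form A (tensor A (C \<beta>) (C \<gamma>)) ?gf"
    using f by (intro left_formI) (simp_all add: left_formD[OF g] ABC.NP.contract_right_closed
        ABC.NP.contract_right_add ABC.NP.contract_right_lsmult)
  have id: "(\<lambda>c. c) \<in> hom (add_monoid (C \<gamma>)) (add_monoid (C \<gamma>))" by (rule homI) simp_all
  have u': "?u' \<in> carrier (tensor_group A (tensor A (C \<alpha>) (C \<beta>)) (C \<gamma>))"
  proof (rule hom_in_carrier[OF tensor_map_props(1) u])
    show "tensor_factors A (C (\<alpha> \<otimes> \<beta>)) (C \<gamma>)"
      by (rule bimodule_tensor_factors[OF bimodule_C[OF ab(1)] bimodule_C[OF deg(3)]])
    show "tensor_factors A (tensor A (C \<alpha>) (C \<beta>)) (C \<gamma>)" by (rule ABC.MN_P.tensor_factors_axioms)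
  qed (use D_ab id deg in \<open>simp_all add: Delta_rsmult\<close>)
  have "slice \<alpha> (\<beta> \<otimes> \<gamma>) (\<lambda>c. g (slice \<beta> \<gamma> f c)) c =
      contract_right A (C \<alpha>) (C (\<beta> \<otimes> \<gamma>)) (\<lambda>c. ?gf (\<Delta> \<beta> \<gamma> c)) ?v"
    by (simp add: slice_def)
  also have "\<dots> = contract_right A (C \<alpha>) (tensor A (C \<beta>) (C \<gamma>)) ?gf
      (tensor_map A (C \<alpha>) (C (\<beta> \<otimes> \<gamma>)) (C \<alpha>) (tensor A (C \<beta>) (C \<gamma>)) (\<lambda>c. c) (\<Delta> \<beta> \<gamma>) ?v)"
    using deg by (intro contract_right_natural_right[OF A_BC ABC.M_NP.tensor_bimodules_axioms D_bc _ gf v,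
          symmetric]) (simp add: Delta_lsmult)
  also have "\<dots> = contract_right A (C \<alpha>) (tensor A (C \<beta>) (C \<gamma>)) ?gf
      (tensor_assoc A (C \<alpha>) (C \<beta>) (C \<gamma>) ?u')"
    using coassoc[OF deg c] by simp
  also have "\<dots> = contract_right A (C \<alpha>) (C \<beta>) g
      (contract_right A (tensor A (C \<alpha>) (C \<beta>)) (C \<gamma>) f ?u')"
    by (rule ABC.contract_right_assoc[OF f g u'])
  also have "contract_right A (tensor A (C \<alpha>) (C \<beta>)) (C \<gamma>) f ?u' =
      \<Delta> \<alpha> \<beta> (contract_right A (C (\<alpha> \<otimes> \<beta>)) (C \<gamma>) f ?u)"
    using deg by (intro contract_right_natural_left[OF AB_C ABC.MN_P.tensor_bimodules_axioms D_ab _ f u])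
      (simp add: Delta_rsmult)
  finally show ?thesis by (simp add: slice_def)
qed

lemma slice_counit:
  assumes \<alpha>: "\<alpha> \<in> carrier G" and c: "c \<in> carrier (C \<alpha>)"
  shows "slice \<alpha> \<one> \<epsilon> c = c"
proof -
  have reg: "tensor_bimodules A A A (C \<alpha>) (regular_bimod A)"
    by (rule tensor_bimodules.intro[OF bimodule_C[OF \<alpha>] bimodule_regular[OF A.ring_axioms]])
  have t: "\<Delta> \<alpha> \<one> c \<in> carrier (tensor_group A (C \<alpha>) (C \<one>))"
    using \<alpha> c by (intro Delta_closed) simp_all
  have eps: "\<epsilon> \<in> hom (add_monoid (C \<one>)) (add_monoid (regular_bimod A))"
    using eps_hom by (simp add: bimod_hom_def)
  have id: "left_form A (regular_bimod A) (\<lambda>a. a)" by (rule left_formI) simp_all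
  have "slice \<alpha> \<one> \<epsilon> c = contract_right A (C \<alpha>) (regular_bimod A) (\<lambda>a. a)
      (tensor_map A (C \<alpha>) (C \<one>) (C \<alpha>) (regular_bimod A) (\<lambda>c. c) \<epsilon> (\<Delta> \<alpha> \<one> c))"
    using contract_right_natural_right[OF bimodules[OF \<alpha> G.one_closed] reg eps _ id t]
    by (simp add: slice_def left_formD[OF eps_form])
  then show ?thesis using counit_right[OF \<alpha> c] by (simp add: tensor_runit_eq)
qed

text \<open>By right linearity of the counit and left linearity of \<open>f\<close>, \<open>\<epsilon>(c\<^sub>1 f(c\<^sub>2)) = \<epsilon>(c\<^sub>1) f(c\<^sub>2) = f(\<epsilon>(c\<^sub>1) c\<^sub>2)\<close>,
  and the left counit law applies.\<close>

lemma eps_slice: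
  assumes \<alpha>: "\<alpha> \<in> carrier G" and f: "left_form A (C \<alpha>) f" and c: "c \<in> carrier (C \<alpha>)"
  shows "\<epsilon> (slice \<one> \<alpha> f c) = f c"
proof -
  have reg: "tensor_bimodules A A A (regular_bimod A) (C \<alpha>)"
    by (rule tensor_bimodules.intro[OF bimodule_regular[OF A.ring_axioms] bimodule_C[OF \<alpha>]])
  have t: "\<Delta> \<one> \<alpha> c \<in> carrier (tensor_group A (C \<one>) (C \<alpha>))"
    using \<alpha> c by (intro Delta_closed) simp_all
  have eps: "\<epsilon> \<in> hom (add_monoid (C \<one>)) (add_monoid (regular_bimod A))"
    using eps_hom by (simp add: bimod_hom_def)
  have id: "(\<lambda>c. c) \<in> hom (add_monoid (C \<alpha>)) (add_monoid (C \<alpha>))" by (rule homI) simp_all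
  let ?s = "tensor_map A (C \<one>) (C \<alpha>) (regular_bimod A) (C \<alpha>) \<epsilon> (\<lambda>c. c) (\<Delta> \<one> \<alpha> c)"
  have s: "?s \<in> carrier (tensor_group A (regular_bimod A) (C \<alpha>))"
  proof (rule hom_in_carrier[OF tensor_map_props(1) t])
    show "tensor_factors A (C \<one>) (C \<alpha>)"
      by (rule bimodule_tensor_factors[OF bimodule_C[OF G.one_closed] bimodule_C[OF \<alpha>]])
    show "tensor_factors A (regular_bimod A) (C \<alpha>)"
      by (rule bimodule_tensor_factors[OF bimodule_regular[OF A.ring_axioms] bimodule_C[OF \<alpha>]])
  qed (use eps id in \<open>simp_all add: eps_rsmult\<close>)
  have "\<epsilon> (slice \<one> \<alpha> f c) = contract_right A (regular_bimod A) (C \<alpha>) f ?s"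
    using contract_right_natural_left[OF bimodules[OF G.one_closed \<alpha>] reg eps _ f t]
    by (simp add: slice_def eps_rsmult)
  also have "\<dots> = f (tensor_lunit A (C \<alpha>) ?s)"
    using form_tensor_lunit[OF A.ring_axioms bimodule_C[OF \<alpha>] f s] by simp
  finally show ?thesis using counit_left[OF \<alpha> c] by simp
qed

end

section \<open>The left dual graded ring\<close>

context group_coring_with_grouplike
begin

text \<open>Forms of degree \<open>\<alpha>\<close> have their arguments in degree \<open>\<alpha>\<^sup>-\<^sup>1\<close>, so these inverted degrees occur throughout.\<close>

abbreviation "Cinv \<alpha> \<equiv> C (inv \<alpha>)"

abbreviation "xinv \<alpha> \<equiv> x (inv \<alpha>)"

lemma cancel_inv:
  "\<lbrakk>\<alpha> \<in> carrier G; \<beta> \<in> carrier G\<rbrakk> \<Longrightarrow> inv \<alpha> \<otimes> (\<alpha> \<otimes> \<beta>) = \<beta>"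
  "\<lbrakk>\<alpha> \<in> carrier G; \<beta> \<in> carrier G\<rbrakk> \<Longrightarrow> \<alpha> \<otimes> (inv \<alpha> \<otimes> \<beta>) = \<beta>"
  by (simp_all add: G.m_assoc[symmetric])

lemmas degree_simps = G.m_assoc G.inv_mult_group cancel_inv

lemma Cmod: "\<alpha> \<in> carrier G \<Longrightarrow> bimodule A A (Cinv \<alpha>)"
  by (simp add: bimodule_C)

lemmas C_lsmult_closed = bimodule.lsmult_closed[OF Cmod]
  and C_rsmult_closed = bimodule.rsmult_closed[OF Cmod]
  and C_lsmult_l_distr = bimodule.lsmult_l_distr[OF Cmod]
  and C_lsmult_assoc = bimodule.lsmult_assoc[OF Cmod]
  and C_lsmult_one = bimodule.lsmult_one[OF Cmod]
  and C_rsmult_r_distr = bimodule.rsmult_r_distr[OF Cmod]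
  and C_rsmult_assoc = bimodule.rsmult_assoc[OF Cmod]
  and C_rsmult_one = bimodule.rsmult_one[OF Cmod]
  and C_smult_commute = bimodule.smult_commute[OF Cmod]

lemma x_inv_closed: "\<alpha> \<in> carrier G \<Longrightarrow> xinv \<alpha> \<in> carrier (Cinv \<alpha>)"
  by (simp add: x_closed)

lemma x_rsmult_closed:
  "\<lbrakk>\<alpha> \<in> carrier G; a \<in> carrier A\<rbrakk> \<Longrightarrow>
    xinv \<alpha> \<triangleleft>\<^bsub>Cinv \<alpha>\<^esub> a \<in> carrier (Cinv \<alpha>)"
  by (simp add: x_inv_closed C_rsmult_closed)

lemma carrier_Rc: "f \<in> carrier (Rc \<alpha>) \<longleftrightarrow>
    left_form A (Cinv \<alpha>) f \<and> f \<in> extensional (carrier (Cinv \<alpha>))"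
  by (simp add: Rc_def left_dual_def left_hom_regular)

lemma Rc_form: "f \<in> carrier (Rc \<alpha>) \<Longrightarrow> left_form A (Cinv \<alpha>) f"
  by (simp add: carrier_Rc)

lemmas Rc_apply_closed = left_formD(1)[OF Rc_form]
  and Rc_apply_add = left_formD(2)[OF Rc_form]
  and Rc_apply_lsmult = left_formD(3)[OF Rc_form]

lemma Rc_eqI:
  assumes "f \<in> carrier (Rc \<alpha>)" "g \<in> carrier (Rc \<alpha>)"
    and "\<And>c. c \<in> carrier (Cinv \<alpha>) \<Longrightarrow> f c = g c"
  shows "f = g"
  using assms by (auto simp: carrier_Rc intro: extensionalityI)

lemma Rc_memI:
  assumes "left_form A (Cinv \<alpha>) f" and "\<alpha> \<in> carrier G"
  shows "restrict f (carrier (Cinv \<alpha>)) \<in> carrier (Rc \<alpha>)"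
proof -
  interpret M: bimodule A A "Cinv \<alpha>" using assms(2) by (rule Cmod)
  have "left_form A (Cinv \<alpha>) (restrict f (carrier (Cinv \<alpha>)))"
    by (rule left_formI) (simp_all add: left_formD[OF assms(1)] M.lsmult_closed)
  then show ?thesis by (simp add: carrier_Rc)
qed

lemma Rc_add: "f \<oplus>\<^bsub>Rc \<alpha>\<^esub> g = (\<lambda>c\<in>carrier (Cinv \<alpha>). f c \<oplus>\<^bsub>A\<^esub> g c)"
  and Rc_zero: "\<zero>\<^bsub>Rc \<alpha>\<^esub> = (\<lambda>c\<in>carrier (Cinv \<alpha>). \<zero>\<^bsub>A\<^esub>)"
  and Rc_rsmult: "f \<triangleleft>\<^bsub>Rc \<alpha>\<^esub> a = (\<lambda>c\<in>carrier (Cinv \<alpha>). f c \<otimes>\<^bsub>A\<^esub> a)"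
  by (simp_all add: Rc_def left_dual_def)

lemma Rc_add_closed:
  "\<lbrakk>\<alpha> \<in> carrier G; f \<in> carrier (Rc \<alpha>); g \<in> carrier (Rc \<alpha>)\<rbrakk> \<Longrightarrow> f \<oplus>\<^bsub>Rc \<alpha>\<^esub> g \<in> carrier (Rc \<alpha>)"
  unfolding Rc_add
  by (intro Rc_memI left_formI)
    (simp_all add: Rc_apply_closed Rc_apply_add Rc_apply_lsmult A.r_distr A.a_ac)

lemma Rc_zero_closed: "\<alpha> \<in> carrier G \<Longrightarrow> \<zero>\<^bsub>Rc \<alpha>\<^esub> \<in> carrier (Rc \<alpha>)"
  unfolding Rc_zero by (intro Rc_memI left_formI) simp_all

lemma Rc_rsmult_closed:
  "\<lbrakk>\<alpha> \<in> carrier G; f \<in> carrier (Rc \<alpha>); a \<in> carrier A\<rbrakk> \<Longrightarrow> f \<triangleleft>\<^bsub>Rc \<alpha>\<^esub> a \<in> carrier (Rc \<alpha>)"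
  unfolding Rc_rsmult
  by (intro Rc_memI left_formI)
    (simp_all add: Rc_apply_closed Rc_apply_add Rc_apply_lsmult A.l_distr A.m_assoc)

lemma abelian_group_Rc:
  assumes \<alpha>: "\<alpha> \<in> carrier G"
  shows "abelian_group (Rc \<alpha>)"
proof (rule abelian_groupI)
  fix f g h assume fgh: "f \<in> carrier (Rc \<alpha>)" "g \<in> carrier (Rc \<alpha>)" "h \<in> carrier (Rc \<alpha>)"
  show "f \<oplus>\<^bsub>Rc \<alpha>\<^esub> g \<in> carrier (Rc \<alpha>)" using \<alpha> fgh by (intro Rc_add_closed)
  show "(f \<oplus>\<^bsub>Rc \<alpha>\<^esub> g) \<oplus>\<^bsub>Rc \<alpha>\<^esub> h = f \<oplus>\<^bsub>Rc \<alpha>\<^esub> (g \<oplus>\<^bsub>Rc \<alpha>\<^esub> h)"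
    by (rule Rc_eqI[of _ \<alpha>]) (use \<alpha> fgh in \<open>simp_all add: Rc_add_closed, simp add: Rc_add Rc_apply_closed A.a_ac\<close>)
  show "f \<oplus>\<^bsub>Rc \<alpha>\<^esub> g = g \<oplus>\<^bsub>Rc \<alpha>\<^esub> f"
    by (rule Rc_eqI[of _ \<alpha>]) (use \<alpha> fgh in \<open>simp_all add: Rc_add_closed, simp add: Rc_add Rc_apply_closed A.a_ac\<close>)
next
  show "\<zero>\<^bsub>Rc \<alpha>\<^esub> \<in> carrier (Rc \<alpha>)" using \<alpha> by (rule Rc_zero_closed)
next
  fix f assume f: "f \<in> carrier (Rc \<alpha>)"
  show "\<zero>\<^bsub>Rc \<alpha>\<^esub> \<oplus>\<^bsub>Rc \<alpha>\<^esub> f = f"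
    by (rule Rc_eqI[of _ \<alpha>])
      (use \<alpha> f in \<open>simp_all add: Rc_add_closed Rc_zero_closed, simp add: Rc_add Rc_zero Rc_apply_closed\<close>)
  have g: "f \<triangleleft>\<^bsub>Rc \<alpha>\<^esub> (\<ominus>\<^bsub>A\<^esub> \<one>\<^bsub>A\<^esub>) \<in> carrier (Rc \<alpha>)" using \<alpha> f by (intro Rc_rsmult_closed) simp_all
  have "(f \<triangleleft>\<^bsub>Rc \<alpha>\<^esub> (\<ominus>\<^bsub>A\<^esub> \<one>\<^bsub>A\<^esub>)) \<oplus>\<^bsub>Rc \<alpha>\<^esub> f = \<zero>\<^bsub>Rc \<alpha>\<^esub>"
    by (rule Rc_eqI[of _ \<alpha>])
      (use \<alpha> f g in \<open>simp_all add: Rc_add_closed Rc_zero_closed,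
        simp add: Rc_add Rc_zero Rc_rsmult Rc_apply_closed A.r_minus A.l_neg\<close>)
  with g show "\<exists>g\<in>carrier (Rc \<alpha>). g \<oplus>\<^bsub>Rc \<alpha>\<^esub> f = \<zero>\<^bsub>Rc \<alpha>\<^esub>" by blast
qed

lemma contract_eq: "contract \<alpha> \<beta> f c = slice (inv \<beta>) (inv \<alpha>) f c"
  by (simp add: contract_def slice_def contract_right_def)

lemma contract_closed:
  "\<lbrakk>\<alpha> \<in> carrier G; \<beta> \<in> carrier G; f \<in> carrier (Rc \<alpha>); c \<in> carrier (Cinv (\<alpha> \<otimes> \<beta>))\<rbrakk> \<Longrightarrow>
    contract \<alpha> \<beta> f c \<in> carrier (Cinv \<beta>)"
  by (simp add: contract_eq slice_closed Rc_form G.inv_mult_group)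

lemma form_contract:
  "\<lbrakk>\<alpha> \<in> carrier G; \<beta> \<in> carrier G; f \<in> carrier (Rc \<alpha>); left_form A (Cinv \<beta>) g\<rbrakk> \<Longrightarrow>
    left_form A (Cinv (\<alpha> \<otimes> \<beta>)) (\<lambda>c. g (contract \<alpha> \<beta> f c))"
  by (simp add: contract_eq form_slice Rc_form G.inv_mult_group)

lemma conv_eq:
  assumes "\<alpha> \<in> carrier G" "\<beta> \<in> carrier G" "f \<in> carrier (Rc \<alpha>)" "g \<in> carrier (Rc \<beta>)"
  shows "conv \<alpha> \<beta> f g = (\<lambda>c\<in>carrier (Cinv (\<alpha> \<otimes> \<beta>)). g (contract \<alpha> \<beta> f c))"
  unfolding conv_def
proof (rule restrict_ext)
  fix c assume "c \<in> carrier (Cinv (\<alpha> \<otimes> \<beta>))"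
  then have "\<Delta> (inv \<beta>) (inv \<alpha>) c \<in> carrier (tensor_group A (Cinv \<beta>) (Cinv \<alpha>))"
    using assms by (intro Delta_closed) (simp_all add: G.inv_mult_group)
  from tensor_lift_form_contract[OF bimodules Rc_form[OF assms(3)] Rc_form[OF assms(4)] this]
  show "tensor_lift A (Cinv \<beta>) (Cinv \<alpha>) (add_monoid A)
      (\<lambda>c1 c2. g (c1 \<triangleleft>\<^bsub>Cinv \<beta>\<^esub> f c2)) (\<Delta> (inv \<beta>) (inv \<alpha>) c) = g (contract \<alpha> \<beta> f c)"
    using assms by (simp add: contract_eq slice_def)
qed

lemma conv_closed:
  "\<lbrakk>\<alpha> \<in> carrier G; \<beta> \<in> carrier G; f \<in> carrier (Rc \<alpha>); g \<in> carrier (Rc \<beta>)\<rbrakk> \<Longrightarrow>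
    conv \<alpha> \<beta> f g \<in> carrier (Rc (\<alpha> \<otimes> \<beta>))"
  by (simp add: conv_eq Rc_memI form_contract Rc_form)

lemma conv_apply:
  "\<lbrakk>\<alpha> \<in> carrier G; \<beta> \<in> carrier G; f \<in> carrier (Rc \<alpha>); g \<in> carrier (Rc \<beta>);
    c \<in> carrier (Cinv (\<alpha> \<otimes> \<beta>))\<rbrakk> \<Longrightarrow> conv \<alpha> \<beta> f g c = g (contract \<alpha> \<beta> f c)"
  by (simp add: conv_eq)

text \<open>Contracting with \<open>f # g\<close> is contracting with \<open>f\<close> and then with \<open>g\<close>. As \<open>f # g\<close> is \<open>g\<close> after contraction
  with \<open>f\<close>, associativity of the product of forms is associativity of composition.\<close>

lemma contract_conv:
  assumes "\<alpha> \<in> carrier G" "\<beta> \<in> carrier G" "\<gamma> \<in> carrier G"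
    and f: "f \<in> carrier (Rc \<alpha>)" and g: "g \<in> carrier (Rc \<beta>)"
    and c: "c \<in> carrier (Cinv (\<alpha> \<otimes> \<beta> \<otimes> \<gamma>))"
  shows "contract (\<alpha> \<otimes> \<beta>) \<gamma> (conv \<alpha> \<beta> f g) c =
    contract \<beta> \<gamma> g (contract \<alpha> (\<beta> \<otimes> \<gamma>) f c)"
proof -
  have deg: "inv \<alpha> \<in> carrier G" "inv \<beta> \<in> carrier G" "inv \<gamma> \<in> carrier G"
    "inv \<beta> \<otimes> inv \<alpha> \<in> carrier G"
    using assms by simp_all
  have inv_ab: "inv (\<alpha> \<otimes> \<beta>) = inv \<beta> \<otimes> inv \<alpha>"
    and inv_bc: "inv (\<beta> \<otimes> \<gamma>) = inv \<gamma> \<otimes> inv \<beta>"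
    using assms by (simp_all add: G.inv_mult_group)
  have c1: "c \<in> carrier (C (inv \<gamma> \<otimes> inv \<beta> \<otimes> inv \<alpha>))"
    and c2: "c \<in> carrier (C (inv \<gamma> \<otimes> (inv \<beta> \<otimes> inv \<alpha>)))"
    using c assms(1-3) by (simp_all add: degree_simps)
  have form: "left_form A (C (inv \<beta> \<otimes> inv \<alpha>)) (\<lambda>c. g (contract \<alpha> \<beta> f c))"
    using form_contract[OF assms(1,2) f Rc_form[OF g]] unfolding inv_ab .
  have "contract (\<alpha> \<otimes> \<beta>) \<gamma> (conv \<alpha> \<beta> f g) c =
      slice (inv \<gamma>) (inv \<beta> \<otimes> inv \<alpha>) (\<lambda>c. g (contract \<alpha> \<beta> f c)) c"
    unfolding contract_eq[of "\<alpha> \<otimes> \<beta>"] inv_ab using assms c2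
    by (intro slice_cong deg form) (simp_all add: conv_apply inv_ab)
  also have "\<dots> = slice (inv \<gamma>) (inv \<beta>) g (slice (inv \<gamma> \<otimes> inv \<beta>) (inv \<alpha>) f c)"
    unfolding contract_eq by (rule slice_comp[OF deg(3,2,1) Rc_form[OF f] Rc_form[OF g] c1])
  finally show ?thesis by (simp add: contract_eq inv_bc)
qed

lemma conv_assoc:
  assumes "\<alpha> \<in> carrier G" "\<beta> \<in> carrier G" "\<gamma> \<in> carrier G"
    and "f \<in> carrier (Rc \<alpha>)" "g \<in> carrier (Rc \<beta>)" "h \<in> carrier (Rc \<gamma>)"
  shows "conv (\<alpha> \<otimes> \<beta>) \<gamma> (conv \<alpha> \<beta> f g) h = conv \<alpha> (\<beta> \<otimes> \<gamma>) f (conv \<beta> \<gamma> g h)"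
proof -
  have "conv (\<alpha> \<otimes> \<beta>) \<gamma> (conv \<alpha> \<beta> f g) h =
      (\<lambda>c\<in>carrier (Cinv (\<alpha> \<otimes> \<beta> \<otimes> \<gamma>)). h (contract (\<alpha> \<otimes> \<beta>) \<gamma> (conv \<alpha> \<beta> f g) c))"
    using assms by (intro conv_eq) (simp_all add: conv_closed)
  also have "\<dots> = (\<lambda>c\<in>carrier (Cinv (\<alpha> \<otimes> (\<beta> \<otimes> \<gamma>))). conv \<beta> \<gamma> g h (contract \<alpha> (\<beta> \<otimes> \<gamma>) f c))"
    using assms by (intro restrict_cong) (simp_all add: G.m_assoc contract_conv conv_apply contract_closed)
  also have "\<dots> = conv \<alpha> (\<beta> \<otimes> \<gamma>) f (conv \<beta> \<gamma> g h)"
    using assms by (intro conv_eq[symmetric]) (simp_all add: conv_closed)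
  finally show ?thesis .
qed

text \<open>The counit, restricted because the elements of the dual modules are extensional.\<close>

definition unit_R :: "'c \<Rightarrow> 'a" where
  "unit_R = restrict \<epsilon> (carrier (C \<one>))"

lemma unit_R_closed: "unit_R \<in> carrier (Rc \<one>)"
  using Rc_memI[of "\<one>" \<epsilon>] eps_form by (simp add: unit_R_def)

lemma contract_unit_R:
  assumes "\<beta> \<in> carrier G" "c \<in> carrier (Cinv \<beta>)"
  shows "contract \<one> \<beta> unit_R c = c"
proof -
  have "contract \<one> \<beta> unit_R c = slice (inv \<beta>) \<one> \<epsilon> c"
    unfolding contract_eq G.inv_one using assms
    by (intro slice_cong eps_form) (simp_all add: unit_R_def)
  then show ?thesis using assms by (simp add: slice_counit)
qed

lemma conv_unit_left:
  assumes "\<beta> \<in> carrier G" "g \<in> carrier (Rc \<beta>)"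
  shows "conv \<one> \<beta> unit_R g = g"
proof (rule Rc_eqI[of _ \<beta>])
  show "conv \<one> \<beta> unit_R g \<in> carrier (Rc \<beta>)"
    using conv_closed[OF G.one_closed assms(1) unit_R_closed assms(2)] assms by simp
  show "conv \<one> \<beta> unit_R g c = g c" if "c \<in> carrier (Cinv \<beta>)" for c
    using assms that by (simp add: conv_apply unit_R_closed contract_unit_R)
qed (rule assms)

lemma conv_unit_right:
  assumes "\<alpha> \<in> carrier G" "f \<in> carrier (Rc \<alpha>)"
  shows "conv \<alpha> \<one> f unit_R = f"
proof (rule Rc_eqI[of _ \<alpha>])
  show "conv \<alpha> \<one> f unit_R \<in> carrier (Rc \<alpha>)"
    using conv_closed[OF assms(1) G.one_closed assms(2) unit_R_closed] assms by simp
  show "conv \<alpha> \<one> f unit_R c = f c" if c: "c \<in> carrier (Cinv \<alpha>)" for c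
  proof -
    have "contract \<alpha> \<one> f c \<in> carrier (C \<one>)"
      using contract_closed[OF assms(1) G.one_closed assms(2), of c] assms c by simp
    then show ?thesis
      using assms c by (simp add: conv_apply unit_R_closed)
        (simp add: unit_R_def contract_eq eps_slice Rc_form)
  qed
qed (rule assms)

text \<open>Since \<open>\<Delta>(x a) = x \<otimes> x a\<close> for the grouplike family.\<close>

lemma contract_x:
  assumes "\<alpha> \<in> carrier G" "\<beta> \<in> carrier G" "f \<in> carrier (Rc \<alpha>)" "a \<in> carrier A"
  shows "contract \<alpha> \<beta> f (xinv (\<alpha> \<otimes> \<beta>) \<triangleleft>\<^bsub>Cinv (\<alpha> \<otimes> \<beta>)\<^esub> a) =
    xinv \<beta> \<triangleleft>\<^bsub>Cinv \<beta>\<^esub> f (xinv \<alpha> \<triangleleft>\<^bsub>Cinv \<alpha>\<^esub> a)"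
proof -
  have deg: "inv \<beta> \<in> carrier G" "inv \<alpha> \<in> carrier G" using assms by simp_all
  interpret T: tensor_bimodules A A A "Cinv \<beta>" "Cinv \<alpha>" using deg by (rule bimodules)
  have x: "xinv \<beta> \<in> carrier (Cinv \<beta>)" "xinv \<alpha> \<in> carrier (Cinv \<alpha>)"
    "x (inv \<beta> \<otimes> inv \<alpha>) \<in> carrier (C (inv \<beta> \<otimes> inv \<alpha>))"
    using deg by (simp_all add: x_closed)
  have "\<Delta> (inv \<beta>) (inv \<alpha>) (x (inv \<beta> \<otimes> inv \<alpha>) \<triangleleft>\<^bsub>C (inv \<beta> \<otimes> inv \<alpha>)\<^esub> a) =
      pure_tensor A (Cinv \<beta>) (Cinv \<alpha>) (xinv \<beta>) (xinv \<alpha> \<triangleleft>\<^bsub>Cinv \<alpha>\<^esub> a)"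
    using deg x assms(4) by (simp add: Delta_rsmult Delta_x T.tensor_rsmult(2))
  then show ?thesis
    using assms x deg
    by (simp add: contract_eq slice_def G.inv_mult_group T.contract_right(2)[OF Rc_form] T.N.rsmult_closed)
qed

lemma contract_form_add:
  assumes "\<alpha> \<in> carrier G" "\<beta> \<in> carrier G" "f \<in> carrier (Rc \<alpha>)" "g \<in> carrier (Rc \<alpha>)"
    and "c \<in> carrier (Cinv (\<alpha> \<otimes> \<beta>))"
  shows "contract \<alpha> \<beta> (f \<oplus>\<^bsub>Rc \<alpha>\<^esub> g) c = contract \<alpha> \<beta> f c \<oplus>\<^bsub>Cinv \<beta>\<^esub> contract \<alpha> \<beta> g c"
  unfolding contract_eq
  by (rule slice_form_add[OF _ _ Rc_form[OF assms(3)] Rc_form[OF assms(4)]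
        Rc_form[OF Rc_add_closed[OF assms(1,3,4)]]])
    (use assms in \<open>simp_all add: Rc_add G.inv_mult_group\<close>)

lemma contract_form_rsmult:
  assumes "\<alpha> \<in> carrier G" "\<beta> \<in> carrier G" "f \<in> carrier (Rc \<alpha>)" "a \<in> carrier A"
    and "c \<in> carrier (Cinv (\<alpha> \<otimes> \<beta>))"
  shows "contract \<alpha> \<beta> (f \<triangleleft>\<^bsub>Rc \<alpha>\<^esub> a) c = contract \<alpha> \<beta> f c \<triangleleft>\<^bsub>Cinv \<beta>\<^esub> a"
  unfolding contract_eq
  by (rule slice_form_rsmult[OF _ _ Rc_form[OF assms(3)] Rc_form[OF Rc_rsmult_closed[OF assms(1,3,4)]]])
    (use assms in \<open>simp_all add: Rc_rsmult G.inv_mult_group\<close>)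

lemma conv_rsmult:
  assumes "\<alpha> \<in> carrier G" "\<beta> \<in> carrier G" "f \<in> carrier (Rc \<alpha>)" "g \<in> carrier (Rc \<beta>)" "a \<in> carrier A"
  shows "conv \<alpha> \<beta> f (g \<triangleleft>\<^bsub>Rc \<beta>\<^esub> a) = conv \<alpha> \<beta> f g \<triangleleft>\<^bsub>Rc (\<alpha> \<otimes> \<beta>)\<^esub> a"
  using assms by (intro Rc_eqI[of _ "\<alpha> \<otimes> \<beta>"])
    (simp_all add: conv_closed Rc_rsmult_closed conv_apply, simp add: Rc_rsmult conv_apply contract_closed)

lemma conv_add_left:
  assumes "\<alpha> \<in> carrier G" "\<beta> \<in> carrier G" "f \<in> carrier (Rc \<alpha>)" "f' \<in> carrier (Rc \<alpha>)" "g \<in> carrier (Rc \<beta>)"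
  shows "conv \<alpha> \<beta> (f \<oplus>\<^bsub>Rc \<alpha>\<^esub> f') g = conv \<alpha> \<beta> f g \<oplus>\<^bsub>Rc (\<alpha> \<otimes> \<beta>)\<^esub> conv \<alpha> \<beta> f' g"
  using assms by (intro Rc_eqI[of _ "\<alpha> \<otimes> \<beta>"])
    (simp_all add: conv_closed Rc_add_closed conv_apply contract_form_add contract_closed
      Rc_apply_add[of g \<beta>], simp add: Rc_add conv_apply)

lemma conv_add_right:
  assumes "\<alpha> \<in> carrier G" "\<beta> \<in> carrier G" "f \<in> carrier (Rc \<alpha>)" "g \<in> carrier (Rc \<beta>)" "g' \<in> carrier (Rc \<beta>)"
  shows "conv \<alpha> \<beta> f (g \<oplus>\<^bsub>Rc \<beta>\<^esub> g') = conv \<alpha> \<beta> f g \<oplus>\<^bsub>Rc (\<alpha> \<otimes> \<beta>)\<^esub> conv \<alpha> \<beta> f g'"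
  using assms by (intro Rc_eqI[of _ "\<alpha> \<otimes> \<beta>"])
    (simp_all add: conv_closed Rc_add_closed conv_apply, simp add: Rc_add conv_apply contract_closed)

section \<open>The ring \<open>S\<close> and the module \<open>Q\<close>\<close>

lemma Sset_mem: "b \<in> Sset \<longleftrightarrow> b \<in> (\<Pi>\<^sub>E \<alpha>\<in>carrier G. carrier A) \<and> (\<forall>\<alpha>\<in>carrier G. \<forall>\<beta>\<in>carrier G.
     b (\<alpha> \<otimes> \<beta>) \<triangleright>\<^bsub>Cinv \<beta>\<^esub> xinv \<beta> = xinv \<beta> \<triangleleft>\<^bsub>Cinv \<beta>\<^esub> b \<alpha>)"
  by (simp add: Sset_def)

lemma Sset_apply_closed: "\<lbrakk>b \<in> Sset; \<alpha> \<in> carrier G\<rbrakk> \<Longrightarrow> b \<alpha> \<in> carrier A"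
  by (auto simp: Sset_mem)

lemma Sset_shift:
  "\<lbrakk>b \<in> Sset; \<alpha> \<in> carrier G; \<beta> \<in> carrier G\<rbrakk> \<Longrightarrow>
    xinv \<beta> \<triangleleft>\<^bsub>Cinv \<beta>\<^esub> b \<alpha> = b (\<alpha> \<otimes> \<beta>) \<triangleright>\<^bsub>Cinv \<beta>\<^esub> xinv \<beta>"
  by (simp add: Sset_mem)

lemma Sset_eqI:
  assumes "b \<in> Sset" "d \<in> Sset" "\<And>\<alpha>. \<alpha> \<in> carrier G \<Longrightarrow> b \<alpha> = d \<alpha>"
  shows "b = d"
  using assms by (auto simp: Sset_mem intro: PiE_ext)

lemma Sset_memI:
  assumes "\<And>\<alpha>. \<alpha> \<in> carrier G \<Longrightarrow> b \<alpha> \<in> carrier A"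
    and "\<And>\<alpha> \<beta>. \<lbrakk>\<alpha> \<in> carrier G; \<beta> \<in> carrier G\<rbrakk> \<Longrightarrow>
      b (\<alpha> \<otimes> \<beta>) \<triangleright>\<^bsub>Cinv \<beta>\<^esub> xinv \<beta> = xinv \<beta> \<triangleleft>\<^bsub>Cinv \<beta>\<^esub> b \<alpha>"
  shows "restrict b (carrier G) \<in> Sset"
  using assms by (simp add: Sset_mem)

lemma Sring_simps [simp]:
  "carrier (Sring B) = B" "b \<otimes>\<^bsub>Sring B\<^esub> d = (\<lambda>\<alpha>\<in>carrier G. b \<alpha> \<otimes>\<^bsub>A\<^esub> d \<alpha>)"
  "\<one>\<^bsub>Sring B\<^esub> = (\<lambda>\<alpha>\<in>carrier G. \<one>\<^bsub>A\<^esub>)" "\<zero>\<^bsub>Sring B\<^esub> = (\<lambda>\<alpha>\<in>carrier G. \<zero>\<^bsub>A\<^esub>)"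
  "b \<oplus>\<^bsub>Sring B\<^esub> d = (\<lambda>\<alpha>\<in>carrier G. b \<alpha> \<oplus>\<^bsub>A\<^esub> d \<alpha>)"
  by (simp_all add: Sring_def)

lemma zero_C: "\<beta> \<in> carrier G \<Longrightarrow> \<zero>\<^bsub>A\<^esub> \<triangleright>\<^bsub>Cinv \<beta>\<^esub> xinv \<beta> = \<zero>\<^bsub>Cinv \<beta>\<^esub>"
  and C_zero: "\<beta> \<in> carrier G \<Longrightarrow> xinv \<beta> \<triangleleft>\<^bsub>Cinv \<beta>\<^esub> \<zero>\<^bsub>A\<^esub> = \<zero>\<^bsub>Cinv \<beta>\<^esub>"
proof -
  assume \<beta>: "\<beta> \<in> carrier G"
  interpret M: bimodule A A "Cinv \<beta>" using \<beta> by (rule Cmod)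
  have x: "xinv \<beta> \<in> carrier (Cinv \<beta>)" using \<beta> by (rule x_inv_closed)
  have idem: "m = \<zero>\<^bsub>Cinv \<beta>\<^esub>" if "m \<in> carrier (Cinv \<beta>)" "m = m \<oplus>\<^bsub>Cinv \<beta>\<^esub> m" for m
    using that by simp
  show "\<zero>\<^bsub>A\<^esub> \<triangleright>\<^bsub>Cinv \<beta>\<^esub> xinv \<beta> = \<zero>\<^bsub>Cinv \<beta>\<^esub>"
    using M.lsmult_l_distr[of "\<zero>\<^bsub>A\<^esub>" "\<zero>\<^bsub>A\<^esub>", OF _ _ x] x by (intro idem M.lsmult_closed) simp_all
  show "xinv \<beta> \<triangleleft>\<^bsub>Cinv \<beta>\<^esub> \<zero>\<^bsub>A\<^esub> = \<zero>\<^bsub>Cinv \<beta>\<^esub>"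
    using M.rsmult_r_distr[of "\<zero>\<^bsub>A\<^esub>" "\<zero>\<^bsub>A\<^esub>", OF _ _ x] x by (intro idem M.rsmult_closed) simp_all
qed

lemma Sset_add: "\<lbrakk>b \<in> Sset; d \<in> Sset\<rbrakk> \<Longrightarrow> (\<lambda>\<alpha>\<in>carrier G. b \<alpha> \<oplus>\<^bsub>A\<^esub> d \<alpha>) \<in> Sset"
  by (intro Sset_memI)
    (simp_all add: Sset_apply_closed C_lsmult_l_distr C_rsmult_r_distr x_inv_closed Sset_shift)

lemma Sset_mult: "\<lbrakk>b \<in> Sset; d \<in> Sset\<rbrakk> \<Longrightarrow> (\<lambda>\<alpha>\<in>carrier G. b \<alpha> \<otimes>\<^bsub>A\<^esub> d \<alpha>) \<in> Sset"
  by (intro Sset_memI)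
    (simp_all add: Sset_apply_closed C_lsmult_assoc C_rsmult_assoc x_inv_closed
      Sset_shift[symmetric], simp_all add: Sset_shift C_smult_commute Sset_apply_closed x_inv_closed)

lemma Sset_zero: "(\<lambda>\<alpha>\<in>carrier G. \<zero>\<^bsub>A\<^esub>) \<in> Sset"
  by (intro Sset_memI) (simp_all add: zero_C C_zero)

lemma Sset_one: "(\<lambda>\<alpha>\<in>carrier G. \<one>\<^bsub>A\<^esub>) \<in> Sset"
  by (intro Sset_memI) (simp_all add: C_lsmult_one C_rsmult_one x_inv_closed)

lemma Sset_translate: "\<lbrakk>b \<in> Sset; \<sigma> \<in> carrier G\<rbrakk> \<Longrightarrow> translate b \<sigma> \<in> Sset"
  unfolding translate_def
  by (intro Sset_memI) (simp_all add: Sset_apply_closed Sset_shift G.m_assoc)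

text \<open>Multiplying by this family supplies the additive inverses of \<open>S\<close> and of \<open>Q\<close>, both of which are
  closed under multiplication by elements of \<open>S\<close>.\<close>

lemma Sset_minus_one: "(\<lambda>\<alpha>\<in>carrier G. \<ominus>\<^bsub>A\<^esub> \<one>\<^bsub>A\<^esub>) \<in> Sset"
proof (intro Sset_memI)
  fix \<beta> assume \<beta>: "\<beta> \<in> carrier G"
  interpret M: bimodule A A "Cinv \<beta>" using \<beta> by (rule Cmod)
  have x: "xinv \<beta> \<in> carrier (Cinv \<beta>)" using \<beta> by (rule x_inv_closed)
  have m: "\<ominus>\<^bsub>A\<^esub> \<one>\<^bsub>A\<^esub> \<in> carrier A" by simp
  have "((\<ominus>\<^bsub>A\<^esub> \<one>\<^bsub>A\<^esub>) \<triangleright>\<^bsub>Cinv \<beta>\<^esub> xinv \<beta>) \<oplus>\<^bsub>Cinv \<beta>\<^esub> xinv \<beta> = \<zero>\<^bsub>Cinv \<beta>\<^esub>"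
    using M.lsmult_l_distr[OF m A.one_closed x] M.lsmult_one[OF x] zero_C[OF \<beta>] by (simp add: A.l_neg)
  moreover have "(xinv \<beta> \<triangleleft>\<^bsub>Cinv \<beta>\<^esub> (\<ominus>\<^bsub>A\<^esub> \<one>\<^bsub>A\<^esub>)) \<oplus>\<^bsub>Cinv \<beta>\<^esub> xinv \<beta> = \<zero>\<^bsub>Cinv \<beta>\<^esub>"
    using M.rsmult_r_distr[OF m A.one_closed x] M.rsmult_one[OF x] C_zero[OF \<beta>] by (simp add: A.l_neg)
  \<comment> \<open>Both sides are the negative of \<open>x\<close>.\<close>
  ultimately show "(\<ominus>\<^bsub>A\<^esub> \<one>\<^bsub>A\<^esub>) \<triangleright>\<^bsub>Cinv \<beta>\<^esub> xinv \<beta> = xinv \<beta> \<triangleleft>\<^bsub>Cinv \<beta>\<^esub> (\<ominus>\<^bsub>A\<^esub> \<one>\<^bsub>A\<^esub>)"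
    using M.M.minus_equality[OF _ x] x m by (metis M.lsmult_closed M.rsmult_closed)
qed simp

lemma abelian_group_Sring: "abelian_group (Sring Sset)"
proof (rule abelian_groupI, goal_cases)
  case (1 b d)
  then show ?case by (simp add: Sset_add)
next
  case 2
  then show ?case by (simp add: Sset_zero)
next
  case (3 b d e)
  then show ?case by (auto simp: Sset_apply_closed A.a_assoc)
next
  case (4 b d)
  then show ?case by (auto simp: Sset_apply_closed A.a_comm)
next
  case (5 b)
  then have b: "b \<in> Sset" by simp
  have "\<zero>\<^bsub>Sring Sset\<^esub> \<oplus>\<^bsub>Sring Sset\<^esub> b \<in> Sset"
    unfolding Sring_simps by (rule Sset_add[OF Sset_zero b])
  then show ?case by (rule Sset_eqI[OF _ b]) (simp add: b Sset_apply_closed)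
next
  case (6 b)
  then have "(\<lambda>\<alpha>\<in>carrier G. (\<lambda>\<alpha>\<in>carrier G. \<ominus>\<^bsub>A\<^esub> \<one>\<^bsub>A\<^esub>) \<alpha> \<otimes>\<^bsub>A\<^esub> b \<alpha>) \<in> Sset"
    by (intro Sset_mult Sset_minus_one) simp
  then show ?case
    using 6 by (intro bexI[where x = "\<lambda>\<alpha>\<in>carrier G. (\<lambda>\<alpha>\<in>carrier G. \<ominus>\<^bsub>A\<^esub> \<one>\<^bsub>A\<^esub>) \<alpha> \<otimes>\<^bsub>A\<^esub> b \<alpha>"])
      (auto simp: Sset_apply_closed A.l_minus A.l_neg)
qed

lemma Qset_apply_closed: "\<lbrakk>q \<in> Qset; \<alpha> \<in> carrier G\<rbrakk> \<Longrightarrow> q \<alpha> \<in> carrier (Rc \<alpha>)"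
  by (auto simp: Qset_def)

lemma contract_Qset:
  "\<lbrakk>q \<in> Qset; \<alpha> \<in> carrier G; \<beta> \<in> carrier G; c \<in> carrier (Cinv (\<alpha> \<otimes> \<beta>))\<rbrakk> \<Longrightarrow>
    contract \<alpha> \<beta> (q \<alpha>) c = q (\<alpha> \<otimes> \<beta>) c \<triangleright>\<^bsub>Cinv \<beta>\<^esub> xinv \<beta>"
  by (simp add: Qset_def)

lemma Qset_eqI:
  assumes "p \<in> Qset" "q \<in> Qset" "\<And>\<alpha>. \<alpha> \<in> carrier G \<Longrightarrow> p \<alpha> = q \<alpha>"
  shows "p = q"
proof (rule PiE_ext)
  show "p \<in> (\<Pi>\<^sub>E \<alpha>\<in>carrier G. carrier (Rc \<alpha>))" "q \<in> (\<Pi>\<^sub>E \<alpha>\<in>carrier G. carrier (Rc \<alpha>))"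
    using assms(1,2) unfolding Qset_def by blast+
qed (rule assms(3))

lemma Qset_memI:
  assumes "\<And>\<alpha>. \<alpha> \<in> carrier G \<Longrightarrow> q \<alpha> \<in> carrier (Rc \<alpha>)"
    and "\<And>\<alpha> \<beta> c. \<lbrakk>\<alpha> \<in> carrier G; \<beta> \<in> carrier G; c \<in> carrier (Cinv (\<alpha> \<otimes> \<beta>))\<rbrakk> \<Longrightarrow>
      contract \<alpha> \<beta> (q \<alpha>) c = q (\<alpha> \<otimes> \<beta>) c \<triangleright>\<^bsub>Cinv \<beta>\<^esub> xinv \<beta>"
  shows "restrict q (carrier G) \<in> Qset"
  using assms by (simp add: Qset_def)

lemma Qmod_simps [simp]:
  "carrier (Qmod W) = W" "\<zero>\<^bsub>Qmod W\<^esub> = (\<lambda>\<alpha>\<in>carrier G. \<zero>\<^bsub>Rc \<alpha>\<^esub>)"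
  "p \<oplus>\<^bsub>Qmod W\<^esub> q = (\<lambda>\<alpha>\<in>carrier G. p \<alpha> \<oplus>\<^bsub>Rc \<alpha>\<^esub> q \<alpha>)"
  by (simp_all add: Qmod_def)

lemma Qset_add:
  assumes "p \<in> Qset" "q \<in> Qset"
  shows "(\<lambda>\<alpha>\<in>carrier G. p \<alpha> \<oplus>\<^bsub>Rc \<alpha>\<^esub> q \<alpha>) \<in> Qset"
proof (rule Qset_memI)
  fix \<alpha> \<beta> c
  assume deg: "\<alpha> \<in> carrier G" "\<beta> \<in> carrier G" and c: "c \<in> carrier (Cinv (\<alpha> \<otimes> \<beta>))"
  have val: "p (\<alpha> \<otimes> \<beta>) c \<in> carrier A" "q (\<alpha> \<otimes> \<beta>) c \<in> carrier A"
    using assms deg c Rc_apply_closed[OF Qset_apply_closed] by simp_all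
  have "contract \<alpha> \<beta> (p \<alpha> \<oplus>\<^bsub>Rc \<alpha>\<^esub> q \<alpha>) c =
      contract \<alpha> \<beta> (p \<alpha>) c \<oplus>\<^bsub>Cinv \<beta>\<^esub> contract \<alpha> \<beta> (q \<alpha>) c"
    using assms deg c by (simp add: contract_form_add Qset_apply_closed)
  also have "\<dots> = (p (\<alpha> \<otimes> \<beta>) c \<oplus>\<^bsub>A\<^esub> q (\<alpha> \<otimes> \<beta>) c) \<triangleright>\<^bsub>Cinv \<beta>\<^esub> xinv \<beta>"
    using assms deg c val by (simp add: contract_Qset C_lsmult_l_distr x_inv_closed)
  finally show "contract \<alpha> \<beta> (p \<alpha> \<oplus>\<^bsub>Rc \<alpha>\<^esub> q \<alpha>) c =
      (p (\<alpha> \<otimes> \<beta>) \<oplus>\<^bsub>Rc (\<alpha> \<otimes> \<beta>)\<^esub> q (\<alpha> \<otimes> \<beta>)) c \<triangleright>\<^bsub>Cinv \<beta>\<^esub> xinv \<beta>"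
    using c by (simp add: Rc_add)
qed (use assms in \<open>simp add: Rc_add_closed Qset_apply_closed\<close>)

lemma Qset_rsmult:
  assumes q: "q \<in> Qset" and b: "b \<in> Sset"
  shows "(\<lambda>\<gamma>\<in>carrier G. q \<gamma> \<triangleleft>\<^bsub>Rc \<gamma>\<^esub> b \<gamma>) \<in> Qset"
proof (rule Qset_memI)
  fix \<alpha> \<beta> c
  assume deg: "\<alpha> \<in> carrier G" "\<beta> \<in> carrier G" and c: "c \<in> carrier (Cinv (\<alpha> \<otimes> \<beta>))"
  have val: "q (\<alpha> \<otimes> \<beta>) c \<in> carrier A" "b \<alpha> \<in> carrier A" "b (\<alpha> \<otimes> \<beta>) \<in> carrier A"
    using q b deg c Rc_apply_closed[OF Qset_apply_closed] by (simp_all add: Sset_apply_closed)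
  have "contract \<alpha> \<beta> (q \<alpha> \<triangleleft>\<^bsub>Rc \<alpha>\<^esub> b \<alpha>) c = contract \<alpha> \<beta> (q \<alpha>) c \<triangleleft>\<^bsub>Cinv \<beta>\<^esub> b \<alpha>"
    using q b deg c by (simp add: contract_form_rsmult Qset_apply_closed Sset_apply_closed)
  also have "\<dots> = q (\<alpha> \<otimes> \<beta>) c \<triangleright>\<^bsub>Cinv \<beta>\<^esub> (xinv \<beta> \<triangleleft>\<^bsub>Cinv \<beta>\<^esub> b \<alpha>)"
    using q deg c val by (simp add: contract_Qset C_smult_commute x_inv_closed)
  also have "\<dots> = (q (\<alpha> \<otimes> \<beta>) c \<otimes>\<^bsub>A\<^esub> b (\<alpha> \<otimes> \<beta>)) \<triangleright>\<^bsub>Cinv \<beta>\<^esub> xinv \<beta>"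
    using b deg val by (simp add: Sset_shift C_lsmult_assoc x_inv_closed)
  finally show "contract \<alpha> \<beta> (q \<alpha> \<triangleleft>\<^bsub>Rc \<alpha>\<^esub> b \<alpha>) c =
      (q (\<alpha> \<otimes> \<beta>) \<triangleleft>\<^bsub>Rc (\<alpha> \<otimes> \<beta>)\<^esub> b (\<alpha> \<otimes> \<beta>)) c \<triangleright>\<^bsub>Cinv \<beta>\<^esub> xinv \<beta>"
    using c by (simp add: Rc_rsmult)
qed (use assms in \<open>simp add: Rc_rsmult_closed Qset_apply_closed Sset_apply_closed\<close>)

lemma Qset_zero: "(\<lambda>\<alpha>\<in>carrier G. \<zero>\<^bsub>Rc \<alpha>\<^esub>) \<in> Qset"
proof (rule Qset_memI)
  fix \<alpha> \<beta> c
  assume deg: "\<alpha> \<in> carrier G" "\<beta> \<in> carrier G" and c: "c \<in> carrier (Cinv (\<alpha> \<otimes> \<beta>))"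
  interpret M: bimodule A A "Cinv \<beta>" using deg(2) by (rule Cmod)
  interpret Ra: abelian_group "Rc \<alpha>" using deg(1) by (rule abelian_group_Rc)
  have z: "contract \<alpha> \<beta> \<zero>\<^bsub>Rc \<alpha>\<^esub> c \<in> carrier (Cinv \<beta>)"
    using deg c by (simp add: contract_closed)
  have "contract \<alpha> \<beta> \<zero>\<^bsub>Rc \<alpha>\<^esub> c =
      contract \<alpha> \<beta> \<zero>\<^bsub>Rc \<alpha>\<^esub> c \<oplus>\<^bsub>Cinv \<beta>\<^esub> contract \<alpha> \<beta> \<zero>\<^bsub>Rc \<alpha>\<^esub> c"
    using contract_form_add[OF deg Ra.zero_closed Ra.zero_closed c] by simp
  then have "contract \<alpha> \<beta> \<zero>\<^bsub>Rc \<alpha>\<^esub> c = \<zero>\<^bsub>Cinv \<beta>\<^esub>" using z by simp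
  then show "contract \<alpha> \<beta> \<zero>\<^bsub>Rc \<alpha>\<^esub> c =
      \<zero>\<^bsub>Rc (\<alpha> \<otimes> \<beta>)\<^esub> c \<triangleright>\<^bsub>Cinv \<beta>\<^esub> xinv \<beta>"
    using c deg by (simp add: Rc_zero[of "\<alpha> \<otimes> \<beta>"] zero_C)
qed (simp add: Rc_zero_closed)

lemma abelian_group_Qmod: "abelian_group (Qmod Qset)"
proof (rule abelian_groupI, goal_cases)
  case (1 p q)
  then show ?case by (simp add: Qset_add)
next
  case 2
  then show ?case by (simp add: Qset_zero)
next
  case (3 p q r)
  then show ?case by (auto simp: Qset_apply_closed abelian_groupE(3)[OF abelian_group_Rc])
next
  case (4 p q)
  then show ?case by (auto simp: Qset_apply_closed abelian_groupE(4)[OF abelian_group_Rc])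
next
  case (5 q)
  then have q: "q \<in> Qset" by simp
  have "\<zero>\<^bsub>Qmod Qset\<^esub> \<oplus>\<^bsub>Qmod Qset\<^esub> q \<in> Qset"
    unfolding Qmod_simps by (rule Qset_add[OF Qset_zero q])
  then show ?case
    by (rule Qset_eqI[OF _ q]) (simp add: q Qset_apply_closed abelian_groupE(5)[OF abelian_group_Rc])
next
  case (6 q)
  let ?m = "\<lambda>\<alpha>\<in>carrier G. \<ominus>\<^bsub>A\<^esub> \<one>\<^bsub>A\<^esub>"
  let ?p = "\<lambda>\<gamma>\<in>carrier G. q \<gamma> \<triangleleft>\<^bsub>Rc \<gamma>\<^esub> ?m \<gamma>"
  have p: "?p \<in> Qset" using 6 by (intro Qset_rsmult Sset_minus_one) simp
  have "(q \<alpha> \<triangleleft>\<^bsub>Rc \<alpha>\<^esub> (\<ominus>\<^bsub>A\<^esub> \<one>\<^bsub>A\<^esub>)) \<oplus>\<^bsub>Rc \<alpha>\<^esub> q \<alpha> = \<zero>\<^bsub>Rc \<alpha>\<^esub>" if "\<alpha> \<in> carrier G" for \<alpha>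
    using 6 that unfolding Rc_add Rc_rsmult Rc_zero
    by (intro restrict_ext) (simp add: Rc_apply_closed[OF Qset_apply_closed] A.r_minus A.l_neg)
  then have eq: "?p \<oplus>\<^bsub>Qmod Qset\<^esub> q = \<zero>\<^bsub>Qmod Qset\<^esub>" by (simp cong: restrict_cong)
  show ?case
    unfolding Qmod_simps(1)
    by (rule bexI[of "\<lambda>p. p \<oplus>\<^bsub>Qmod Qset\<^esub> q = \<zero>\<^bsub>Qmod Qset\<^esub>", OF eq p])
qed

text \<open>Contracting with \<open>f # q\<^sub>\<gamma>\<close> is contracting with \<open>f\<close> and then with \<open>q\<^sub>\<gamma>\<close>, and to the second contraction the
  condition defining \<open>Q\<close> applies.\<close>

lemma Qset_lsmult:
  assumes \<beta>: "\<beta> \<in> carrier G" and f: "f \<in> carrier (Rc \<beta>)" and q: "q \<in> Qset"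
  shows "(\<lambda>\<gamma>\<in>carrier G. conv \<beta> (inv \<beta> \<otimes> \<gamma>) f (q (inv \<beta> \<otimes> \<gamma>))) \<in> Qset"
proof (rule Qset_memI)
  fix \<gamma> assume \<gamma>: "\<gamma> \<in> carrier G"
  have d: "inv \<beta> \<otimes> \<gamma> \<in> carrier G" using \<beta> \<gamma> by simp
  show "conv \<beta> (inv \<beta> \<otimes> \<gamma>) f (q (inv \<beta> \<otimes> \<gamma>)) \<in> carrier (Rc \<gamma>)"
    using conv_closed[OF \<beta> d f Qset_apply_closed[OF q d]] \<beta> \<gamma> by (simp add: cancel_inv)
  fix \<delta> c assume \<delta>: "\<delta> \<in> carrier G" and c: "c \<in> carrier (Cinv (\<gamma> \<otimes> \<delta>))"
  \<comment> \<open>In terms of \<open>\<gamma>'\<close> no inverses occur in the degrees.\<close>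
  define \<gamma>' where "\<gamma>' = inv \<beta> \<otimes> \<gamma>"
  have \<gamma>': "\<gamma>' \<in> carrier G" "\<gamma> = \<beta> \<otimes> \<gamma>'" using \<beta> \<gamma> by (simp_all add: \<gamma>'_def cancel_inv)
  have c': "c \<in> carrier (Cinv (\<beta> \<otimes> \<gamma>' \<otimes> \<delta>))" using c \<gamma>' by simp
  have c'': "c \<in> carrier (Cinv (\<beta> \<otimes> (\<gamma>' \<otimes> \<delta>)))" using c' \<beta> \<gamma>'(1) \<delta> by (simp add: G.m_assoc)
  have k: "contract \<beta> (\<gamma>' \<otimes> \<delta>) f c \<in> carrier (Cinv (\<gamma>' \<otimes> \<delta>))"
    using \<beta> \<gamma>'(1) \<delta> f c'' by (intro contract_closed) simp_all
  have "contract (\<beta> \<otimes> \<gamma>') \<delta> (conv \<beta> \<gamma>' f (q \<gamma>')) c =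
      contract \<gamma>' \<delta> (q \<gamma>') (contract \<beta> (\<gamma>' \<otimes> \<delta>) f c)"
    by (rule contract_conv[OF \<beta> \<gamma>'(1) \<delta> f Qset_apply_closed[OF q \<gamma>'(1)] c'])
  also have "\<dots> = q (\<gamma>' \<otimes> \<delta>) (contract \<beta> (\<gamma>' \<otimes> \<delta>) f c) \<triangleright>\<^bsub>Cinv \<delta>\<^esub> xinv \<delta>"
    by (rule contract_Qset[OF q \<gamma>'(1) \<delta> k])
  also have "q (\<gamma>' \<otimes> \<delta>) (contract \<beta> (\<gamma>' \<otimes> \<delta>) f c) =
      conv \<beta> (\<gamma>' \<otimes> \<delta>) f (q (\<gamma>' \<otimes> \<delta>)) c"
    using \<beta> \<gamma>'(1) \<delta> f q c'' by (simp add: conv_apply Qset_apply_closed)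
  finally show "contract \<gamma> \<delta> (conv \<beta> (inv \<beta> \<otimes> \<gamma>) f (q (inv \<beta> \<otimes> \<gamma>))) c =
      conv \<beta> (inv \<beta> \<otimes> (\<gamma> \<otimes> \<delta>)) f (q (inv \<beta> \<otimes> (\<gamma> \<otimes> \<delta>))) c
        \<triangleright>\<^bsub>Cinv \<delta>\<^esub> xinv \<delta>"
    using \<beta> \<gamma>'(1) \<delta> by (simp add: \<gamma>'(2) G.m_assoc cancel_inv)
qed

text \<open>The condition defining \<open>Q\<close>, evaluated at \<open>x a\<close>, where the contraction is known from \<open>contract_x\<close>, is
  the condition defining \<open>S\<close>.\<close>

lemma omega_val_closed:
  assumes \<sigma>: "\<sigma> \<in> carrier G" and q: "q \<in> Qset" and a: "a \<in> carrier A"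
  shows "omega_val \<sigma> q a \<in> Sset"
  unfolding omega_val_def
proof (rule Sset_memI)
  fix \<alpha> assume \<alpha>: "\<alpha> \<in> carrier G"
  have sa: "\<sigma> \<otimes> \<alpha> \<in> carrier G" using \<sigma> \<alpha> by simp
  show "q (\<sigma> \<otimes> \<alpha>) (xinv (\<sigma> \<otimes> \<alpha>) \<triangleleft>\<^bsub>Cinv (\<sigma> \<otimes> \<alpha>)\<^esub> a) \<in> carrier A"
    by (rule Rc_apply_closed[OF Qset_apply_closed[OF q sa] x_rsmult_closed[OF sa a]])
  fix \<beta> assume \<beta>: "\<beta> \<in> carrier G"
  have sab: "\<sigma> \<otimes> \<alpha> \<otimes> \<beta> \<in> carrier G" using sa \<beta> by simp
  show "q (\<sigma> \<otimes> (\<alpha> \<otimes> \<beta>)) (xinv (\<sigma> \<otimes> (\<alpha> \<otimes> \<beta>)) \<triangleleft>\<^bsub>Cinv (\<sigma> \<otimes> (\<alpha> \<otimes> \<beta>))\<^esub> a)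
        \<triangleright>\<^bsub>Cinv \<beta>\<^esub> xinv \<beta> =
      xinv \<beta> \<triangleleft>\<^bsub>Cinv \<beta>\<^esub>
        q (\<sigma> \<otimes> \<alpha>) (xinv (\<sigma> \<otimes> \<alpha>) \<triangleleft>\<^bsub>Cinv (\<sigma> \<otimes> \<alpha>)\<^esub> a)"
    using contract_Qset[OF q sa \<beta> x_rsmult_closed[OF sab a]]
      contract_x[OF sa \<beta> Qset_apply_closed[OF q sa] a]
    by (simp add: G.m_assoc[OF \<sigma> \<alpha> \<beta>])
qed

lemma omega_val_apply:
  "\<beta> \<in> carrier G \<Longrightarrow> omega_val \<sigma> q a \<beta> =
    q (\<sigma> \<otimes> \<beta>) (xinv (\<sigma> \<otimes> \<beta>) \<triangleleft>\<^bsub>Cinv (\<sigma> \<otimes> \<beta>)\<^esub> a)"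
  by (simp add: omega_val_def)

text \<open>The relation \<open>x b\<^sub>\<alpha> = b\<^sub>\<alpha>\<^sub>\<beta> x\<close> as seen by a left linear form. It makes the action of \<open>S\<close> on \<open>A{G}\<close> commute
  with that of \<open>R\<close>, and the first connecting map left linear.\<close>

lemma apply_x_lsmult:
  assumes "b \<in> Sset" "\<alpha> \<in> carrier G" "\<beta> \<in> carrier G" "f \<in> carrier (Rc \<beta>)" "a \<in> carrier A"
  shows "f (xinv \<beta> \<triangleleft>\<^bsub>Cinv \<beta>\<^esub> (b \<alpha> \<otimes>\<^bsub>A\<^esub> a)) =
    b (\<alpha> \<otimes> \<beta>) \<otimes>\<^bsub>A\<^esub> f (xinv \<beta> \<triangleleft>\<^bsub>Cinv \<beta>\<^esub> a)"
  using assms by (simp add: C_rsmult_assoc x_inv_closed Sset_apply_closed Sset_shift C_smult_commute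
      Rc_apply_lsmult[of f \<beta>] x_rsmult_closed)

text \<open>Here \<open>f(c\<^sub>1 q\<^sub>\<alpha>(c\<^sub>2) a) = f(q\<^sub>\<alpha>\<^sub>\<beta>(c) x a) = q\<^sub>\<alpha>\<^sub>\<beta>(c) f(x a)\<close>. This is what makes the second connecting map right
  linear, and it is also the content of the second Morita identity.\<close>

lemma conv_Qset_rsmult:
  assumes q: "q \<in> Qset" and deg: "\<alpha> \<in> carrier G" "\<beta> \<in> carrier G"
    and a: "a \<in> carrier A" and f: "f \<in> carrier (Rc \<beta>)"
  shows "conv \<alpha> \<beta> (q \<alpha> \<triangleleft>\<^bsub>Rc \<alpha>\<^esub> a) f =
    q (\<alpha> \<otimes> \<beta>) \<triangleleft>\<^bsub>Rc (\<alpha> \<otimes> \<beta>)\<^esub> f (xinv \<beta> \<triangleleft>\<^bsub>Cinv \<beta>\<^esub> a)"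
proof (rule Rc_eqI[of _ "\<alpha> \<otimes> \<beta>"])
  have qa: "q \<alpha> \<in> carrier (Rc \<alpha>)" and qab: "q (\<alpha> \<otimes> \<beta>) \<in> carrier (Rc (\<alpha> \<otimes> \<beta>))"
    using q deg by (simp_all add: Qset_apply_closed)
  have qaa: "q \<alpha> \<triangleleft>\<^bsub>Rc \<alpha>\<^esub> a \<in> carrier (Rc \<alpha>)" using deg a qa by (intro Rc_rsmult_closed)
  have fx: "f (xinv \<beta> \<triangleleft>\<^bsub>Cinv \<beta>\<^esub> a) \<in> carrier A"
    using f deg a by (intro Rc_apply_closed[OF f] x_rsmult_closed)
  show "conv \<alpha> \<beta> (q \<alpha> \<triangleleft>\<^bsub>Rc \<alpha>\<^esub> a) f \<in> carrier (Rc (\<alpha> \<otimes> \<beta>))"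
    using deg qaa f by (intro conv_closed)
  show "q (\<alpha> \<otimes> \<beta>) \<triangleleft>\<^bsub>Rc (\<alpha> \<otimes> \<beta>)\<^esub> f (xinv \<beta> \<triangleleft>\<^bsub>Cinv \<beta>\<^esub> a) \<in> carrier (Rc (\<alpha> \<otimes> \<beta>))"
    using deg qab fx by (intro Rc_rsmult_closed) simp_all
  fix c assume c: "c \<in> carrier (Cinv (\<alpha> \<otimes> \<beta>))"
  have val: "q (\<alpha> \<otimes> \<beta>) c \<in> carrier A" using Rc_apply_closed[OF qab c] .
  have "conv \<alpha> \<beta> (q \<alpha> \<triangleleft>\<^bsub>Rc \<alpha>\<^esub> a) f c =
      f ((q (\<alpha> \<otimes> \<beta>) c \<triangleright>\<^bsub>Cinv \<beta>\<^esub> xinv \<beta>) \<triangleleft>\<^bsub>Cinv \<beta>\<^esub> a)"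
    by (simp only: conv_apply[OF deg qaa f c] contract_form_rsmult[OF deg qa a c] contract_Qset[OF q deg c])
  also have "\<dots> = q (\<alpha> \<otimes> \<beta>) c \<otimes>\<^bsub>A\<^esub> f (xinv \<beta> \<triangleleft>\<^bsub>Cinv \<beta>\<^esub> a)"
    using deg a val
    by (simp add: C_smult_commute x_inv_closed Rc_apply_lsmult[OF f] x_rsmult_closed)
  finally show "conv \<alpha> \<beta> (q \<alpha> \<triangleleft>\<^bsub>Rc \<alpha>\<^esub> a) f c =
      (q (\<alpha> \<otimes> \<beta>) \<triangleleft>\<^bsub>Rc (\<alpha> \<otimes> \<beta>)\<^esub> f (xinv \<beta> \<triangleleft>\<^bsub>Cinv \<beta>\<^esub> a)) c"
    using c by (simp add: Rc_rsmult)
qed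

section \<open>Homogeneous Morita data of a grouplike family\<close>

text \<open>The summands and the homogeneous operations are spelled exactly as in the definitions of \<open>G * S\<close>, \<open>R\<close>,
  \<open>A{G}\<close>, \<open>QG\<close> and the connecting maps, so that the context assembled from them is the given one by
  unfolding. The letters in \<open>assoc_SPQ\<close> and the like name the entries that are multiplied.\<close>

abbreviation "famS \<equiv> \<lambda>_::'g. Sring Sset"
abbreviation "famA \<equiv> \<lambda>_::'g. A"
abbreviation "famQ \<equiv> \<lambda>_::'g. Qmod Qset"

abbreviation "hom_S \<equiv> \<lambda>\<alpha> \<beta> b d. translate b \<beta> \<otimes>\<^bsub>Sring Sset\<^esub> d"
abbreviation "hom_lP \<equiv> \<lambda>\<sigma> \<alpha> b a. b \<alpha> \<otimes>\<^bsub>A\<^esub> a"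
abbreviation "hom_rP \<equiv> \<lambda>\<alpha> \<beta> a f. f (xinv \<beta> \<triangleleft>\<^bsub>Cinv \<beta>\<^esub> a)"
abbreviation "hom_lQ \<equiv> \<lambda>\<beta> \<alpha> f q. \<lambda>\<gamma>\<in>carrier G.
  conv \<beta> (inv \<beta> \<otimes> \<gamma>) f (q (inv \<beta> \<otimes> \<gamma>))"
abbreviation "hom_rQ \<equiv> \<lambda>\<alpha> \<tau> q b. \<lambda>\<gamma>\<in>carrier G.
  q \<gamma> \<triangleleft>\<^bsub>Rc \<gamma>\<^esub> translate b (inv (\<alpha> \<otimes> \<tau>)) \<gamma>"
abbreviation "hom_phi \<equiv> \<lambda>\<alpha> \<sigma> a q. omega_val \<sigma> q a"
abbreviation "hom_psi \<equiv> \<lambda>\<sigma> \<alpha> q a. q (\<sigma> \<otimes> \<alpha>) \<triangleleft>\<^bsub>Rc (\<sigma> \<otimes> \<alpha>)\<^esub> a"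

lemma translate_apply: "\<alpha> \<in> carrier G \<Longrightarrow> translate b \<sigma> \<alpha> = b (\<sigma> \<otimes> \<alpha>)"
  by (simp add: translate_def)

lemma rQ_closed:
  "\<lbrakk>\<alpha> \<in> carrier G; \<tau> \<in> carrier G; q \<in> Qset; b \<in> Sset\<rbrakk> \<Longrightarrow> hom_rQ \<alpha> \<tau> q b \<in> Qset"
  by (intro Qset_rsmult Sset_translate) simp_all

lemma Rc_rsmult_distr:
  "\<lbrakk>f \<in> carrier (Rc \<alpha>); g \<in> carrier (Rc \<alpha>); a \<in> carrier A\<rbrakk> \<Longrightarrow>
    (f \<oplus>\<^bsub>Rc \<alpha>\<^esub> g) \<triangleleft>\<^bsub>Rc \<alpha>\<^esub> a = (f \<triangleleft>\<^bsub>Rc \<alpha>\<^esub> a) \<oplus>\<^bsub>Rc \<alpha>\<^esub> (g \<triangleleft>\<^bsub>Rc \<alpha>\<^esub> a)"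
  "\<lbrakk>f \<in> carrier (Rc \<alpha>); a \<in> carrier A; b \<in> carrier A\<rbrakk> \<Longrightarrow>
    f \<triangleleft>\<^bsub>Rc \<alpha>\<^esub> (a \<oplus>\<^bsub>A\<^esub> b) = (f \<triangleleft>\<^bsub>Rc \<alpha>\<^esub> a) \<oplus>\<^bsub>Rc \<alpha>\<^esub> (f \<triangleleft>\<^bsub>Rc \<alpha>\<^esub> b)"
  by (auto simp: Rc_rsmult Rc_add A.l_distr A.r_distr Rc_apply_closed)

lemma Rc_rsmult_assoc:
  assumes "f \<in> carrier (Rc \<alpha>)" "a \<in> carrier A" "b \<in> carrier A"
  shows "f \<triangleleft>\<^bsub>Rc \<alpha>\<^esub> a \<triangleleft>\<^bsub>Rc \<alpha>\<^esub> b = f \<triangleleft>\<^bsub>Rc \<alpha>\<^esub> (a \<otimes>\<^bsub>A\<^esub> b)"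
  unfolding Rc_rsmult
  by (rule restrict_ext) (use assms in \<open>simp add: A.m_assoc Rc_apply_closed[OF assms(1)]\<close>)

lemma pairing_S: "graded_pairing G famS famS famS hom_S"
proof (rule graded_pairingI)
  fix \<alpha> \<beta> b b' d d'
  assume deg: "\<alpha> \<in> carrier G" "\<beta> \<in> carrier G"
    and "b \<in> carrier (Sring Sset)" "d \<in> carrier (Sring Sset)"
  then have bd: "b \<in> Sset" "d \<in> Sset" by simp_all
  show "hom_S \<alpha> \<beta> b d \<in> carrier (Sring Sset)"
    unfolding Sring_simps using deg bd by (intro Sset_mult Sset_translate)
  show "hom_S \<alpha> \<beta> (b \<oplus>\<^bsub>Sring Sset\<^esub> b') d = hom_S \<alpha> \<beta> b d \<oplus>\<^bsub>Sring Sset\<^esub> hom_S \<alpha> \<beta> b' d"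
    if "b' \<in> carrier (Sring Sset)"
    unfolding Sring_simps
    by (rule restrict_ext) (use deg bd that in \<open>simp add: translate_def Sset_apply_closed A.l_distr\<close>)
  show "hom_S \<alpha> \<beta> b (d \<oplus>\<^bsub>Sring Sset\<^esub> d') = hom_S \<alpha> \<beta> b d \<oplus>\<^bsub>Sring Sset\<^esub> hom_S \<alpha> \<beta> b d'"
    if "d' \<in> carrier (Sring Sset)"
    unfolding Sring_simps
    by (rule restrict_ext) (use deg bd that in \<open>simp add: translate_def Sset_apply_closed A.r_distr\<close>)
qed

lemma pairing_lP: "graded_pairing G famS famA famA hom_lP"
  by (rule graded_pairingI) (simp_all add: Sset_apply_closed A.l_distr A.r_distr)

lemma pairing_R: "graded_pairing G Rc Rc Rc conv"
  by (rule graded_pairingI) (simp_all add: conv_closed conv_add_left conv_add_right)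

lemma pairing_rP: "graded_pairing G famA Rc famA hom_rP"
proof (rule graded_pairingI)
  fix \<alpha> \<beta> a a' f f'
  assume deg: "\<alpha> \<in> carrier G" "\<beta> \<in> carrier G" and a: "a \<in> carrier A" and f: "f \<in> carrier (Rc \<beta>)"
  show "hom_rP \<alpha> \<beta> a f \<in> carrier A" using Rc_apply_closed[OF f x_rsmult_closed[OF deg(2) a]] .
  show "hom_rP \<alpha> \<beta> (a \<oplus>\<^bsub>A\<^esub> a') f = hom_rP \<alpha> \<beta> a f \<oplus>\<^bsub>A\<^esub> hom_rP \<alpha> \<beta> a' f" if "a' \<in> carrier A"
    using deg a that
    by (simp add: C_rsmult_r_distr x_inv_closed Rc_apply_add[OF f] x_rsmult_closed)
  show "hom_rP \<alpha> \<beta> a (f \<oplus>\<^bsub>Rc \<beta>\<^esub> f') = hom_rP \<alpha> \<beta> a f \<oplus>\<^bsub>A\<^esub> hom_rP \<alpha> \<beta> a f'"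
    using deg a by (simp add: Rc_add x_rsmult_closed)
qed

lemma pairing_lQ: "graded_pairing G Rc famQ famQ hom_lQ"
proof (rule graded_pairingI)
  fix \<beta> \<alpha> f f' q q'
  assume deg: "\<beta> \<in> carrier G" "\<alpha> \<in> carrier G" and f: "f \<in> carrier (Rc \<beta>)"
    and "q \<in> carrier (Qmod Qset)"
  then have q: "q \<in> Qset" by simp
  have d: "inv \<beta> \<otimes> \<gamma> \<in> carrier G" if "\<gamma> \<in> carrier G" for \<gamma> using deg that by simp
  show "hom_lQ \<beta> \<alpha> f q \<in> carrier (Qmod Qset)"
    unfolding Qmod_simps by (rule Qset_lsmult[OF deg(1) f q])
  show "hom_lQ \<beta> \<alpha> (f \<oplus>\<^bsub>Rc \<beta>\<^esub> f') q = hom_lQ \<beta> \<alpha> f q \<oplus>\<^bsub>Qmod Qset\<^esub> hom_lQ \<beta> \<alpha> f' q"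
    if "f' \<in> carrier (Rc \<beta>)"
    unfolding Qmod_simps
    by (rule restrict_ext)
      (use deg f q that in \<open>simp add: conv_add_left Qset_apply_closed cancel_inv\<close>)
  show "hom_lQ \<beta> \<alpha> f (q \<oplus>\<^bsub>Qmod Qset\<^esub> q') = hom_lQ \<beta> \<alpha> f q \<oplus>\<^bsub>Qmod Qset\<^esub> hom_lQ \<beta> \<alpha> f q'"
    if "q' \<in> carrier (Qmod Qset)"
    unfolding Qmod_simps
    by (rule restrict_ext)
      (use deg f q that in \<open>simp add: conv_add_right Qset_apply_closed cancel_inv\<close>)
qed

lemma pairing_rQ: "graded_pairing G famQ famS famQ hom_rQ"
proof (rule graded_pairingI)
  fix \<alpha> \<tau> q q' b b'
  assume deg: "\<alpha> \<in> carrier G" "\<tau> \<in> carrier G"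
    and "q \<in> carrier (Qmod Qset)" "b \<in> carrier (Sring Sset)"
  then have qb: "q \<in> Qset" "b \<in> Sset" by simp_all
  show "hom_rQ \<alpha> \<tau> q b \<in> carrier (Qmod Qset)"
    unfolding Qmod_simps by (rule rQ_closed[OF deg qb])
  show "hom_rQ \<alpha> \<tau> (q \<oplus>\<^bsub>Qmod Qset\<^esub> q') b = hom_rQ \<alpha> \<tau> q b \<oplus>\<^bsub>Qmod Qset\<^esub> hom_rQ \<alpha> \<tau> q' b"
    if "q' \<in> carrier (Qmod Qset)"
    unfolding Qmod_simps
    by (rule restrict_ext) (use deg qb that in \<open>simp add: translate_apply Rc_rsmult_distr
        Qset_apply_closed Sset_apply_closed\<close>)
  show "hom_rQ \<alpha> \<tau> q (b \<oplus>\<^bsub>Sring Sset\<^esub> b') = hom_rQ \<alpha> \<tau> q b \<oplus>\<^bsub>Qmod Qset\<^esub> hom_rQ \<alpha> \<tau> q b'"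
    if "b' \<in> carrier (Sring Sset)"
    unfolding Qmod_simps
    by (rule restrict_ext) (use deg qb that in \<open>simp add: translate_apply Rc_rsmult_distr
        Qset_apply_closed Sset_apply_closed\<close>)
qed

lemma pairing_phi: "graded_pairing G famA famQ famS hom_phi"
proof (rule graded_pairingI)
  fix \<alpha> \<sigma> a a' q q'
  assume deg: "\<alpha> \<in> carrier G" "\<sigma> \<in> carrier G" and a: "a \<in> carrier A"
    and "q \<in> carrier (Qmod Qset)"
  then have q: "q \<in> Qset" by simp
  show "hom_phi \<alpha> \<sigma> a q \<in> carrier (Sring Sset)"
    unfolding Sring_simps by (rule omega_val_closed[OF deg(2) q a])
  show "hom_phi \<alpha> \<sigma> (a \<oplus>\<^bsub>A\<^esub> a') q = hom_phi \<alpha> \<sigma> a q \<oplus>\<^bsub>Sring Sset\<^esub> hom_phi \<alpha> \<sigma> a' q"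
    if "a' \<in> carrier A"
    unfolding Sring_simps omega_val_def
    by (rule restrict_ext) (use deg a q that in \<open>simp add: C_rsmult_r_distr x_inv_closed
        Rc_apply_add[OF Qset_apply_closed] x_rsmult_closed\<close>)
  show "hom_phi \<alpha> \<sigma> a (q \<oplus>\<^bsub>Qmod Qset\<^esub> q') = hom_phi \<alpha> \<sigma> a q \<oplus>\<^bsub>Sring Sset\<^esub> hom_phi \<alpha> \<sigma> a q'"
    unfolding Sring_simps omega_val_def
    by (rule restrict_ext) (use deg a in \<open>simp add: Rc_add x_rsmult_closed\<close>)
qed

lemma pairing_psi: "graded_pairing G famQ famA Rc hom_psi"
proof (rule graded_pairingI)
  fix \<sigma> \<alpha> q q' a a'
  assume deg: "\<sigma> \<in> carrier G" "\<alpha> \<in> carrier G" and a: "a \<in> carrier A"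
    and "q \<in> carrier (Qmod Qset)"
  then have q: "q \<in> Qset" by simp
  have qs: "q (\<sigma> \<otimes> \<alpha>) \<in> carrier (Rc (\<sigma> \<otimes> \<alpha>))" using q deg by (simp add: Qset_apply_closed)
  show "hom_psi \<sigma> \<alpha> q a \<in> carrier (Rc (\<sigma> \<otimes> \<alpha>))"
    using deg qs a by (intro Rc_rsmult_closed) simp_all
  show "hom_psi \<sigma> \<alpha> (q \<oplus>\<^bsub>Qmod Qset\<^esub> q') a =
      hom_psi \<sigma> \<alpha> q a \<oplus>\<^bsub>Rc (\<sigma> \<otimes> \<alpha>)\<^esub> hom_psi \<sigma> \<alpha> q' a" if "q' \<in> carrier (Qmod Qset)"
    using deg qs a that by (simp add: Rc_rsmult_distr Qset_apply_closed)
  show "hom_psi \<sigma> \<alpha> q (a \<oplus>\<^bsub>A\<^esub> a') =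
      hom_psi \<sigma> \<alpha> q a \<oplus>\<^bsub>Rc (\<sigma> \<otimes> \<alpha>)\<^esub> hom_psi \<sigma> \<alpha> q a'" if "a' \<in> carrier A"
    using qs a that by (rule Rc_rsmult_distr(2))
qed

lemma assoc_SSS:
  "graded_associative G famS famS famS hom_S hom_S hom_S hom_S"
proof (rule graded_associativeI, unfold Sring_simps)
  fix \<alpha> \<beta> \<gamma> b d e
  assume "\<alpha> \<in> carrier G" "\<beta> \<in> carrier G" "\<gamma> \<in> carrier G" "b \<in> Sset" "d \<in> Sset" "e \<in> Sset"
  then show "(\<lambda>\<delta>\<in>carrier G. translate (\<lambda>\<delta>\<in>carrier G. translate b \<beta> \<delta> \<otimes>\<^bsub>A\<^esub> d \<delta>) \<gamma> \<delta> \<otimes>\<^bsub>A\<^esub> e \<delta>) =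
      (\<lambda>\<delta>\<in>carrier G. translate b (\<beta> \<otimes> \<gamma>) \<delta> \<otimes>\<^bsub>A\<^esub>
        (\<lambda>\<delta>\<in>carrier G. translate d \<gamma> \<delta> \<otimes>\<^bsub>A\<^esub> e \<delta>) \<delta>)"
    by (intro restrict_ext) (simp add: translate_apply Sset_apply_closed A.m_assoc G.m_assoc)
qed

lemma assoc_SSP:
  "graded_associative G famS famS famA hom_S hom_lP hom_lP hom_lP"
  by (rule graded_associativeI)
    (simp add: translate_apply Sset_apply_closed A.m_assoc)

lemma assoc_SPR:
  "graded_associative G famS famA Rc hom_lP hom_rP hom_rP hom_lP"
  by (rule graded_associativeI) (simp add: apply_x_lsmult)

lemma assoc_PRR: "graded_associative G famA Rc Rc hom_rP hom_rP conv hom_rP"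
  by (rule graded_associativeI) (simp add: conv_apply x_rsmult_closed contract_x)

lemma assoc_SPQ:
  "graded_associative G famS famA famQ hom_lP hom_phi hom_phi hom_S"
proof (rule graded_associativeI, unfold Sring_simps Qmod_simps)
  fix \<sigma> \<alpha> \<tau> b a q
  assume H: "\<sigma> \<in> carrier G" "\<alpha> \<in> carrier G" "\<tau> \<in> carrier G" "b \<in> Sset" "a \<in> carrier A" "q \<in> Qset"
  show "omega_val \<tau> q (b \<alpha> \<otimes>\<^bsub>A\<^esub> a) =
      (\<lambda>\<delta>\<in>carrier G. translate b (\<alpha> \<otimes> \<tau>) \<delta> \<otimes>\<^bsub>A\<^esub> omega_val \<tau> q a \<delta>)"
    unfolding omega_val_def
    by (rule restrict_ext)
      (use H in \<open>simp add: apply_x_lsmult Qset_apply_closed translate_apply G.m_assoc\<close>)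
qed

lemma assoc_PRQ:
  "graded_associative G famA Rc famQ hom_rP hom_phi hom_lQ hom_phi"
proof (rule graded_associativeI, unfold Qmod_simps)
  fix \<alpha> \<beta> \<sigma> a f q
  assume H: "\<alpha> \<in> carrier G" "\<beta> \<in> carrier G" "\<sigma> \<in> carrier G" "a \<in> carrier A"
    "f \<in> carrier (Rc \<beta>)" "q \<in> Qset"
  show "omega_val \<sigma> q (hom_rP \<alpha> \<beta> a f) = omega_val (\<beta> \<otimes> \<sigma>) (hom_lQ \<beta> \<sigma> f q) a"
    unfolding omega_val_def
  proof (rule restrict_ext)
    fix \<delta> assume \<delta>: "\<delta> \<in> carrier G"
    define \<tau> where "\<tau> = \<sigma> \<otimes> \<delta>"
    have \<tau>: "\<tau> \<in> carrier G" using H \<delta> by (simp add: \<tau>_def)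
    have eqs: "\<beta> \<otimes> \<sigma> \<otimes> \<delta> = \<beta> \<otimes> \<tau>" using H \<delta> by (simp add: \<tau>_def G.m_assoc)
    show "q (\<sigma> \<otimes> \<delta>) (xinv (\<sigma> \<otimes> \<delta>) \<triangleleft>\<^bsub>Cinv (\<sigma> \<otimes> \<delta>)\<^esub> hom_rP \<alpha> \<beta> a f) =
      hom_lQ \<beta> \<sigma> f q (\<beta> \<otimes> \<sigma> \<otimes> \<delta>)
        (xinv (\<beta> \<otimes> \<sigma> \<otimes> \<delta>) \<triangleleft>\<^bsub>Cinv (\<beta> \<otimes> \<sigma> \<otimes> \<delta>)\<^esub> a)"
      unfolding eqs unfolding \<tau>_def[symmetric] using H \<tau>
      by (simp add: cancel_inv conv_apply Qset_apply_closed x_rsmult_closed contract_x)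
  qed
qed

lemma assoc_PQS:
  "graded_associative G famA famQ famS hom_phi hom_S hom_rQ hom_phi"
proof (rule graded_associativeI, unfold Sring_simps Qmod_simps)
  fix \<alpha> \<sigma> \<tau> a q b
  assume H: "\<alpha> \<in> carrier G" "\<sigma> \<in> carrier G" "\<tau> \<in> carrier G" "a \<in> carrier A" "q \<in> Qset" "b \<in> Sset"
  show "(\<lambda>\<delta>\<in>carrier G. translate (omega_val \<sigma> q a) \<tau> \<delta> \<otimes>\<^bsub>A\<^esub> b \<delta>) =
      omega_val (\<sigma> \<otimes> \<tau>) (hom_rQ \<sigma> \<tau> q b) a"
    unfolding omega_val_def[of "\<sigma> \<otimes> \<tau>"]
  proof (rule restrict_ext)
    fix \<delta> assume \<delta>: "\<delta> \<in> carrier G"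
    have d: "\<sigma> \<otimes> \<tau> \<otimes> \<delta> \<in> carrier G" "\<sigma> \<otimes> \<tau> \<in> carrier G" using H \<delta> by simp_all
    have "hom_rQ \<sigma> \<tau> q b (\<sigma> \<otimes> \<tau> \<otimes> \<delta>)
        (xinv (\<sigma> \<otimes> \<tau> \<otimes> \<delta>) \<triangleleft>\<^bsub>Cinv (\<sigma> \<otimes> \<tau> \<otimes> \<delta>)\<^esub> a) =
      q (\<sigma> \<otimes> \<tau> \<otimes> \<delta>) (xinv (\<sigma> \<otimes> \<tau> \<otimes> \<delta>) \<triangleleft>\<^bsub>Cinv (\<sigma> \<otimes> \<tau> \<otimes> \<delta>)\<^esub> a) \<otimes>\<^bsub>A\<^esub> b \<delta>"
      using d \<delta> x_rsmult_closed[OF d(1) H(4)] by (simp add: Rc_rsmult translate_apply cancel_inv del: G.m_assoc)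
    then show "translate (omega_val \<sigma> q a) \<tau> \<delta> \<otimes>\<^bsub>A\<^esub> b \<delta> =
      hom_rQ \<sigma> \<tau> q b (\<sigma> \<otimes> \<tau> \<otimes> \<delta>)
        (xinv (\<sigma> \<otimes> \<tau> \<otimes> \<delta>) \<triangleleft>\<^bsub>Cinv (\<sigma> \<otimes> \<tau> \<otimes> \<delta>)\<^esub> a)"
      using H \<delta> by (simp add: translate_apply omega_val_apply G.m_assoc)
  qed
qed

lemma assoc_PQP:
  "graded_associative G famA famQ famA hom_phi hom_lP hom_psi hom_rP"
  by (rule graded_associativeI) (simp add: omega_val_apply Rc_rsmult x_rsmult_closed)

lemma assoc_RRR: "graded_associative G Rc Rc Rc conv conv conv conv"
  by (rule graded_associativeI) (rule conv_assoc)

lemma assoc_RRQ: "graded_associative G Rc Rc famQ conv hom_lQ hom_lQ hom_lQ"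
proof (rule graded_associativeI, unfold Qmod_simps)
  fix \<alpha> \<beta> \<gamma> f g q
  assume H: "\<alpha> \<in> carrier G" "\<beta> \<in> carrier G" "\<gamma> \<in> carrier G" "f \<in> carrier (Rc \<alpha>)"
    "g \<in> carrier (Rc \<beta>)" "q \<in> Qset"
  show "hom_lQ (\<alpha> \<otimes> \<beta>) \<gamma> (conv \<alpha> \<beta> f g) q = hom_lQ \<alpha> (\<beta> \<otimes> \<gamma>) f (hom_lQ \<beta> \<gamma> g q)"
  proof (rule restrict_ext)
    fix \<delta> assume \<delta>: "\<delta> \<in> carrier G"
    define \<tau> where "\<tau> = inv (\<alpha> \<otimes> \<beta>) \<otimes> \<delta>"
    have \<tau>: "\<tau> \<in> carrier G" "inv \<alpha> \<otimes> \<delta> = \<beta> \<otimes> \<tau>"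
      using H \<delta> by (simp_all add: \<tau>_def degree_simps)
    show "conv (\<alpha> \<otimes> \<beta>) (inv (\<alpha> \<otimes> \<beta>) \<otimes> \<delta>) (conv \<alpha> \<beta> f g) (q (inv (\<alpha> \<otimes> \<beta>) \<otimes> \<delta>)) =
      conv \<alpha> (inv \<alpha> \<otimes> \<delta>) f (hom_lQ \<beta> \<gamma> g q (inv \<alpha> \<otimes> \<delta>))"
      unfolding \<tau>(2) unfolding \<tau>_def[symmetric]
      using H \<tau>(1) by (simp add: cancel_inv conv_assoc Qset_apply_closed)
  qed
qed

lemma assoc_RQS:
  "graded_associative G Rc famQ famS hom_lQ hom_rQ hom_rQ hom_lQ"
proof (rule graded_associativeI, unfold Qmod_simps Sring_simps)
  fix \<beta> \<alpha> \<tau> f q b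
  assume H: "\<beta> \<in> carrier G" "\<alpha> \<in> carrier G" "\<tau> \<in> carrier G" "f \<in> carrier (Rc \<beta>)"
    "q \<in> Qset" "b \<in> Sset"
  show "hom_rQ (\<beta> \<otimes> \<alpha>) \<tau> (hom_lQ \<beta> \<alpha> f q) b = hom_lQ \<beta> (\<alpha> \<otimes> \<tau>) f (hom_rQ \<alpha> \<tau> q b)"
  proof (rule restrict_ext)
    fix \<gamma> assume \<gamma>: "\<gamma> \<in> carrier G"
    define \<delta> where "\<delta> = inv \<beta> \<otimes> \<gamma>"
    have \<delta>: "\<delta> \<in> carrier G" "\<gamma> = \<beta> \<otimes> \<delta>" using H \<gamma> by (simp_all add: \<delta>_def cancel_inv)
    have e: "inv (\<beta> \<otimes> \<alpha> \<otimes> \<tau>) \<otimes> (\<beta> \<otimes> \<delta>) = inv (\<alpha> \<otimes> \<tau>) \<otimes> \<delta>"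
      using H \<delta>(1) by (simp add: degree_simps)
    have "hom_lQ \<beta> \<alpha> f q (\<beta> \<otimes> \<delta>) = conv \<beta> \<delta> f (q \<delta>)"
      using H \<delta>(1) by (simp add: cancel_inv)
    moreover have "translate b (inv (\<beta> \<otimes> \<alpha> \<otimes> \<tau>)) (\<beta> \<otimes> \<delta>) = b (inv (\<alpha> \<otimes> \<tau>) \<otimes> \<delta>)"
      using H \<delta>(1) e by (simp add: translate_apply)
    moreover have "hom_rQ \<alpha> \<tau> q b \<delta> = q \<delta> \<triangleleft>\<^bsub>Rc \<delta>\<^esub> b (inv (\<alpha> \<otimes> \<tau>) \<otimes> \<delta>)"
      using H \<delta>(1) by (simp add: translate_apply)
    moreover have "conv \<beta> \<delta> f (q \<delta> \<triangleleft>\<^bsub>Rc \<delta>\<^esub> b (inv (\<alpha> \<otimes> \<tau>) \<otimes> \<delta>)) =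
        conv \<beta> \<delta> f (q \<delta>) \<triangleleft>\<^bsub>Rc (\<beta> \<otimes> \<delta>)\<^esub> b (inv (\<alpha> \<otimes> \<tau>) \<otimes> \<delta>)"
      using H \<delta>(1) by (intro conv_rsmult) (simp_all add: Qset_apply_closed Sset_apply_closed)
    moreover have "inv \<beta> \<otimes> (\<beta> \<otimes> \<delta>) = \<delta>" using H \<delta>(1) by (simp add: cancel_inv)
    ultimately show "hom_lQ \<beta> \<alpha> f q \<gamma> \<triangleleft>\<^bsub>Rc \<gamma>\<^esub> translate b (inv (\<beta> \<otimes> \<alpha> \<otimes> \<tau>)) \<gamma> =
      conv \<beta> (inv \<beta> \<otimes> \<gamma>) f (hom_rQ \<alpha> \<tau> q b (inv \<beta> \<otimes> \<gamma>))"
      unfolding \<delta>(2) by (simp only:)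
  qed
qed

lemma assoc_QSS:
  "graded_associative G famQ famS famS hom_rQ hom_rQ hom_S hom_rQ"
proof (rule graded_associativeI, unfold Qmod_simps)
  fix \<alpha> \<sigma> \<tau> q b d
  assume H: "\<alpha> \<in> carrier G" "\<sigma> \<in> carrier G" "\<tau> \<in> carrier G" "q \<in> Qset"
    "b \<in> carrier (Sring Sset)" "d \<in> carrier (Sring Sset)"
  show "hom_rQ (\<alpha> \<otimes> \<sigma>) \<tau> (hom_rQ \<alpha> \<sigma> q b) d = hom_rQ \<alpha> (\<sigma> \<otimes> \<tau>) q (hom_S \<sigma> \<tau> b d)"
    by (rule restrict_ext)
      (use H in \<open>simp add: translate_apply degree_simps Rc_rsmult_assoc Qset_apply_closed Sset_apply_closed\<close>)
qed

lemma assoc_RQP: "graded_associative G Rc famQ famA hom_lQ hom_psi hom_psi conv"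
  by (rule graded_associativeI)
    (simp add: cancel_inv G.m_assoc conv_rsmult Qset_apply_closed)

lemma assoc_QSP:
  "graded_associative G famQ famS famA hom_rQ hom_psi hom_lP hom_psi"
  by (rule graded_associativeI)
    (simp add: translate_apply degree_simps Rc_rsmult_assoc Qset_apply_closed Sset_apply_closed)

lemma assoc_QPR: "graded_associative G famQ famA Rc hom_psi conv hom_rP hom_psi"
  by (rule graded_associativeI) (simp add: conv_Qset_rsmult G.m_assoc)

lemma assoc_QPQ:
  "graded_associative G famQ famA famQ hom_psi hom_lQ hom_phi hom_rQ"
proof (rule graded_associativeI, unfold Qmod_simps)
  fix \<sigma> \<alpha> \<tau> q a q'
  assume H: "\<sigma> \<in> carrier G" "\<alpha> \<in> carrier G" "\<tau> \<in> carrier G" "q \<in> Qset" "a \<in> carrier A" "q' \<in> Qset"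
  show "hom_lQ (\<sigma> \<otimes> \<alpha>) \<tau> (hom_psi \<sigma> \<alpha> q a) q' = hom_rQ \<sigma> (\<alpha> \<otimes> \<tau>) q (omega_val \<tau> q' a)"
  proof (rule restrict_ext)
    fix \<gamma> assume \<gamma>: "\<gamma> \<in> carrier G"
    define \<delta> where "\<delta> = inv (\<sigma> \<otimes> \<alpha>) \<otimes> \<gamma>"
    have sa: "\<sigma> \<otimes> \<alpha> \<in> carrier G" using H by simp
    have \<delta>: "\<delta> \<in> carrier G" "\<gamma> = \<sigma> \<otimes> \<alpha> \<otimes> \<delta>" using sa \<gamma> by (simp_all add: \<delta>_def cancel_inv(2)[OF sa])
    \<comment> \<open>The shift in the right action of \<open>u\<^sub>\<alpha>\<^sub>\<tau>\<close> on \<open>\<omega>\<^sub>\<sigma>(q)\<close> undoes the total degree, which leaves \<open>\<tau>\<close> times it equal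
      to the degree left over by \<open>q\<^sub>\<sigma>\<^sub>\<alpha> a\<close>.\<close>
    have e: "\<tau> \<otimes> (inv (\<sigma> \<otimes> (\<alpha> \<otimes> \<tau>)) \<otimes> \<gamma>) = \<delta>"
      using H \<gamma> by (simp add: \<delta>_def degree_simps)
    have v: "translate (omega_val \<tau> q' a) (inv (\<sigma> \<otimes> (\<alpha> \<otimes> \<tau>))) \<gamma> =
        q' \<delta> (xinv \<delta> \<triangleleft>\<^bsub>Cinv \<delta>\<^esub> a)"
      unfolding translate_apply[OF \<gamma>] using H \<gamma> by (subst omega_val_apply) (simp_all only: e, simp)
    show "conv (\<sigma> \<otimes> \<alpha>) (inv (\<sigma> \<otimes> \<alpha>) \<otimes> \<gamma>) (hom_psi \<sigma> \<alpha> q a)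
        (q' (inv (\<sigma> \<otimes> \<alpha>) \<otimes> \<gamma>)) =
      q \<gamma> \<triangleleft>\<^bsub>Rc \<gamma>\<^esub> translate (omega_val \<tau> q' a) (inv (\<sigma> \<otimes> (\<alpha> \<otimes> \<tau>))) \<gamma>"
      unfolding v unfolding \<delta>_def[symmetric]
      using conv_Qset_rsmult[OF H(4) sa \<delta>(1) H(5) Qset_apply_closed[OF H(6) \<delta>(1)]]
      by (simp only: \<delta>(2)[symmetric])
  qed
qed

lemma homogeneous_morita:
  "homogeneous_morita G famS Rc famA famQ
    hom_S conv hom_lP hom_rP hom_lQ hom_rQ hom_phi hom_psi \<one>\<^bsub>Sring Sset\<^esub> unit_R"
proof (intro homogeneous_morita.intro homogeneous_morita_axioms.intro G.group_axioms
    abelian_group_Sring abelian_group_Rc A.abelian_group_axioms abelian_group_Qmod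
    pairing_S pairing_R pairing_lP pairing_rP pairing_lQ pairing_rQ pairing_phi pairing_psi
    assoc_SSS assoc_SSP assoc_SPR assoc_PRR assoc_SPQ assoc_PRQ assoc_PQS assoc_PQP
    assoc_RRR assoc_RRQ assoc_RQS assoc_QSS assoc_RQP assoc_QSP assoc_QPR assoc_QPQ
    unit_R_closed conv_unit_left conv_unit_right)
  show "\<one>\<^bsub>Sring Sset\<^esub> \<in> carrier (Sring Sset)" by (simp add: Sset_one)
next
  fix \<alpha> assume \<alpha>: "\<alpha> \<in> carrier G"
  have ext: "(\<lambda>\<beta>\<in>carrier G. s \<beta>) = s" if "s \<in> Sset" for s
    using that by (auto simp: Sset_mem PiE_def intro: extensional_restrict)
  show "hom_S \<one> \<alpha> \<one>\<^bsub>Sring Sset\<^esub> s = s" if "s \<in> carrier (Sring Sset)" for s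
    using that \<alpha> ext[of s] by (simp add: translate_apply Sset_apply_closed cong: restrict_cong)
  show "hom_S \<alpha> \<one> s \<one>\<^bsub>Sring Sset\<^esub> = s" if "s \<in> carrier (Sring Sset)" for s
    using that \<alpha> ext[of s] by (simp add: translate_apply Sset_apply_closed cong: restrict_cong)
  show "hom_lP \<one> \<alpha> \<one>\<^bsub>Sring Sset\<^esub> p = p" if "p \<in> carrier A" for p
    using that \<alpha> by simp
  show "hom_rP \<alpha> \<one> p unit_R = p" if p: "p \<in> carrier A" for p
    using p x_rsmult_closed[OF G.one_closed p] x_closed[of "\<one>"]
    by (simp add: unit_R_def eps_rsmult eps_x)
  have extQ: "(\<lambda>\<gamma>\<in>carrier G. q \<gamma>) = q" if "q \<in> Qset" for q
    using that by (auto simp: Qset_def PiE_def intro: extensional_restrict)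
  show "hom_lQ \<one> \<alpha> unit_R q = q" if "q \<in> carrier (Qmod Qset)" for q
    using that extQ[of q] by (simp add: conv_unit_left Qset_apply_closed cong: restrict_cong)
  have one: "f \<triangleleft>\<^bsub>Rc \<gamma>\<^esub> \<one>\<^bsub>A\<^esub> = f" if "f \<in> carrier (Rc \<gamma>)" "\<gamma> \<in> carrier G" for f \<gamma>
    using that by (intro Rc_eqI[of _ \<gamma>]) (simp_all add: Rc_rsmult_closed, simp add: Rc_rsmult Rc_apply_closed)
  show "hom_rQ \<alpha> \<one> q \<one>\<^bsub>Sring Sset\<^esub> = q" if "q \<in> carrier (Qmod Qset)" for q
    using that \<alpha> extQ[of q] by (simp add: translate_apply one Qset_apply_closed cong: restrict_cong)
qed

sublocale morita: homogeneous_morita G famS Rc famA famQ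
    hom_S conv hom_lP hom_rP hom_lQ hom_rQ hom_phi hom_psi "\<one>\<^bsub>Sring Sset\<^esub>" unit_R
  by (rule homogeneous_morita)

lemma morita_components:
  "morita.SS = smash Sset" "morita.RR = dual_ring" "morita.PP = AG Sset" "morita.QQ = QG Qset"
  "morita.phi = omega_map Sset Qset" "morita.psi = nu_map Sset Qset"
  unfolding smash_def dual_ring_def AG_def QG_def omega_map_def nu_map_def unit_R_def[symmetric]
    morita.phi_def morita.psi_def morita.SS_def morita.RR_def morita.PP_def morita.QQ_def
  by (rule refl)+

theorem graded_morita_context_GM: "graded_morita_context G GM"
  using morita.graded_morita_context
  unfolding morita_components GM_def context_of_def .

theorem connecting_formulas_GM: "connecting_formulas Sset Qset"
  unfolding connecting_formulas_def mu_elt_def om_elt_def u_elt_def R_elt_def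
proof (intro ballI conjI)
  fix \<alpha> \<sigma> a q
  assume H: "\<alpha> \<in> carrier G" "\<sigma> \<in> carrier G" "a \<in> carrier A" and "q \<in> Qset"
  then have q: "q \<in> carrier (Qmod Qset)" by simp
  show "omega_map Sset Qset (pure_tensor dual_ring (AG Sset) (QG Qset)
        (homogeneous G famA \<alpha> a) (homogeneous G famQ \<sigma> q)) =
      homogeneous G famS (\<alpha> \<otimes> \<sigma>) (omega_val \<sigma> q a)"
    by (rule morita.phi_homogeneous[OF H(1,2,3) q, unfolded morita_components])
  show "nu_map Sset Qset (pure_tensor (smash Sset) (QG Qset) (AG Sset)
        (homogeneous G famQ \<sigma> q) (homogeneous G famA \<alpha> a)) =
      homogeneous G Rc (\<sigma> \<otimes> \<alpha>) (q (\<sigma> \<otimes> \<alpha>) \<triangleleft>\<^bsub>Rc (\<sigma> \<otimes> \<alpha>)\<^esub> a)"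
    by (rule morita.psi_homogeneous[OF H(2,1) q H(3), unfolded morita_components])
qed

section \<open>Left homogeneously finite corings\<close>

text \<open>Consequently an equation between elements of \<open>C\<close> may be tested on linear forms, which turns the
  conditions defining \<open>S'\<close> and \<open>Q'\<close> into those defining \<open>S\<close> and \<open>Q\<close>.\<close>

lemma Rc_separates:
  assumes "left_homogeneously_finite" and \<beta>: "\<beta> \<in> carrier G"
    and "c \<in> carrier (Cinv \<beta>)" "d \<in> carrier (Cinv \<beta>)"
  shows "(\<forall>f\<in>carrier (Rc \<beta>). f c = f d) \<longleftrightarrow> c = d"
proof -
  have "left_projective A (Cinv \<beta>)"
    using assms(1) \<beta> by (simp add: left_homogeneously_finite_def)
  from left_projective_separates[OF A.ring_axioms Cmod[OF \<beta>] this assms(3,4)]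
  show ?thesis by (auto simp: Rc_def left_dual_def)
qed

lemma Sset'_eq:
  assumes "left_homogeneously_finite"
  shows "Sset' = Sset"
proof -
  have "(\<forall>\<alpha>\<in>carrier G. \<forall>\<beta>\<in>carrier G. \<forall>f\<in>carrier (Rc \<beta>).
       f (b (\<alpha> \<otimes> \<beta>) \<triangleright>\<^bsub>Cinv \<beta>\<^esub> xinv \<beta>) = f (xinv \<beta> \<triangleleft>\<^bsub>Cinv \<beta>\<^esub> b \<alpha>)) \<longleftrightarrow>
    (\<forall>\<alpha>\<in>carrier G. \<forall>\<beta>\<in>carrier G.
       b (\<alpha> \<otimes> \<beta>) \<triangleright>\<^bsub>Cinv \<beta>\<^esub> xinv \<beta> = xinv \<beta> \<triangleleft>\<^bsub>Cinv \<beta>\<^esub> b \<alpha>)"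
    if b: "b \<in> (\<Pi>\<^sub>E \<alpha>\<in>carrier G. carrier A)" for b
  proof (intro ball_cong refl Rc_separates assms)
    fix \<alpha> \<beta> assume "\<alpha> \<in> carrier G" "\<beta> \<in> carrier G"
    then show "b (\<alpha> \<otimes> \<beta>) \<triangleright>\<^bsub>Cinv \<beta>\<^esub> xinv \<beta> \<in> carrier (Cinv \<beta>)"
      "xinv \<beta> \<triangleleft>\<^bsub>Cinv \<beta>\<^esub> b \<alpha> \<in> carrier (Cinv \<beta>)"
      using PiE_mem[OF b] by (simp_all add: C_lsmult_closed C_rsmult_closed x_inv_closed)
  qed
  then show ?thesis unfolding Sset_def Sset'_def by blast
qed

lemma Qset'_eq:
  assumes "left_homogeneously_finite"
  shows "Qset' = Qset"
proof -
  have "(\<forall>\<alpha>\<in>carrier G. \<forall>\<beta>\<in>carrier G. \<forall>c\<in>carrier (Cinv (\<alpha> \<otimes> \<beta>)). \<forall>f\<in>carrier (Rc \<beta>).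
       f (contract \<alpha> \<beta> (q \<alpha>) c) = f (q (\<alpha> \<otimes> \<beta>) c \<triangleright>\<^bsub>Cinv \<beta>\<^esub> xinv \<beta>)) \<longleftrightarrow>
    (\<forall>\<alpha>\<in>carrier G. \<forall>\<beta>\<in>carrier G. \<forall>c\<in>carrier (Cinv (\<alpha> \<otimes> \<beta>)).
       contract \<alpha> \<beta> (q \<alpha>) c = q (\<alpha> \<otimes> \<beta>) c \<triangleright>\<^bsub>Cinv \<beta>\<^esub> xinv \<beta>)"
    if q: "q \<in> (\<Pi>\<^sub>E \<alpha>\<in>carrier G. carrier (Rc \<alpha>))" for q
  proof (intro ball_cong refl Rc_separates assms)
    fix \<alpha> \<beta> c
    assume H: "\<alpha> \<in> carrier G" "\<beta> \<in> carrier G" "c \<in> carrier (Cinv (\<alpha> \<otimes> \<beta>))"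
    show "contract \<alpha> \<beta> (q \<alpha>) c \<in> carrier (Cinv \<beta>)"
      by (rule contract_closed[OF H(1,2) PiE_mem[OF q H(1)] H(3)])
    have "q (\<alpha> \<otimes> \<beta>) c \<in> carrier A"
      using H by (intro Rc_apply_closed[OF PiE_mem[OF q]]) simp_all
    then show "q (\<alpha> \<otimes> \<beta>) c \<triangleright>\<^bsub>Cinv \<beta>\<^esub> xinv \<beta> \<in> carrier (Cinv \<beta>)"
      using H by (simp add: C_lsmult_closed x_inv_closed)
  qed
  then show ?thesis unfolding Qset_def Qset'_def by blast
qed

lemma GM'_eq: "left_homogeneously_finite \<Longrightarrow> GM' = GM"
  by (simp add: GM_def GM'_def Sset'_eq Qset'_eq)

end

lemma gr_ring_iso_id: "(\<lambda>r. r) \<in> gr_ring_iso G R R"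
  by (auto simp: gr_ring_iso_def ring_iso_def ring_hom_def bij_betw_def)

lemma gr_bimod_iso_id: "(\<lambda>m. m) \<in> gr_bimod_iso G A B (\<lambda>a. a) (\<lambda>b. b) M M"
  by (auto simp: gr_bimod_iso_def iso_def hom_def bij_betw_def)

lemma gr_context_isomorphic_refl: "gr_context_isomorphic G K K"
  unfolding gr_context_isomorphic_def
  \<comment> \<open>The four identity maps have different types, so each quantifier needs its own instance.\<close>
  by ((rule exI[where x = "\<lambda>u. u"])+, intro conjI ballI refl gr_ring_iso_id gr_bimod_iso_id)

theorem theorem8p8:
  fixes G :: "('g, 'w) monoid_scheme"
    and A :: "('a, 'z) ring_scheme"
    and C :: "'g \<Rightarrow> ('a, 'a, 'c) bimod"
    and \<Delta> :: "'g \<Rightarrow> 'g \<Rightarrow> 'c \<Rightarrow> ('c \<times> 'c \<Rightarrow>\<^sub>0 int) set"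
    and \<epsilon> :: "'c \<Rightarrow> 'a"
    and x :: "'g \<Rightarrow> 'c"
  assumes "group_coring_with_grouplike G A C \<Delta> \<epsilon> x"
  shows "graded_morita_context G (coring_data.GM G A C \<Delta> \<epsilon> x) \<and>
    coring_data.connecting_formulas G A C \<Delta> \<epsilon> x
      (coring_data.Sset G A C x) (coring_data.Qset G A C \<Delta> x) \<and>
    (coring_data.left_homogeneously_finite G A C \<longrightarrow>
      graded_morita_context G (coring_data.GM' G A C \<Delta> \<epsilon> x) \<and>
      coring_data.connecting_formulas G A C \<Delta> \<epsilon> x
        (coring_data.Sset' G A C x) (coring_data.Qset' G A C \<Delta> x) \<and>
      gr_context_isomorphic G (coring_data.GM' G A C \<Delta> \<epsilon> x) (coring_data.GM G A C \<Delta> \<epsilon> x))"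
proof -
  interpret group_coring_with_grouplike G A C \<Delta> \<epsilon> x by (rule assms)
  show ?thesis
    using graded_morita_context_GM connecting_formulas_GM gr_context_isomorphic_refl[of G GM]
    by (auto simp: GM'_eq Sset'_eq Qset'_eq)
qed

end
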